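(* The homomorphism $\theta:\ddot U'_h(\mathfrak{gl}_1)\to U(\bar{\mathfrak d}_q)$ determined by $$e_i\mapsto Z^iD,\quad f_i\mapsto-D^{-1}Z^i,\quad H_i\mapsto-(1-q^{-i})Z^i-q^{-i}c_{\mathfrak d}\qquad(i\in\mathbb Z),$$ whose image lies in $U(\bar{\mathfrak d}^0_q)$, provides an isomorphism $\theta:\ddot U'_h(\mathfrak{gl}_1)\to U(\bar{\mathfrak d}^0_q)$.
   Context: $h$ is a formal variable and $q=\exp(h)\in\mathbb C[[h]]$. $\ddot U'_h(\mathfrak{gl}_1)$ is the unital associative $\mathbb C[[h]]$-algebra topologically generated by $e_i,f_i,H_i$ ($i\in\mathbb Z$) subject to the following relations, where $e(z)=\sum_{i\in\mathbb Z}e_iz^{-i}$, $f(z)=\sum_{i\in\mathbb Z}f_iz^{-i}$, $q_1=q^{-1}$, $q_2=q$, $q_3=1$, and $\mathrm{Sym}_{\mathfrak S_3}$ is the sum over permutations of $i_1,i_2,i_3$: - $[H_i,H_j]=0$, $[e_i,f_j]=H_{i+j}$; - $e(z)e(w)(z-q_1w)(z-q_2w)(z-q_3w)=-e(w)e(z)(w-q_1z)(w-q_2z)(w-q_3z)$; - $f(z)f(w)(w-q_1z)(w-q_2z)(w-q_3z)=-f(w)f(z)(z-q_1w)(z-q_2w)(z-q_3w)$; - $[H_i,e_j]=-(1-q^i)(1-q^{-i})e_{i+j}$, $[H_i,f_j]=(1-q^i)(1-q^{-i})f_{i+j}$; - $\mathrm{Sym}_{\mathfrak S_3}[e_{i_1},[e_{i_2+1},e_{i_3-1}]]=0$,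 $\mathrm{Sym}_{\mathfrak S_3}[f_{i_1},[f_{i_2+1},f_{i_3-1}]]=0$. $\mathfrak d_q$ is the unital associative $\mathbb C[[h]]$-algebra topologically generated by $Z^{\pm1},D^{\pm1}$ with $DZ=qZD$ (and $ZZ^{-1}=Z^{-1}Z=1=DD^{-1}=D^{-1}D$), viewed as a Lie algebra with the commutator bracket; $\bar{\mathfrak d}_q=\mathfrak d_q\oplus\mathbb C[[h]]c_{\mathfrak d}$ is its central extension by the 2-cocycle $$\phi_{\mathfrak d}(Z^aD^j,Z^bD^{-j'})=\begin{cases}\sum_{i=-j}^{-1}q^{ai+b(i+j)}&j=j'>0\\-\sum_{i=j}^{-1}q^{bi+a(i-j)}&j=j'<0\\0&\text{otherwise.}\end{cases}$$ $\bar{\mathfrak d}^0_q\subset\bar{\mathfrak d}_q$ is the Lie subalgebra which is the free $\mathbb C[[h]]$-submodule spanned by $\{c_{\mathfrak d},hZ^kD^0,h^{j-1}Z^iD^{\pm j}\mid i\in\mathbb Z,k\in\mathbb Z\setminus\{0\},j\in\mathbb N\}$. $U(\cdot)$ denotes the universal enveloping algebra. *)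

theory Defs
  imports
    "HOL-Algebra.QuotRing"
    "HOL-Algebra.Module"
    "HOL-Combinatorics.Permutations"
    "HOL-Computational_Algebra.Formal_Power_Series"
begin

text \<open>
  The ground ring \<open>\<complex>[[h]]\<close> is the type \<open>complex fps\<close>, with \<open>h = fps_X\<close>. A unital associative
  \<open>\<complex>[[h]]\<close>-algebra is a record of type \<open>(complex fps, 'a) module\<close>: this record type extends
  \<open>'a ring\<close> (including its multiplication) by a scalar multiplication.
\<close>

type_synonym 'a halg = "(complex fps, 'a) module"

abbreviation h :: "complex fps" where "h \<equiv> fps_X"

definition q :: "complex fps" where "q = fps_exp 1"

definition alg_hom :: "'a halg \<Rightarrow> 'b halg \<Rightarrow> ('a \<Rightarrow> 'b) set" where
  "alg_hom A B = {\<theta> \<in> ring_hom A B. \<forall>c. \<forall>x \<in> carrier A. \<theta> (c \<odot>\<^bsub>A\<^esub> x) = c \<odot>\<^bsub>B\<^esub> \<theta> x}"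

definition alg_iso :: "'a halg \<Rightarrow> 'b halg \<Rightarrow> ('a \<Rightarrow> 'b) set" where
  "alg_iso A B = {\<theta> \<in> alg_hom A B. bij_betw \<theta> (carrier A) (carrier B)}"

definition commutator :: "('a, 'm) ring_scheme \<Rightarrow> 'a \<Rightarrow> 'a \<Rightarrow> 'a" where
  "commutator A x y = x \<otimes>\<^bsub>A\<^esub> y \<ominus>\<^bsub>A\<^esub> y \<otimes>\<^bsub>A\<^esub> x"


section \<open>Topologically presented algebras\<close>

text \<open>
  The \<open>h\<close>-adic completion of the free algebra \<open>\<complex>[[h]]\<langle>X\<rangle>\<close>. An element is the family of its
  coefficients at the words in \<open>X\<close>; completeness means that the coefficients need not be finitely
  supported but only have to tend to \<open>0\<close> in the \<open>h\<close>-adic topology.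
\<close>

definition free_halg :: "'x set \<Rightarrow> ('x list \<Rightarrow> complex fps) halg" where
  "free_halg X =
    \<lparr>carrier = {f. (\<forall>w. w \<notin> lists X \<longrightarrow> f w = 0) \<and> (\<forall>n. finite {w. \<not> h ^ n dvd f w})},
     monoid.mult = (\<lambda>f g w. \<Sum>k\<le>length w. f (take k w) * g (drop k w)),
     one = (\<lambda>w. if w = [] then 1 else 0),
     zero = (\<lambda>w. 0),
     add = (\<lambda>f g w. f w + g w),
     smult = (\<lambda>c f w. c * f w)\<rparr>"

definition letter :: "'x \<Rightarrow> 'x list \<Rightarrow> complex fps" where
  "letter x = (\<lambda>w. if w = [x] then 1 else 0)"

text \<open>The closure, in the \<open>h\<close>-adic topology, of the two-sided ideal generated by \<open>R\<close>.\<close>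

definition rel_ideal :: "'x set \<Rightarrow> ('x list \<Rightarrow> complex fps) set \<Rightarrow> ('x list \<Rightarrow> complex fps) set" where
  "rel_ideal X R = {f \<in> carrier (free_halg X).
     \<forall>n. \<exists>g \<in> Idl\<^bsub>free_halg X\<^esub> R. \<forall>w. h ^ n dvd f w - g w}"

text \<open>
  The algebra topologically generated by \<open>X\<close> subject to the relations \<open>r = 0\<close>, \<open>r \<in> R\<close>. It is
  complete and separated; algebra homomorphisms between such algebras are automatically continuous.
\<close>

definition presented :: "'x set \<Rightarrow> ('x list \<Rightarrow> complex fps) set \<Rightarrow> ('x list \<Rightarrow> complex fps) set halg" where
  "presented X R = ring.extend (free_halg X Quot rel_ideal X R)
     (module.fields (\<lambda>c K. \<Union>f\<in>K. rel_ideal X R +>\<^bsub>free_halg X\<^esub> (c \<odot>\<^bsub>free_halg X\<^esub> f)))"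

definition pgen :: "'x set \<Rightarrow> ('x list \<Rightarrow> complex fps) set \<Rightarrow> 'x \<Rightarrow> ('x list \<Rightarrow> complex fps) set" where
  "pgen X R x = rel_ideal X R +>\<^bsub>free_halg X\<^esub> letter x"

text \<open>
  For \<open>X \<subseteq> Y\<close> with every relation in \<open>R\<close> holding modulo \<open>S\<close>: the map
  \<open>presented X R \<rightarrow> presented Y S\<close> induced by the inclusion of generators.
\<close>

definition presented_map ::
  "'x set \<Rightarrow> ('x list \<Rightarrow> complex fps) set \<Rightarrow> ('x list \<Rightarrow> complex fps) set \<Rightarrow> ('x list \<Rightarrow> complex fps) set"
where
  "presented_map Y S K = (\<Union>f\<in>K. rel_ideal Y S +>\<^bsub>free_halg Y\<^esub> f)"


section \<open>The toroidal algebra of \<open>gl\<^sub>1\<close>\<close>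

datatype tor_gen = Ee int | Ff int | Hh int

abbreviation (input) q1 :: "complex fps" where "q1 \<equiv> q powi (-1)"
abbreviation (input) q2 :: "complex fps" where "q2 \<equiv> q"
abbreviation (input) q3 :: "complex fps" where "q3 \<equiv> 1"

text \<open>
  A formal series \<open>\<Sum>\<^sub>i\<^sub>,\<^sub>j a\<^sub>i\<^sub>j z\<^sup>-\<^sup>i w\<^sup>-\<^sup>j\<close> is represented by \<open>a\<close>. Multiplication by \<open>z\<close> replaces \<open>a\<^sub>i\<^sub>j\<close> by
  \<open>a\<^sub>i\<^sub>+\<^sub>1\<^sub>,\<^sub>j\<close>; the following are the multiplications by \<open>z - c w\<close> and by \<open>w - c z\<close>.
\<close>

definition mult_z_cw :: "'a halg \<Rightarrow> complex fps \<Rightarrow> (int \<Rightarrow> int \<Rightarrow> 'a) \<Rightarrow> int \<Rightarrow> int \<Rightarrow> 'a" where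
  "mult_z_cw A c a = (\<lambda>i j. a (i + 1) j \<ominus>\<^bsub>A\<^esub> c \<odot>\<^bsub>A\<^esub> a i (j + 1))"

definition mult_w_cz :: "'a halg \<Rightarrow> complex fps \<Rightarrow> (int \<Rightarrow> int \<Rightarrow> 'a) \<Rightarrow> int \<Rightarrow> int \<Rightarrow> 'a" where
  "mult_w_cz A c a = (\<lambda>i j. a i (j + 1) \<ominus>\<^bsub>A\<^esub> c \<odot>\<^bsub>A\<^esub> a (i + 1) j)"

definition cubic_zw :: "'a halg \<Rightarrow> (int \<Rightarrow> int \<Rightarrow> 'a) \<Rightarrow> int \<Rightarrow> int \<Rightarrow> 'a" where
  "cubic_zw A a = mult_z_cw A q1 (mult_z_cw A q2 (mult_z_cw A q3 a))"

definition cubic_wz :: "'a halg \<Rightarrow> (int \<Rightarrow> int \<Rightarrow> 'a) \<Rightarrow> int \<Rightarrow> int \<Rightarrow> 'a" where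
  "cubic_wz A a = mult_w_cz A q1 (mult_w_cz A q2 (mult_w_cz A q3 a))"

definition serre :: "'a halg \<Rightarrow> (int \<Rightarrow> 'a) \<Rightarrow> (nat \<Rightarrow> int) \<Rightarrow> 'a" where
  "serre A x i = (\<Oplus>\<^bsub>A\<^esub>\<sigma> \<in> {\<sigma>. \<sigma> permutes {1, 2, 3}}.
     commutator A (x (i (\<sigma> 1))) (commutator A (x (i (\<sigma> 2) + 1)) (x (i (\<sigma> 3) - 1))))"

abbreviation tor_free :: "(tor_gen list \<Rightarrow> complex fps) halg" where
  "tor_free \<equiv> free_halg UNIV"

definition tor_rels :: "(tor_gen list \<Rightarrow> complex fps) set" where
  "tor_rels =
    (let e = \<lambda>i. letter (Ee i); f = \<lambda>i. letter (Ff i); H = \<lambda>i. letter (Hh i) in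
      {commutator tor_free (H i) (H j) | i j. True} \<union>
      {commutator tor_free (e i) (f j) \<ominus>\<^bsub>tor_free\<^esub> H (i + j) | i j. True} \<union>
      {cubic_zw tor_free (\<lambda>i j. e i \<otimes>\<^bsub>tor_free\<^esub> e j) i j \<oplus>\<^bsub>tor_free\<^esub>
       cubic_wz tor_free (\<lambda>i j. e j \<otimes>\<^bsub>tor_free\<^esub> e i) i j | i j. True} \<union>
      {cubic_wz tor_free (\<lambda>i j. f i \<otimes>\<^bsub>tor_free\<^esub> f j) i j \<oplus>\<^bsub>tor_free\<^esub>
       cubic_zw tor_free (\<lambda>i j. f j \<otimes>\<^bsub>tor_free\<^esub> f i) i j | i j. True} \<union>
      {commutator tor_free (H i) (e j) \<ominus>\<^bsub>tor_free\<^esub>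
       (- ((1 - q powi i) * (1 - q powi (-i)))) \<odot>\<^bsub>tor_free\<^esub> e (i + j) | i j. True} \<union>
      {commutator tor_free (H i) (f j) \<ominus>\<^bsub>tor_free\<^esub>
       ((1 - q powi i) * (1 - q powi (-i))) \<odot>\<^bsub>tor_free\<^esub> f (i + j) | i j. True} \<union>
      {serre tor_free e i | i. True} \<union>
      {serre tor_free f i | i. True})"

definition toroidal :: "(tor_gen list \<Rightarrow> complex fps) set halg" where
  "toroidal = presented UNIV tor_rels"

definition tor_e :: "int \<Rightarrow> (tor_gen list \<Rightarrow> complex fps) set" where
  "tor_e i = pgen UNIV tor_rels (Ee i)"

definition tor_f :: "int \<Rightarrow> (tor_gen list \<Rightarrow> complex fps) set" where
  "tor_f i = pgen UNIV tor_rels (Ff i)"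

definition tor_H :: "int \<Rightarrow> (tor_gen list \<Rightarrow> complex fps) set" where
  "tor_H i = pgen UNIV tor_rels (Hh i)"


section \<open>The algebra \<open>\<dd>\<^sub>q\<close>\<close>

datatype d_gen = GZ | GZinv | GD | GDinv

type_synonym d_elem = "(d_gen list \<Rightarrow> complex fps) set"

abbreviation d_free :: "(d_gen list \<Rightarrow> complex fps) halg" where
  "d_free \<equiv> free_halg UNIV"

definition d_rels :: "(d_gen list \<Rightarrow> complex fps) set" where
  "d_rels =
    {letter GZ \<otimes>\<^bsub>d_free\<^esub> letter GZinv \<ominus>\<^bsub>d_free\<^esub> \<one>\<^bsub>d_free\<^esub>,
     letter GZinv \<otimes>\<^bsub>d_free\<^esub> letter GZ \<ominus>\<^bsub>d_free\<^esub> \<one>\<^bsub>d_free\<^esub>,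
     letter GD \<otimes>\<^bsub>d_free\<^esub> letter GDinv \<ominus>\<^bsub>d_free\<^esub> \<one>\<^bsub>d_free\<^esub>,
     letter GDinv \<otimes>\<^bsub>d_free\<^esub> letter GD \<ominus>\<^bsub>d_free\<^esub> \<one>\<^bsub>d_free\<^esub>,
     letter GD \<otimes>\<^bsub>d_free\<^esub> letter GZ \<ominus>\<^bsub>d_free\<^esub> q \<odot>\<^bsub>d_free\<^esub> (letter GZ \<otimes>\<^bsub>d_free\<^esub> letter GD)}"

definition dq :: "d_elem halg" where
  "dq = presented UNIV d_rels"

text \<open>Integer powers in \<open>\<dd>\<^sub>q\<close>; the negative ones are powers of the inverse in \<open>\<dd>\<^sub>q\<close>.\<close>

definition Zpow :: "int \<Rightarrow> d_elem" where
  "Zpow a = pgen UNIV d_rels GZ [^]\<^bsub>dq\<^esub> a"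

definition Dpow :: "int \<Rightarrow> d_elem" where
  "Dpow j = pgen UNIV d_rels GD [^]\<^bsub>dq\<^esub> j"

definition ZD :: "int \<Rightarrow> int \<Rightarrow> d_elem" where
  "ZD a j = Zpow a \<otimes>\<^bsub>dq\<^esub> Dpow j"


section \<open>Lie algebras and universal enveloping algebras\<close>

text \<open>Only the part of the structure that enters the presentation of the enveloping algebra.\<close>

record 'a hlie = "'a partial_object" +
  lie_add :: "'a \<Rightarrow> 'a \<Rightarrow> 'a"
  lie_smult :: "complex fps \<Rightarrow> 'a \<Rightarrow> 'a"
  lie_bracket :: "'a \<Rightarrow> 'a \<Rightarrow> 'a"

text \<open>
  The (\<open>h\<close>-adically completed) universal enveloping algebra. The tensor algebra of the
  \<open>\<complex>[[h]]\<close>-module underlying \<open>L\<close> is obtained from the free algebra on the set \<open>carrier L\<close> by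
  imposing linearity, which is the first two families of relations.
\<close>

definition uea_rels :: "'a hlie \<Rightarrow> ('a list \<Rightarrow> complex fps) set" where
  "uea_rels L = (let F = free_halg (carrier L) in
     {letter (lie_add L x y) \<ominus>\<^bsub>F\<^esub> (letter x \<oplus>\<^bsub>F\<^esub> letter y) | x y.
        x \<in> carrier L \<and> y \<in> carrier L} \<union>
     {letter (lie_smult L c x) \<ominus>\<^bsub>F\<^esub> c \<odot>\<^bsub>F\<^esub> letter x | c x. x \<in> carrier L} \<union>
     {commutator F (letter x) (letter y) \<ominus>\<^bsub>F\<^esub> letter (lie_bracket L x y) | x y.
        x \<in> carrier L \<and> y \<in> carrier L})"

definition uea :: "'a hlie \<Rightarrow> ('a list \<Rightarrow> complex fps) set halg" where
  "uea L = presented (carrier L) (uea_rels L)"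

definition uea_of :: "'a hlie \<Rightarrow> 'a \<Rightarrow> ('a list \<Rightarrow> complex fps) set" where
  "uea_of L x = pgen (carrier L) (uea_rels L) x"

text \<open>For a Lie subalgebra of \<open>M\<close>, the homomorphism from its enveloping algebra into \<open>uea M\<close>.\<close>

definition uea_incl :: "'a hlie \<Rightarrow> ('a list \<Rightarrow> complex fps) set \<Rightarrow> ('a list \<Rightarrow> complex fps) set" where
  "uea_incl M = presented_map (carrier M) (uea_rels M)"

inductive_set lie_span :: "'a hlie \<Rightarrow> 'a set \<Rightarrow> 'a set" for L S where
  base: "x \<in> S \<Longrightarrow> x \<in> lie_span L S"
| add: "x \<in> lie_span L S \<Longrightarrow> y \<in> lie_span L S \<Longrightarrow> lie_add L x y \<in> lie_span L S"
| smult: "x \<in> lie_span L S \<Longrightarrow> lie_smult L c x \<in> lie_span L S"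


section \<open>The central extension of \<open>\<dd>\<^sub>q\<close> and its subalgebra\<close>

definition cocycle_val :: "int \<Rightarrow> int \<Rightarrow> int \<Rightarrow> int \<Rightarrow> complex fps" where
  "cocycle_val a j b j' =
    (if j = j' \<and> j > 0 then \<Sum>i = -j..-1. q powi (a * i + b * (i + j))
     else if j = j' \<and> j < 0 then - (\<Sum>i = j..-1. q powi (b * i + a * (i - j)))
     else 0)"

text \<open>
  \<open>\<complex>[[h]]\<close>-bilinear maps are \<open>h\<close>-adically continuous, and the \<open>Z\<^sup>a D\<^sup>j\<close> span a dense submodule of
  \<open>\<dd>\<^sub>q\<close>; so the following conditions determine the values of \<open>\<phi>\<close> on \<open>carrier dq\<close>.
\<close>

definition is_cocycle_d :: "(d_elem \<Rightarrow> d_elem \<Rightarrow> complex fps) \<Rightarrow> bool" where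
  "is_cocycle_d \<phi> \<longleftrightarrow>
    (\<forall>x\<in>carrier dq. \<forall>y\<in>carrier dq. \<forall>z\<in>carrier dq.
       \<phi> (x \<oplus>\<^bsub>dq\<^esub> y) z = \<phi> x z + \<phi> y z \<and> \<phi> z (x \<oplus>\<^bsub>dq\<^esub> y) = \<phi> z x + \<phi> z y) \<and>
    (\<forall>c. \<forall>x\<in>carrier dq. \<forall>y\<in>carrier dq.
       \<phi> (c \<odot>\<^bsub>dq\<^esub> x) y = c * \<phi> x y \<and> \<phi> x (c \<odot>\<^bsub>dq\<^esub> y) = c * \<phi> x y) \<and>
    (\<forall>a j b j'. \<phi> (ZD a j) (ZD b (- j')) = cocycle_val a j b j')"

definition cocycle_d :: "d_elem \<Rightarrow> d_elem \<Rightarrow> complex fps" where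
  "cocycle_d = (SOME \<phi>. is_cocycle_d \<phi>)"

text \<open>The pair \<open>(x, s)\<close> stands for \<open>x + s c\<close>, where \<open>c\<close> is the central element.\<close>

definition bar_dq :: "(d_elem \<times> complex fps) hlie" where
  "bar_dq =
    \<lparr>carrier = carrier dq \<times> UNIV,
     lie_add = (\<lambda>(x, s) (y, t). (x \<oplus>\<^bsub>dq\<^esub> y, s + t)),
     lie_smult = (\<lambda>c (x, s). (c \<odot>\<^bsub>dq\<^esub> x, c * s)),
     lie_bracket = (\<lambda>(x, s) (y, t). (commutator dq x y, cocycle_d x y))\<rparr>"

definition bar_dq0 :: "(d_elem \<times> complex fps) hlie" where
  "bar_dq0 = bar_dq\<lparr>carrier := lie_span bar_dq
     ({(\<zero>\<^bsub>dq\<^esub>, 1)} \<union>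
      {(h \<odot>\<^bsub>dq\<^esub> ZD k 0, 0) | k. k \<noteq> 0} \<union>
      {(h ^ (j - 1) \<odot>\<^bsub>dq\<^esub> ZD i (int j), 0) | i j. 1 \<le> j} \<union>
      {(h ^ (j - 1) \<odot>\<^bsub>dq\<^esub> ZD i (- int j), 0) | i j. 1 \<le> j})\<rparr>"

definition theta_on_generators ::
  "((tor_gen list \<Rightarrow> complex fps) set \<Rightarrow> ((d_elem \<times> complex fps) list \<Rightarrow> complex fps) set) \<Rightarrow> bool"
where
  "theta_on_generators \<theta> \<longleftrightarrow> (\<forall>i.
     \<theta> (tor_e i) = uea_of bar_dq (Zpow i \<otimes>\<^bsub>dq\<^esub> Dpow 1, 0) \<and>
     \<theta> (tor_f i) = uea_of bar_dq (\<ominus>\<^bsub>dq\<^esub> (Dpow (-1) \<otimes>\<^bsub>dq\<^esub> Zpow i), 0) \<and>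
     \<theta> (tor_H i) = uea_of bar_dq ((- (1 - q powi (-i))) \<odot>\<^bsub>dq\<^esub> Zpow i, - (q powi (-i))))"

end

theory Submission
  imports Defs "HOL-Library.Option_ord"
begin

text \<open>
  Modulo the relations, every generator of the toroidal algebra is a Lie algebra element and every
  relation is a Lie algebra relation: with \<open>q\<^sub>1 = q\<^sup>-\<^sup>1\<close>, \<open>q\<^sub>2 = q\<close>, \<open>q\<^sub>3 = 1\<close> the two cubic factors in
  the \<open>e\<close>-\<open>e\<close> relation agree up to sign, so that it says \<open>(z - q\<^sup>-\<^sup>1w)(z - q w)(z - w) [e(z), e(w)] = 0\<close>.
  All relations hold for the images in \<open>bar_dq0\<close> (\<open>Th_trels\<close>), which gives \<open>\<theta>\<close>. The question is
  whether the toroidal algebra is too big, and the answer is that it is not even so modulo \<open>h\<close>.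

  \<^emph>\<open>Classical limit.\<close> For \<open>q = 1\<close> the \<open>H\<^sub>i\<close> become central, \<open>[e\<^sub>i, f\<^sub>j] = H\<^sub>i\<^sub>+\<^sub>j\<close>, and everything depends on
  the Lie algebra generated by the \<open>e\<^sub>i\<close>. Each bidegree of it is spanned by a single element \<open>X\<^sub>a\<^sub>,\<^sub>n\<close>,
  with \<open>[e\<^sub>a, X\<^sub>b\<^sub>,\<^sub>n] = (b - n a) X\<^sub>a\<^sub>+\<^sub>b\<^sub>,\<^sub>n\<^sub>+\<^sub>1\<close> (\<open>poisson_rule_all\<close>); this is the Poisson bracket of the monomials
  \<open>x\<^sup>a y\<close> and \<open>x\<^sup>b y\<^sup>n\<close>. In degree 2 this follows from the cubic relation, in degree 3 from the Serre
  relation. In degree \<open>n + 1 \<ge> 4\<close> the Jacobi identity alone suffices: it yields a functional equation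
  for \<open>a \<mapsto> [e\<^sub>a, X\<^sub>s\<^sub>-\<^sub>a\<^sub>,\<^sub>n]\<close> whose only solutions are the multiples of \<open>s - (n + 1) a\<close> (\<open>affine_jacobi\<close>).

  \<^emph>\<open>Injectivity.\<close> Consequently the ordered monomials in lifts of the \<open>H\<^sub>a\<close>, the \<open>X\<^sub>a\<^sub>,\<^sub>n\<close> and their
  counterparts for the \<open>f\<^sub>i\<close> span the toroidal algebra modulo \<open>h\<close>, hence, by completeness, topologically (\<open>spanning\<close>). The lifts can be taken such
  that \<open>\<theta>\<close> sends them to multiples \<open>v h\<^sup>k Z\<^sup>a D\<^sup>j\<close> of the basis elements with \<open>v\<close> invertible
  (\<open>lifts_basis_lift\<close>). Ordered monomials in the basis of \<open>bar_dq\<close> are linearly independent in its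
  enveloping algebra by the Poincare-Birkhoff-Witt theorem, proved here by a confluent reduction
  (\<open>swapped_descent\<close>, \<open>pbw_coords_Rel\<close>). So a convergent combination of ordered monomials that is
  killed by \<open>\<theta>\<close> has zero coefficients (\<open>Th_inj\<close>).

  \<^emph>\<open>Surjectivity\<close> onto the enveloping algebra of \<open>bar_dq0\<close> holds because the lifts hit a spanning set
  of \<open>bar_dq0\<close> up to invertible scalars (\<open>Th_surj\<close>); together with the injectivity of \<open>\<theta>\<close> this also
  yields that of the map between the two enveloping algebras.

  All modules that occur are completions of free modules. They are realised by one type \<open>'i hs\<close>, on
  which \<open>\<complex>[[h]]\<close>-linear maps are automatically continuous, so that identities between multilinear
  maps need to be verified on basis elements only (\<open>hlin_mem_closed\<close>, \<open>hlin_eqI\<close>).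
\<close>

unbundle fps_syntax

section \<open>Completed free modules over the power series ring\<close>

lemma h_power_dvd_iff: "h ^ n dvd (f :: complex fps) \<longleftrightarrow> (\<forall>k<n. f $ k = 0)"
proof
  assume "h ^ n dvd f"
  then show "\<forall>k<n. f $ k = 0" by (auto elim!: dvdE simp: fps_X_power_mult_nth)
next
  assume *: "\<forall>k<n. f $ k = 0"
  have "f = h ^ n * fps_shift n f"
    by (rule fps_ext) (use * in \<open>auto simp: fps_X_power_mult_nth\<close>)
  then show "h ^ n dvd f" by (metis dvd_triv_left)
qed

lemma h_adic_separated: "(\<And>n. h ^ n dvd (f :: complex fps)) \<Longrightarrow> f = 0"
  by (rule fps_ext) (metis h_power_dvd_iff fps_zero_nth lessI)

text \<open>
  The \<open>h\<close>-adic completion of the free module with basis \<open>'i\<close>: families of coefficients that tend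
  to \<open>0\<close>. Words as indices give the completed free algebra, monomials \<open>Z\<^sup>a D\<^sup>j\<close> the algebra \<open>\<dd>\<^sub>q\<close>, and so on.
\<close>

typedef 'i hs = "{f :: 'i \<Rightarrow> complex fps. \<forall>n. finite {i. \<not> h ^ n dvd f i}}"
  morphisms coef Abs_hs
  by (rule exI[of _ "\<lambda>_. 0"]) auto

setup_lifting type_definition_hs

lemma finite_coef: "finite {i. \<not> h ^ n dvd coef x i}"
  using coef[of x] by blast

lemma hs_eqI: "(\<And>i. coef x i = coef y i) \<Longrightarrow> x = y"
  by (simp add: coef_inject[symmetric] fun_eq_iff)

instantiation hs :: (type) ab_group_add
begin
lift_definition zero_hs :: "'a hs" is "\<lambda>_. 0" by simp
lift_definition plus_hs :: "'a hs \<Rightarrow> 'a hs \<Rightarrow> 'a hs" is "\<lambda>f g i. f i + g i"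
  subgoal premises prems for f g n
    by (rule finite_subset[OF _ finite_UnI[OF prems(1)[of n] prems(2)[of n]]]) (auto intro: dvd_add)
  done
lift_definition uminus_hs :: "'a hs \<Rightarrow> 'a hs" is "\<lambda>f i. - f i" by simp
lift_definition minus_hs :: "'a hs \<Rightarrow> 'a hs \<Rightarrow> 'a hs" is "\<lambda>f g i. f i - g i"
  subgoal premises prems for f g n
    by (rule finite_subset[OF _ finite_UnI[OF prems(1)[of n] prems(2)[of n]]]) (auto intro: dvd_diff)
  done
instance by standard (transfer; simp add: algebra_simps fun_eq_iff)+
end

lift_definition hscale :: "complex fps \<Rightarrow> 'i hs \<Rightarrow> 'i hs" (infixr "\<bullet>" 75) is "\<lambda>c f i. c * f i"
  subgoal premises prems for c f n
    by (rule finite_subset[OF _ prems[of n]]) auto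
  done

lift_definition single :: "'i \<Rightarrow> 'i hs" is "\<lambda>i j. if j = i then 1 else 0"
  subgoal for i n
    by (rule finite_subset[of _ "{i}"]) auto
  done

lemma coef_simps [simp]:
  "coef 0 i = 0" "coef (x + y) i = coef x i + coef y i" "coef (- x) i = - coef x i"
  "coef (x - y) i = coef x i - coef y i" "coef (c \<bullet> x) i = c * coef x i"
  "coef (single k) i = (if i = k then 1 else 0)"
  by (transfer; simp)+

lemma coef_sum [simp]: "coef (sum f A) i = (\<Sum>a\<in>A. coef (f a) i)"
  by (induction A rule: infinite_finite_induct) auto

interpretation hs: Modules.module "(\<bullet>) :: complex fps \<Rightarrow> 'i hs \<Rightarrow> 'i hs"
  by unfold_locales (rule hs_eqI; simp add: algebra_simps)+

lemma single_neq_0 [simp]: "single i \<noteq> 0"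
  by (metis coef_simps(1,6) one_neq_zero)

text \<open>
  Every element is a finite combination of basis elements up to a multiple of \<open>h\<^sup>n\<close>; this is what
  makes \<open>\<complex>[[h]]\<close>-linear maps automatically continuous.
\<close>

lemma hs_approx:
  obtains y where "x = (\<Sum>i | \<not> h ^ n dvd coef x i. coef x i \<bullet> single i) + h ^ n \<bullet> y"
proof -
  define f where "f i = (if h ^ n dvd coef x i then fps_shift n (coef x i) else 0)" for i
  have eq: "h ^ n * f i = coef x i" if "h ^ n dvd coef x i" for i
    using that unfolding f_def h_power_dvd_iff
    by (auto intro!: fps_ext simp: fps_X_power_mult_nth)
  have fin: "finite {i. \<not> h ^ m dvd f i}" for m
  proof (rule finite_subset[OF _ finite_coef[of "n + m" x]], safe)
    fix i assume "\<not> h ^ m dvd f i" and d: "h ^ (n + m) dvd coef x i"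
    moreover have d': "h ^ n dvd coef x i" using d by (metis dvd_mult_left power_add)
    moreover have "h ^ n * h ^ m dvd h ^ n * f i" using d eq[OF d'] by (simp add: power_add)
    ultimately show False by (simp add: dvd_mult_cancel_left)
  qed
  define y where "y = Abs_hs f"
  have cy: "coef y i = f i" for i
    unfolding y_def using fin by (subst Abs_hs_inverse) auto
  show ?thesis
  proof (rule that[of y], rule hs_eqI)
    fix i
    have "(\<Sum>j | \<not> h ^ n dvd coef x j. coef x j * (if i = j then 1 else 0))
        = (if \<not> h ^ n dvd coef x i then coef x i else 0)"
      by (subst sum.mono_neutral_cong_right[of _ "{i} \<inter> {j. \<not> h ^ n dvd coef x j}"])
         (auto simp: finite_coef)
    moreover have "h ^ n * f i = (if \<not> h ^ n dvd coef x i then 0 else coef x i)"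
      using eq[of i] by (simp add: f_def)
    ultimately show "coef x i = coef ((\<Sum>i | \<not> h ^ n dvd coef x i. coef x i \<bullet> single i) + h ^ n \<bullet> y) i"
      by (simp add: cy)
  qed
qed

definition supp :: "'i hs \<Rightarrow> 'i set" where "supp x = {i. coef x i \<noteq> 0}"

definition hlin :: "('i hs \<Rightarrow> 'j hs) \<Rightarrow> bool" where
  "hlin T \<longleftrightarrow> (\<forall>x y. T (x + y) = T x + T y) \<and> (\<forall>c x. T (c \<bullet> x) = c \<bullet> T x)"

text \<open>
  Submodules that contain the \<open>h\<close>-adic limits of their elements. The ideals that define the
  presented algebras are of this kind.
\<close>

definition hclosed :: "'i hs set \<Rightarrow> bool" where
  "hclosed J \<longleftrightarrow> 0 \<in> J \<and> (\<forall>x\<in>J. \<forall>y\<in>J. x + y \<in> J) \<and> (\<forall>c. \<forall>x\<in>J. c \<bullet> x \<in> J) \<and>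
     (\<forall>x. (\<forall>n. \<exists>y. x - h ^ n \<bullet> y \<in> J) \<longrightarrow> x \<in> J)"

lemma hlin_add: "hlin T \<Longrightarrow> T (x + y) = T x + T y"
  and hlin_scale: "hlin T \<Longrightarrow> T (c \<bullet> x) = c \<bullet> T x"
  by (simp_all add: hlin_def)

lemma hlin_zero: "hlin T \<Longrightarrow> T 0 = 0"
  using hlin_scale[of T 0 0] by simp

lemma hlin_minus: "hlin T \<Longrightarrow> T (- x) = - T x"
  using hlin_scale[of T "- 1" x] by simp

lemma hlin_diff: "hlin T \<Longrightarrow> T (x - y) = T x - T y"
  using hlin_add[of T x "- y"] by (simp add: hlin_minus)

lemma hlin_sum: "hlin T \<Longrightarrow> T (sum f A) = (\<Sum>a\<in>A. T (f a))"
  by (induction A rule: infinite_finite_induct) (auto simp: hlin_zero hlin_add)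

lemma hclosed_zero: "hclosed J \<Longrightarrow> 0 \<in> J"
  and hclosed_add: "hclosed J \<Longrightarrow> x \<in> J \<Longrightarrow> y \<in> J \<Longrightarrow> x + y \<in> J"
  and hclosed_scale: "hclosed J \<Longrightarrow> x \<in> J \<Longrightarrow> c \<bullet> x \<in> J"
  and hclosed_limit: "hclosed J \<Longrightarrow> (\<And>n. \<exists>y. x - h ^ n \<bullet> y \<in> J) \<Longrightarrow> x \<in> J"
  by (auto simp: hclosed_def)

lemma hclosed_minus: "hclosed J \<Longrightarrow> x \<in> J \<Longrightarrow> - x \<in> J"
  using hclosed_scale[of J x "- 1"] by simp

lemma hclosed_diff: "hclosed J \<Longrightarrow> x \<in> J \<Longrightarrow> y \<in> J \<Longrightarrow> x - y \<in> J"
  using hclosed_add[of J x "- y"] by (simp add: hclosed_minus)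

lemma hclosed_sum: "hclosed J \<Longrightarrow> (\<And>a. a \<in> A \<Longrightarrow> f a \<in> J) \<Longrightarrow> sum f A \<in> J"
  by (induction A rule: infinite_finite_induct) (auto simp: hclosed_zero hclosed_add)

lemma hclosed_singleton_zero: "hclosed {0}"
  unfolding hclosed_def
proof (intro conjI allI impI)
  fix x :: "'a hs" assume *: "\<forall>n. \<exists>y. x - h ^ n \<bullet> y \<in> {0}"
  have "coef x i = 0" for i
  proof (rule h_adic_separated)
    fix n obtain y where "x = h ^ n \<bullet> y" using * by auto
    then show "h ^ n dvd coef x i" by simp
  qed
  then show "x \<in> {0}" by (auto intro: hs_eqI)
qed auto

text \<open>
  The workhorse: by automatic continuity, a statement about all elements that is linear and closed
  needs to be checked on basis elements only.
\<close>

lemma hlin_mem_closed: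
  assumes "hlin T" "hclosed J" "\<And>i. i \<in> supp x \<Longrightarrow> T (single i) \<in> J"
  shows "T x \<in> J"
proof (rule hclosed_limit[OF assms(2)])
  fix n
  obtain y where y: "x = (\<Sum>i | \<not> h ^ n dvd coef x i. coef x i \<bullet> single i) + h ^ n \<bullet> y"
    by (rule hs_approx)
  have "T x - h ^ n \<bullet> T y = (\<Sum>i | \<not> h ^ n dvd coef x i. coef x i \<bullet> T (single i))"
    using assms(1) by (subst y) (simp add: hlin_add hlin_scale hlin_sum)
  also have "\<dots> \<in> J"
    by (rule hclosed_sum[OF assms(2)], rule hclosed_scale[OF assms(2)], rule assms(3))
       (auto simp: supp_def)
  finally show "\<exists>y. T x - h ^ n \<bullet> y \<in> J" by blast
qed

named_theorems hlin_intro

lemma hlin_id_intro [hlin_intro]: "hlin (\<lambda>x. x)"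
  by (simp add: hlin_def)

lemma hlin_add_intro [hlin_intro]: "hlin S \<Longrightarrow> hlin T \<Longrightarrow> hlin (\<lambda>x. S x + T x)"
  by (simp add: hlin_def algebra_simps)

lemma hlin_diff_intro [hlin_intro]: "hlin S \<Longrightarrow> hlin T \<Longrightarrow> hlin (\<lambda>x. S x - T x)"
  by (simp add: hlin_def hs.scale_right_diff_distrib)

lemma hlin_scale_intro [hlin_intro]: "hlin T \<Longrightarrow> hlin (\<lambda>x. c \<bullet> T x)"
  by (simp add: hlin_def hs.scale_right_distrib mult.commute)

lemma hlin_zero_intro [hlin_intro]: "hlin (\<lambda>x. 0)"
  by (simp add: hlin_def)

lemma hlin_eqI:
  assumes "hlin S" "hlin T" "\<And>i. S (single i) = T (single i)"
  shows "S x = T x"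
  using hlin_mem_closed[OF hlin_diff_intro[OF assms(1,2)] hclosed_singleton_zero, of x] assms(3)
  by auto

subsection \<open>Linear extension\<close>

text \<open>
  The sum of all \<open>x\<^sub>i g\<^sub>i\<close>. It converges because the \<open>x\<^sub>i\<close> tend to \<open>0\<close>; since coefficient \<open>n\<close> only
  depends on the finitely many \<open>x\<^sub>i\<close> that are nonzero modulo \<open>h\<^sup>n\<^sup>+\<^sup>1\<close>, it can be written down without limits.
\<close>

lift_definition ext :: "('i \<Rightarrow> 'j hs) \<Rightarrow> 'i hs \<Rightarrow> 'j hs" is
  "\<lambda>g x j. Abs_fps (\<lambda>n. (\<Sum>i | \<not> h ^ Suc n dvd x i. x i * g i j) $ n)"
  subgoal premises prems for g x n
  proof -
    have fin: "finite {i. \<not> h ^ n dvd x i}" for n using prems(2) by auto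
    have finj: "finite {j. \<not> h ^ n dvd g i j}" for i using prems(1) by auto
    show "finite {j. \<not> h ^ n dvd Abs_fps (\<lambda>n. (\<Sum>i | \<not> h ^ Suc n dvd x i. x i * g i j) $ n)}"
    proof (rule finite_subset[of _ "\<Union>i\<in>{i. \<not> h ^ n dvd x i}. {j. \<not> h ^ n dvd g i j}"])
      show "finite (\<Union>i\<in>{i. \<not> h ^ n dvd x i}. {j. \<not> h ^ n dvd g i j})"
        using fin finj by auto
      show "{j. \<not> h ^ n dvd Abs_fps (\<lambda>n. (\<Sum>i | \<not> h ^ Suc n dvd x i. x i * g i j) $ n)}
          \<subseteq> (\<Union>i\<in>{i. \<not> h ^ n dvd x i}. {j. \<not> h ^ n dvd g i j})"
      proof (rule subsetI, rule ccontr)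
        fix j
        assume j: "j \<in> {j. \<not> h ^ n dvd Abs_fps (\<lambda>n. (\<Sum>i | \<not> h ^ Suc n dvd x i. x i * g i j) $ n)}"
          and "j \<notin> (\<Union>i\<in>{i. \<not> h ^ n dvd x i}. {j. \<not> h ^ n dvd g i j})"
        then have *: "h ^ n dvd x i * g i j" for i by (cases "h ^ n dvd x i") auto
        have "Abs_fps (\<lambda>n. (\<Sum>i | \<not> h ^ Suc n dvd x i. x i * g i j) $ n) $ k = 0" if "k < n" for k
        proof -
          have "h ^ n dvd (\<Sum>i | \<not> h ^ Suc k dvd x i. x i * g i j)"
            by (rule dvd_sum) (rule *)
          then show ?thesis using that by (simp add: h_power_dvd_iff)
        qed
        then show False using j by (auto simp: h_power_dvd_iff)
      qed
    qed
  qed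
  done

lemma ext_approx:
  assumes "finite A" "{i. \<not> h ^ n dvd coef x i} \<subseteq> A"
  shows "h ^ n dvd coef (ext g x) j - (\<Sum>i\<in>A. coef x i * coef (g i) j)"
  unfolding h_power_dvd_iff
proof (intro allI impI)
  fix k assume k: "k < n"
  have sub: "{i. \<not> h ^ Suc k dvd coef x i} \<subseteq> A"
    using assms(2) dvd_trans[OF le_imp_power_dvd[of "Suc k" n h]] k by (auto simp del: power_Suc)
  have "(\<Sum>i\<in>A. coef x i * coef (g i) j) $ k = (\<Sum>i\<in>A. (coef x i * coef (g i) j) $ k)"
    by (simp add: fps_sum_nth)
  also have "\<dots> = (\<Sum>i | \<not> h ^ Suc k dvd coef x i. (coef x i * coef (g i) j) $ k)"
  proof (rule sum.mono_neutral_right[OF assms(1) sub], rule ballI)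
    fix i assume "i \<in> A - {i. \<not> h ^ Suc k dvd coef x i}"
    then have "h ^ Suc k dvd coef x i * coef (g i) j" by (auto intro: dvd_mult2)
    then show "(coef x i * coef (g i) j) $ k = 0" by (simp add: h_power_dvd_iff del: power_Suc)
  qed
  finally show "(coef (ext g x) j - (\<Sum>i\<in>A. coef x i * coef (g i) j)) $ k = 0"
    by (simp add: ext.rep_eq fps_sum_nth)
qed

lemma ext_eqI:
  assumes "\<And>n. \<exists>A. finite A \<and> {i. \<not> h ^ n dvd coef x i} \<subseteq> A \<and>
     h ^ n dvd (\<Sum>i\<in>A. coef x i * coef (g i) j) - b"
  shows "coef (ext g x) j = b"
proof -
  have "coef (ext g x) j - b = 0"
  proof (rule h_adic_separated)
    fix n
    obtain A where A: "finite A" "{i. \<not> h ^ n dvd coef x i} \<subseteq> A"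
      and d: "h ^ n dvd (\<Sum>i\<in>A. coef x i * coef (g i) j) - b"
      using assms[of n] by blast
    show "h ^ n dvd coef (ext g x) j - b"
      using dvd_add[OF ext_approx[OF A, of g j] d] by simp
  qed
  then show ?thesis by simp
qed

lemma hlin_ext: "hlin (ext g)"
  unfolding hlin_def
proof (intro conjI allI; rule hs_eqI)
  fix x y :: "'a hs" and j
  show "coef (ext g (x + y)) j = coef (ext g x + ext g y) j"
  proof (rule ext_eqI, intro exI conjI)
    fix n
    let ?A = "{i. \<not> h ^ n dvd coef x i} \<union> {i. \<not> h ^ n dvd coef y i}"
    show fin: "finite ?A" by (simp add: finite_coef)
    show "{i. \<not> h ^ n dvd coef (x + y) i} \<subseteq> ?A" by (auto intro: dvd_add)
    have "h ^ n dvd - ((coef (ext g x) j - (\<Sum>i\<in>?A. coef x i * coef (g i) j)) +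
       (coef (ext g y) j - (\<Sum>i\<in>?A. coef y i * coef (g i) j)))"
      by (subst dvd_minus_iff, rule dvd_add; rule ext_approx[OF fin]) auto
    then show "h ^ n dvd (\<Sum>i\<in>?A. coef (x + y) i * coef (g i) j) - coef (ext g x + ext g y) j"
      by (simp add: algebra_simps sum.distrib)
  qed
next
  fix c and x :: "'a hs" and j
  show "coef (ext g (c \<bullet> x)) j = coef (c \<bullet> ext g x) j"
  proof (rule ext_eqI, intro exI conjI)
    fix n
    let ?A = "{i. \<not> h ^ n dvd coef x i}"
    show fin: "finite ?A" by (simp add: finite_coef)
    show "{i. \<not> h ^ n dvd coef (c \<bullet> x) i} \<subseteq> ?A" by auto
    have "h ^ n dvd - (c * (coef (ext g x) j - (\<Sum>i\<in>?A. coef x i * coef (g i) j)))"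
      by (subst dvd_minus_iff, rule dvd_mult; rule ext_approx[OF fin]) auto
    then show "h ^ n dvd (\<Sum>i\<in>?A. coef (c \<bullet> x) i * coef (g i) j) - coef (c \<bullet> ext g x) j"
      by (simp add: algebra_simps sum_distrib_left)
  qed
qed

lemma ext_single [simp]: "ext g (single i) = g i"
proof (rule hs_eqI, rule ext_eqI, intro exI conjI)
  fix n j
  show "finite {i}" by simp
  show "{k. \<not> h ^ n dvd coef (single i) k} \<subseteq> {i}" by auto
  show "h ^ n dvd (\<Sum>k\<in>{i}. coef (single i) k * coef (g k) j) - coef (g i) j" by simp
qed

lemma hlin_ext_intro [hlin_intro]: "hlin T \<Longrightarrow> hlin (\<lambda>x. ext g (T x))"
  using hlin_ext[of g] by (simp add: hlin_def)

lemma hlin_comp: "hlin S \<Longrightarrow> hlin T \<Longrightarrow> hlin (\<lambda>x. S (T x))"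
  by (simp add: hlin_def)

lemma hlin_ext_family [hlin_intro]:
  assumes "\<And>i. hlin (\<lambda>x. g x i)"
  shows "hlin (\<lambda>x. ext (g x) y)"
  unfolding hlin_def
proof (intro conjI allI)
  fix u v
  show "ext (g (u + v)) y = ext (g u) y + ext (g v) y"
    by (rule hlin_eqI[where x = y]) (auto intro!: hlin_intro simp: hlin_add[OF assms])
next
  fix c u
  show "ext (g (c \<bullet> u)) y = c \<bullet> ext (g u) y"
    by (rule hlin_eqI[where x = y]) (auto intro!: hlin_intro simp: hlin_scale[OF assms])
qed

lemma hlin_ext_comp: "hlin T \<Longrightarrow> T (ext g x) = ext (\<lambda>i. T (g i)) x"
  by (rule hlin_eqI[where x = x]) (auto intro!: hlin_intro intro: hlin_comp)

lemma ext_single_id [simp]: "ext single x = x"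
  by (rule hlin_eqI[where x = x]) (auto intro!: hlin_intro)

subsection \<open>Twisted monoid algebras\<close>

text \<open>
  One construction for the two algebras with a monomial basis: the free algebra, where the twist is
  trivial, and \<open>\<dd>\<^sub>q\<close>, where \<open>D\<^sup>i Z\<^sup>b = q\<^sup>i\<^sup>b Z\<^sup>b D\<^sup>i\<close> makes it \<open>q\<^sup>i\<^sup>b\<close>.
\<close>

class twisted_monoid =
  fixes twist :: "'a \<Rightarrow> 'a \<Rightarrow> complex fps" and tmul :: "'a \<Rightarrow> 'a \<Rightarrow> 'a" and tone :: 'a
  assumes tmul_assoc: "tmul (tmul a b) c = tmul a (tmul b c)"
    and tmul_one [simp]: "tmul tone a = a" "tmul a tone = a"
    and twist_assoc: "twist a b * twist (tmul a b) c = twist b c * twist a (tmul b c)"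
    and twist_one [simp]: "twist tone a = 1" "twist a tone = 1"

definition tprod :: "'a::twisted_monoid hs \<Rightarrow> 'a hs \<Rightarrow> 'a hs" where
  "tprod x y = ext (\<lambda>u. ext (\<lambda>v. twist u v \<bullet> single (tmul u v)) y) x"

lemma hlin_tprod_left: "hlin (\<lambda>x. tprod x y)"
  unfolding tprod_def by (intro hlin_intro)

lemma hlin_tprod_right: "hlin (\<lambda>y. tprod x y)"
  unfolding tprod_def by (intro hlin_intro)

lemma tprod_single: "tprod (single u) (single v) = twist u v \<bullet> single (tmul u v)"
  by (simp add: tprod_def)

lemma tprod_assoc: "tprod (tprod x y) z = tprod x (tprod y z)"
proof -
  have *: "tprod (tprod (single u) (single v)) (single w) = tprod (single u) (tprod (single v) (single w))"
    for u v w :: 'a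
    by (simp add: tprod_single hlin_scale[OF hlin_tprod_left] hlin_scale[OF hlin_tprod_right]
        tmul_assoc twist_assoc)
  have **: "tprod (tprod (single u) (single v)) z = tprod (single u) (tprod (single v) z)" for u v :: 'a and z
    by (rule hlin_eqI[where x = z])
       (auto intro!: * hlin_tprod_right hlin_comp[OF hlin_tprod_right hlin_tprod_right])
  have ***: "tprod (tprod (single u) y) z = tprod (single u) (tprod y z)" for u :: 'a and y z
    by (rule hlin_eqI[where x = y])
       (auto intro!: ** hlin_comp[OF hlin_tprod_left hlin_tprod_right] hlin_comp[OF hlin_tprod_right hlin_tprod_left])
  show ?thesis
    by (rule hlin_eqI[where x = x])
       (auto intro!: *** hlin_tprod_left hlin_comp[OF hlin_tprod_left hlin_tprod_left])
qed

instantiation hs :: (twisted_monoid) ring_1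
begin
definition one_hs :: "'a hs" where "one_hs = single tone"
definition times_hs :: "'a hs \<Rightarrow> 'a hs \<Rightarrow> 'a hs" where "times_hs = tprod"
instance
proof
  fix x y z :: "'a hs"
  show "x * y * z = x * (y * z)" by (simp add: times_hs_def tprod_assoc)
  show "1 * x = x"
    by (rule hlin_eqI[where x = x]) (auto intro!: hlin_intro hlin_tprod_right simp: times_hs_def one_hs_def tprod_single)
  show "x * 1 = x"
    by (rule hlin_eqI[where x = x]) (auto intro!: hlin_intro hlin_tprod_left simp: times_hs_def one_hs_def tprod_single)
  show "(x + y) * z = x * z + y * z" by (simp add: times_hs_def hlin_add[OF hlin_tprod_left])
  show "x * (y + z) = x * y + x * z" by (simp add: times_hs_def hlin_add[OF hlin_tprod_right])
  show "(0 :: 'a hs) \<noteq> 1" by (metis one_hs_def single_neq_0)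
qed
end

lemma hscale_mult_left [simp]: "(c \<bullet> x) * y = c \<bullet> (x * y)"
  and hscale_mult_right [simp]: "x * (c \<bullet> y) = c \<bullet> (x * y)"
  by (simp_all add: times_hs_def hlin_scale[OF hlin_tprod_left] hlin_scale[OF hlin_tprod_right])

lemma hlin_mult_intro [hlin_intro]:
  "hlin S \<Longrightarrow> hlin (\<lambda>x. S x * b)" "hlin S \<Longrightarrow> hlin (\<lambda>x. b * S x)"
  by (simp_all add: hlin_def algebra_simps)

lemma single_mult: "single u * single v = twist u v \<bullet> single (tmul u v)"
  by (simp add: times_hs_def tprod_single)

instantiation list :: (type) twisted_monoid
begin
definition twist_list :: "'a list \<Rightarrow> 'a list \<Rightarrow> complex fps" where "twist_list u v = 1"
definition tmul_list :: "'a list \<Rightarrow> 'a list \<Rightarrow> 'a list" where "tmul_list = (@)"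
definition tone_list :: "'a list" where "tone_list = []"
instance by standard (auto simp: twist_list_def tmul_list_def tone_list_def)
end

lemma single_mult_list [simp]: "single u * single v = single (u @ v)"
  by (simp add: single_mult twist_list_def tmul_list_def)

lemma one_list: "(1 :: 'x list hs) = single []"
  by (simp add: one_hs_def tone_list_def)

text \<open>Multiplication of words deconcatenates, as in the defining formula of the free algebra.\<close>

lemma coef_mult_list: "coef (x * y) w = (\<Sum>k\<le>length w. coef x (take k w) * coef y (drop k w))"
proof -
  \<comment> \<open>Both sides are bilinear; they are compared as linear maps into the module of rank one.\<close>
  define G where "G x y = (\<Sum>k\<le>length w. coef x (take k w) * coef y (drop k w)) \<bullet> single ()" for x y :: "'a list hs"
  define F where "F x y = coef (x * y) w \<bullet> single ()" for x y :: "'a list hs"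
  have F1: "hlin (\<lambda>x. F x y)" and F2: "hlin (\<lambda>x. F y x)" for y
    by (simp_all add: hlin_def F_def distrib_left distrib_right hs.scale_left_distrib)
  have G1: "hlin (\<lambda>x. G x y)" for y
    by (simp add: hlin_def G_def distrib_right sum.distrib hs.scale_left_distrib sum_distrib_left mult.assoc)
  have G2: "hlin (\<lambda>x. G y x)" for y
    by (simp add: hlin_def G_def distrib_left sum.distrib hs.scale_left_distrib sum_distrib_left mult.left_commute)
  have *: "F (single u) (single v) = G (single u) (single v)" for u v
  proof -
    have "(\<Sum>k\<le>length w. (if take k w = u then 1 else 0) * (if drop k w = v then 1 else (0::complex fps)))
       = (\<Sum>k\<le>length w. if k = length u then (if w = u @ v then 1 else 0) else 0)"
    proof (rule sum.cong[OF refl])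
      fix k assume k: "k \<in> {..length w}"
      show "(if take k w = u then 1 else 0) * (if drop k w = v then 1 else (0::complex fps))
         = (if k = length u then (if w = u @ v then 1 else 0) else 0)"
      proof (cases "k = length u")
        case True
        have *: "take k w = u \<and> drop k w = v \<longleftrightarrow> w = u @ v"
        proof
          assume "take k w = u \<and> drop k w = v"
          then show "w = u @ v" using append_take_drop_id[of k w] by simp
        qed (simp add: True)
        have "(if A then 1 else 0) * (if B then 1 else 0) = (if A \<and> B then 1 else (0::complex fps))" for A B
          by simp
        then show ?thesis by (simp only: * True[symmetric] refl if_True)
      next
        case False
        then have "take k w \<noteq> u" using k by auto
        then show ?thesis using False by simp
      qed
    qed
    also have "\<dots> = (if w = u @ v then 1 else 0)" by simp
    finally show ?thesis by (simp add: F_def G_def)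
  qed
  have "F x (single v) = G x (single v)" for v
    by (rule hlin_eqI[OF F1 G1]) (rule *)
  then have "F x y = G x y" by (rule hlin_eqI[OF F2 G2])
  then have "coef (F x y) () = coef (G x y) ()" by simp
  then show ?thesis by (simp add: F_def G_def)
qed

subsection \<open>Substitution\<close>

definition hsubst :: "('x \<Rightarrow> 'b::twisted_monoid hs) \<Rightarrow> 'x list hs \<Rightarrow> 'b hs" where
  "hsubst \<phi> = ext (\<lambda>w. prod_list (map \<phi> w))"

lemma hlin_hsubst: "hlin (hsubst \<phi>)"
  by (simp add: hsubst_def hlin_ext)

lemma hlin_hsubst_intro [hlin_intro]: "hlin T \<Longrightarrow> hlin (\<lambda>x. hsubst \<phi> (T x))"
  by (simp add: hsubst_def hlin_ext_intro)

lemma hsubst_single [simp]: "hsubst \<phi> (single w) = prod_list (map \<phi> w)"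
  by (simp add: hsubst_def)

lemma hsubst_one [simp]: "hsubst \<phi> 1 = 1"
  by (simp add: one_list)

lemma hsubst_mult [simp]: "hsubst \<phi> (x * y) = hsubst \<phi> x * hsubst \<phi> y"
proof -
  have "hsubst \<phi> (x * single v) = hsubst \<phi> x * hsubst \<phi> (single v)" for v
    by (rule hlin_eqI[OF hlin_hsubst_intro[OF hlin_mult_intro(1)[OF hlin_id_intro]]
          hlin_mult_intro(1)[OF hlin_hsubst]]) simp
  then show ?thesis
    by (rule hlin_eqI[OF hlin_hsubst_intro[OF hlin_mult_intro(2)[OF hlin_id_intro]]
          hlin_mult_intro(2)[OF hlin_hsubst]])
qed

lemmas hsubst_simps [simp] = hlin_add[OF hlin_hsubst] hlin_scale[OF hlin_hsubst]
  hlin_diff[OF hlin_hsubst] hlin_minus[OF hlin_hsubst] hlin_zero[OF hlin_hsubst] hlin_sum[OF hlin_hsubst]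

section \<open>Presented algebras\<close>

text \<open>
  Transfers the ring axioms and subtraction from a type class to a record, along a surjection from a
  subring that respects the operations.
\<close>

lemma ring_of_surj:
  fixes \<phi> :: "'b::ring_1 \<Rightarrow> 'a" and A :: "('a, 'm) ring_scheme"
  assumes car: "carrier A = \<phi> ` S"
    and S: "0 \<in> S" "1 \<in> S" "\<And>x y. x \<in> S \<Longrightarrow> y \<in> S \<Longrightarrow> x + y \<in> S" "\<And>x. x \<in> S \<Longrightarrow> - x \<in> S"
      "\<And>x y. x \<in> S \<Longrightarrow> y \<in> S \<Longrightarrow> x * y \<in> S"
    and ops: "\<And>x y. x \<in> S \<Longrightarrow> y \<in> S \<Longrightarrow> \<phi> x \<oplus>\<^bsub>A\<^esub> \<phi> y = \<phi> (x + y)"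
      "\<And>x y. x \<in> S \<Longrightarrow> y \<in> S \<Longrightarrow> \<phi> x \<otimes>\<^bsub>A\<^esub> \<phi> y = \<phi> (x * y)"
      "\<zero>\<^bsub>A\<^esub> = \<phi> 0" "\<one>\<^bsub>A\<^esub> = \<phi> 1"
  shows "ring A" and "\<And>x y. x \<in> S \<Longrightarrow> y \<in> S \<Longrightarrow> \<phi> x \<ominus>\<^bsub>A\<^esub> \<phi> y = \<phi> (x - y)"
proof -
  have ag: "abelian_group A"
  proof (rule abelian_groupI)
    fix x assume "x \<in> carrier A"
    then obtain s where "s \<in> S" "x = \<phi> s" by (auto simp: car)
    then show "\<exists>y\<in>carrier A. y \<oplus>\<^bsub>A\<^esub> x = \<zero>\<^bsub>A\<^esub>"
      by (intro bexI[of _ "\<phi> (- s)"]) (auto simp: car ops S)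
  qed (auto simp: car ops S add.assoc add.commute add.left_commute)
  have mon: "monoid A"
    by (rule monoidI) (auto simp: car ops S mult.assoc)
  show r: "ring A"
    by (rule ringI[OF ag mon]) (auto simp: car ops S distrib_left distrib_right)
  interpret ring A by (rule r)
  fix x y assume xy: "x \<in> S" "y \<in> S"
  have "\<ominus>\<^bsub>A\<^esub> \<phi> y = \<phi> (- y)"
    by (rule minus_equality) (use xy S in \<open>auto simp: car ops\<close>)
  then show "\<phi> x \<ominus>\<^bsub>A\<^esub> \<phi> y = \<phi> (x - y)"
    unfolding a_minus_def using xy S ops(1)[of x "- y"] by simp
qed

definition free_on :: "'x set \<Rightarrow> 'x list hs set" where "free_on X = {x. supp x \<subseteq> lists X}"

lemma free_on_UNIV [simp]: "free_on UNIV = UNIV"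
  by (auto simp: free_on_def)

lemma free_on_iff: "x \<in> free_on X \<longleftrightarrow> (\<forall>w. w \<notin> lists X \<longrightarrow> coef x w = 0)"
  by (auto simp: free_on_def supp_def)

lemma free_on_closed:
  "0 \<in> free_on X" "1 \<in> free_on X"
  "x \<in> free_on X \<Longrightarrow> y \<in> free_on X \<Longrightarrow> x + y \<in> free_on X"
  "x \<in> free_on X \<Longrightarrow> y \<in> free_on X \<Longrightarrow> x - y \<in> free_on X"
  "x \<in> free_on X \<Longrightarrow> - x \<in> free_on X"
  "x \<in> free_on X \<Longrightarrow> c \<bullet> x \<in> free_on X"
  by (auto simp: free_on_iff one_list)

lemma free_on_single: "single w \<in> free_on X \<longleftrightarrow> w \<in> lists X"
  by (auto simp: free_on_iff)

lemma free_on_mult: "x \<in> free_on X \<Longrightarrow> y \<in> free_on X \<Longrightarrow> x * y \<in> free_on X"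
  unfolding free_on_iff
proof (intro allI impI)
  fix w assume x: "\<forall>w. w \<notin> lists X \<longrightarrow> coef x w = 0" and y: "\<forall>w. w \<notin> lists X \<longrightarrow> coef y w = 0"
    and w: "w \<notin> lists X"
  have "take k w \<notin> lists X \<or> drop k w \<notin> lists X" for k
    using w by (metis append_in_lists_conv append_take_drop_id)
  then have "coef x (take k w) * coef y (drop k w) = 0" for k
    using x y by (metis mult_zero_left mult_zero_right)
  then show "coef (x * y) w = 0" by (simp add: coef_mult_list del: mult_eq_0_iff)
qed

lemma free_on_hclosed: "hclosed (free_on X)"
  unfolding hclosed_def
proof (intro conjI allI impI ballI free_on_closed)
  fix x assume *: "\<forall>n. \<exists>y. x - h ^ n \<bullet> y \<in> free_on X"
  show "x \<in> free_on X"
    unfolding free_on_iff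
  proof (intro allI impI h_adic_separated)
    fix w n assume w: "w \<notin> lists X"
    obtain y where y: "x - h ^ n \<bullet> y \<in> free_on X" using * by blast
    have "coef x w - h ^ n * coef y w = 0" using y w unfolding free_on_iff by auto
    then show "h ^ n dvd coef x w" by (metis dvd_triv_left eq_iff_diff_eq_0)
  qed
qed

lemma carrier_free: "carrier (free_halg X) = coef ` free_on X"
proof -
  have "f \<in> coef ` free_on X" if "\<forall>w. w \<notin> lists X \<longrightarrow> f w = 0" "\<forall>n. finite {w. \<not> h ^ n dvd f w}" for f
    using that by (intro image_eqI[of _ _ "Abs_hs f"]) (auto simp: Abs_hs_inverse free_on_iff)
  moreover have "coef x w = 0" if "x \<in> free_on X" "w \<notin> lists X" for x w
    using that by (simp add: free_on_iff)
  ultimately show ?thesis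
    unfolding free_halg_def by (auto simp: finite_coef simp del: in_lists_conv_set)
qed

lemma free_ops:
  "coef x \<otimes>\<^bsub>free_halg X\<^esub> coef y = coef (x * y)" "coef x \<oplus>\<^bsub>free_halg X\<^esub> coef y = coef (x + y)"
  "\<zero>\<^bsub>free_halg X\<^esub> = coef 0" "\<one>\<^bsub>free_halg X\<^esub> = coef 1" "c \<odot>\<^bsub>free_halg X\<^esub> coef x = coef (c \<bullet> x)"
  by (auto simp: free_halg_def coef_mult_list one_list fun_eq_iff)

lemma ring_free: "ring (free_halg X)"
  and free_minus: "x \<in> free_on X \<Longrightarrow> y \<in> free_on X \<Longrightarrow> coef x \<ominus>\<^bsub>free_halg X\<^esub> coef y = coef (x - y)"
  using ring_of_surj[of "free_halg X" coef "free_on X"]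
  by (auto simp: carrier_free free_ops free_on_closed free_on_mult)

lemma letter_coef: "letter x = coef (single [x])"
  by (auto simp: letter_def fun_eq_iff)

text \<open>
  \<open>Rel\<close> is the closed ideal \<open>rel_ideal\<close> read in the type \<open>'x list hs\<close>, and \<open>cls\<close> the residue class of an
  element; the lemmas below reduce all questions about presented algebras to these two.
\<close>

definition Rel :: "'x set \<Rightarrow> ('x list \<Rightarrow> complex fps) set \<Rightarrow> 'x list hs set" where
  "Rel X R = {x. coef x \<in> rel_ideal X R}"

definition cls :: "'x set \<Rightarrow> ('x list \<Rightarrow> complex fps) set \<Rightarrow> 'x list hs \<Rightarrow> ('x list \<Rightarrow> complex fps) set" where
  "cls X R x = coef ` {j + x | j. j \<in> Rel X R}"

context
  fixes X :: "'x set" and R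
  assumes R: "R \<subseteq> carrier (free_halg X)"
begin

interpretation F: ring "free_halg X" by (rule ring_free)

lemma Idl_ideal: "ideal (Idl\<^bsub>free_halg X\<^esub> R) (free_halg X)"
  by (rule F.genideal_ideal[OF R])

text \<open>
  The ideal before taking its \<open>h\<close>-adic closure.
\<close>

definition alg_Idl where "alg_Idl = {x. coef x \<in> Idl\<^bsub>free_halg X\<^esub> R}"

lemma alg_Idl_props:
  "x \<in> alg_Idl \<Longrightarrow> x \<in> free_on X"
  "0 \<in> alg_Idl" "x \<in> alg_Idl \<Longrightarrow> y \<in> alg_Idl \<Longrightarrow> x + y \<in> alg_Idl"
  "x \<in> alg_Idl \<Longrightarrow> u \<in> free_on X \<Longrightarrow> u * x \<in> alg_Idl"
  "x \<in> alg_Idl \<Longrightarrow> u \<in> free_on X \<Longrightarrow> x * u \<in> alg_Idl"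
  "coef x \<in> R \<Longrightarrow> x \<in> alg_Idl"
proof -
  interpret I: ideal "Idl\<^bsub>free_halg X\<^esub> R" "free_halg X" by (rule Idl_ideal)
  show "x \<in> alg_Idl \<Longrightarrow> x \<in> free_on X"
    using I.Icarr[of "coef x"] by (auto simp: alg_Idl_def carrier_free coef_inject)
  show "0 \<in> alg_Idl" using I.zero_closed by (simp add: alg_Idl_def free_ops)
  show "x \<in> alg_Idl \<Longrightarrow> y \<in> alg_Idl \<Longrightarrow> x + y \<in> alg_Idl"
    using I.a_closed[of "coef x" "coef y"] by (simp add: alg_Idl_def free_ops)
  show "x \<in> alg_Idl \<Longrightarrow> u \<in> free_on X \<Longrightarrow> u * x \<in> alg_Idl"
    using I.I_l_closed[of "coef x" "coef u"] by (simp add: alg_Idl_def free_ops carrier_free)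
  show "x \<in> alg_Idl \<Longrightarrow> u \<in> free_on X \<Longrightarrow> x * u \<in> alg_Idl"
    using I.I_r_closed[of "coef x" "coef u"] by (simp add: alg_Idl_def free_ops carrier_free)
  show "coef x \<in> R \<Longrightarrow> x \<in> alg_Idl"
    using F.genideal_self[OF R] by (auto simp: alg_Idl_def)
qed

lemma Rel_iff: "x \<in> Rel X R \<longleftrightarrow> x \<in> free_on X \<and> (\<forall>n. \<exists>g\<in>alg_Idl. \<exists>y. x = g + h ^ n \<bullet> y)"
proof -
  have 1: "(\<forall>w. h ^ n dvd coef x w - coef g w) \<longleftrightarrow> (\<exists>y. x = g + h ^ n \<bullet> y)" for n g
  proof
    assume d: "\<forall>w. h ^ n dvd coef x w - coef g w"
    obtain y where y: "x - g = (\<Sum>i | \<not> h ^ n dvd coef (x - g) i. coef (x - g) i \<bullet> single i) + h ^ n \<bullet> y"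
      by (rule hs_approx)
    have "{i. \<not> h ^ n dvd coef (x - g) i} = {}" using d by auto
    then have "x - g = h ^ n \<bullet> y" by (subst y) simp
    then show "\<exists>y. x = g + h ^ n \<bullet> y" by (metis add_diff_cancel_left' add_diff_eq diff_add_cancel)
  qed auto
  have "(\<exists>g\<in>Idl\<^bsub>free_halg X\<^esub> R. \<forall>w. h ^ n dvd coef x w - g w) \<longleftrightarrow> (\<exists>g\<in>alg_Idl. \<exists>y. x = g + h ^ n \<bullet> y)" for n
  proof -
    interpret I: ideal "Idl\<^bsub>free_halg X\<^esub> R" "free_halg X" by (rule Idl_ideal)
    have "g \<in> coef ` free_on X" if "g \<in> Idl\<^bsub>free_halg X\<^esub> R" for g
      using I.Icarr[OF that] by (simp add: carrier_free)
    then show ?thesis unfolding 1[symmetric] alg_Idl_def by blast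
  qed
  then show ?thesis
    by (auto simp: Rel_def rel_ideal_def carrier_free coef_inject)
qed

lemma Rel_free_on: "x \<in> Rel X R \<Longrightarrow> x \<in> free_on X"
  by (simp add: Rel_iff)

lemma Rel_mult_left: "x \<in> Rel X R \<Longrightarrow> u \<in> free_on X \<Longrightarrow> u * x \<in> Rel X R"
  unfolding Rel_iff
proof (intro conjI allI)
  fix n assume x: "x \<in> free_on X \<and> (\<forall>n. \<exists>g\<in>alg_Idl. \<exists>y. x = g + h ^ n \<bullet> y)" and u: "u \<in> free_on X"
  show "u * x \<in> free_on X" using x u by (simp add: free_on_mult)
  obtain g y where g: "g \<in> alg_Idl" "x = g + h ^ n \<bullet> y" using x by blast
  then have "u * x = u * g + h ^ n \<bullet> (u * y)" by (simp add: distrib_left)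
  then show "\<exists>g\<in>alg_Idl. \<exists>y. u * x = g + h ^ n \<bullet> y" using alg_Idl_props(4)[OF g(1) u] by blast
qed

lemma Rel_mult_right: "x \<in> Rel X R \<Longrightarrow> u \<in> free_on X \<Longrightarrow> x * u \<in> Rel X R"
  unfolding Rel_iff
proof (intro conjI allI)
  fix n assume x: "x \<in> free_on X \<and> (\<forall>n. \<exists>g\<in>alg_Idl. \<exists>y. x = g + h ^ n \<bullet> y)" and u: "u \<in> free_on X"
  show "x * u \<in> free_on X" using x u by (simp add: free_on_mult)
  obtain g y where g: "g \<in> alg_Idl" "x = g + h ^ n \<bullet> y" using x by blast
  then have "x * u = g * u + h ^ n \<bullet> (y * u)" by (simp add: distrib_right)
  then show "\<exists>g\<in>alg_Idl. \<exists>y. x * u = g + h ^ n \<bullet> y" using alg_Idl_props(5)[OF g(1) u] by blast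
qed

lemma Rel_relation: "coef x \<in> R \<Longrightarrow> x \<in> Rel X R"
  unfolding Rel_iff using alg_Idl_props(1,6) by (metis add.right_neutral hs.scale_zero_right)

lemma Rel_hclosed: "hclosed (Rel X R)"
  unfolding hclosed_def
proof (intro conjI allI impI ballI)
  show "0 \<in> Rel X R"
    unfolding Rel_iff using alg_Idl_props(2) by (metis add.right_neutral free_on_closed(1) hs.scale_zero_right)
next
  fix x y assume xy: "x \<in> Rel X R" "y \<in> Rel X R"
  show "x + y \<in> Rel X R"
    unfolding Rel_iff
  proof (intro conjI allI)
    show "x + y \<in> free_on X" using xy by (simp add: free_on_closed Rel_free_on)
    fix n
    obtain g u where g: "g \<in> alg_Idl" "x = g + h ^ n \<bullet> u" using xy(1) unfolding Rel_iff by blast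
    obtain g' u' where g': "g' \<in> alg_Idl" "y = g' + h ^ n \<bullet> u'" using xy(2) unfolding Rel_iff by blast
    have "x + y = (g + g') + h ^ n \<bullet> (u + u')" using g g' by (simp add: hs.scale_right_distrib)
    then show "\<exists>g\<in>alg_Idl. \<exists>u. x + y = g + h ^ n \<bullet> u" using alg_Idl_props(3)[OF g(1) g'(1)] by blast
  qed
next
  fix c x assume x: "x \<in> Rel X R"
  have "(c \<bullet> 1) * x \<in> Rel X R" using x by (intro Rel_mult_left free_on_closed)
  then show "c \<bullet> x \<in> Rel X R" by simp
next
  fix x assume *: "\<forall>n. \<exists>y. x - h ^ n \<bullet> y \<in> Rel X R"
  show "x \<in> Rel X R"
    unfolding Rel_iff
  proof (intro conjI allI)
    show "x \<in> free_on X"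
      by (rule hclosed_limit[OF free_on_hclosed]) (use * Rel_free_on in blast)
    fix n
    obtain y where y: "x - h ^ n \<bullet> y \<in> Rel X R" using * by blast
    then obtain g u where g: "g \<in> alg_Idl" "x - h ^ n \<bullet> y = g + h ^ n \<bullet> u" unfolding Rel_iff by blast
    have "x = g + h ^ n \<bullet> (u + y)" using g(2) by (simp add: hs.scale_right_distrib algebra_simps)
    then show "\<exists>g\<in>alg_Idl. \<exists>u. x = g + h ^ n \<bullet> u" using g(1) by blast
  qed
qed

lemma ideal_of_closed:
  assumes J: "hclosed J" and l: "\<And>x u. x \<in> J \<Longrightarrow> u \<in> free_on X \<Longrightarrow> u * x \<in> J"
    and r: "\<And>x u. x \<in> J \<Longrightarrow> u \<in> free_on X \<Longrightarrow> x * u \<in> J"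
  shows "ideal (coef ` (J \<inter> free_on X)) (free_halg X)" (is "ideal ?J _")
proof (rule idealI[OF ring_free])
  show "subgroup ?J (add_monoid (free_halg X))"
  proof (rule group.subgroupI)
    show "Group.group (add_monoid (free_halg X))" by (rule F.a_group)
    show "?J \<subseteq> carrier (add_monoid (free_halg X))" by (auto simp: carrier_free)
    show "?J \<noteq> {}" using hclosed_zero[OF J] free_on_closed(1) by blast
    show "a \<otimes>\<^bsub>add_monoid (free_halg X)\<^esub> b \<in> ?J" if "a \<in> ?J" "b \<in> ?J" for a b
      using that hclosed_add[OF J] by (auto simp: free_ops free_on_closed)
    show "inv\<^bsub>add_monoid (free_halg X)\<^esub> a \<in> ?J" if a: "a \<in> ?J" for a
    proof -
      obtain z where z: "a = coef z" "z \<in> J" "z \<in> free_on X" using a by auto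
      have "\<ominus>\<^bsub>free_halg X\<^esub> a = coef (- z)"
        by (rule F.minus_equality) (use z in \<open>auto simp: free_ops carrier_free free_on_closed\<close>)
      then have "inv\<^bsub>add_monoid (free_halg X)\<^esub> a = coef (- z)" by (simp add: a_inv_def)
      then show ?thesis using z hclosed_minus[OF J] by (auto simp: free_on_closed)
    qed
  qed
  show "u \<otimes>\<^bsub>free_halg X\<^esub> a \<in> ?J" "a \<otimes>\<^bsub>free_halg X\<^esub> u \<in> ?J" if "a \<in> ?J" "u \<in> carrier (free_halg X)" for a u
    using that l r by (auto simp: carrier_free free_ops free_on_mult)
qed

text \<open>
  Every closed ideal containing the relations contains the ideal generated by them. This is how
  homomorphisms out of presented algebras are constructed.
\<close>

lemma Rel_minimal:
  assumes J: "hclosed J" and R': "\<And>x. coef x \<in> R \<Longrightarrow> x \<in> J"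
    and l: "\<And>x u. x \<in> J \<Longrightarrow> u \<in> free_on X \<Longrightarrow> u * x \<in> J"
    and r: "\<And>x u. x \<in> J \<Longrightarrow> u \<in> free_on X \<Longrightarrow> x * u \<in> J"
  shows "Rel X R \<subseteq> J"
proof
  fix x assume x: "x \<in> Rel X R"
  have "ideal (coef ` (J \<inter> free_on X)) (free_halg X)"
    by (rule ideal_of_closed[OF J]) (fact l r)+
  moreover have "R \<subseteq> coef ` (J \<inter> free_on X)" using R R' by (auto simp: carrier_free)
  ultimately have "Idl\<^bsub>free_halg X\<^esub> R \<subseteq> coef ` (J \<inter> free_on X)"
    by (rule F.genideal_minimal)
  then have sub: "alg_Idl \<subseteq> J" by (auto simp: alg_Idl_def coef_inject)
  show "x \<in> J"
  proof (rule hclosed_limit[OF J])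
    fix n
    obtain g y where "g \<in> alg_Idl" "x = g + h ^ n \<bullet> y" using x unfolding Rel_iff by blast
    then show "\<exists>y. x - h ^ n \<bullet> y \<in> J" using sub by (intro exI[of _ y]) auto
  qed
qed

lemma rel_ideal_Rel: "rel_ideal X R = coef ` Rel X R"
  by (auto simp: Rel_def rel_ideal_def carrier_free)

lemma coset_cls: "rel_ideal X R +>\<^bsub>free_halg X\<^esub> coef x = cls X R x"
  by (auto simp: a_r_coset_def' rel_ideal_Rel cls_def free_ops)

lemma pgen_cls: "pgen X R x = cls X R (single [x])"
  by (simp add: pgen_def letter_coef coset_cls)

lemma cls_eq_iff: "cls X R x = cls X R y \<longleftrightarrow> x - y \<in> Rel X R"
proof
  assume eq: "cls X R x = cls X R y"
  have "coef (0 + x) \<in> cls X R x" unfolding cls_def using hclosed_zero[OF Rel_hclosed] by blast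
  then obtain j where j: "j \<in> Rel X R" "x = j + y" unfolding eq by (auto simp: cls_def coef_inject)
  then show "x - y \<in> Rel X R" by simp
next
  assume d: "x - y \<in> Rel X R"
  have "{j + x | j. j \<in> Rel X R} = {j + y | j. j \<in> Rel X R}"
  proof (intro Set.set_eqI iffI; clarsimp)
    fix j assume j: "j \<in> Rel X R"
    show "\<exists>ja. j + x = ja + y \<and> ja \<in> Rel X R"
      by (rule exI[of _ "j + (x - y)"]) (use hclosed_add[OF Rel_hclosed j d] in simp)
    show "\<exists>ja. j + y = ja + x \<and> ja \<in> Rel X R"
      by (rule exI[of _ "j - (x - y)"]) (use hclosed_diff[OF Rel_hclosed j d] in simp)
  qed
  then show "cls X R x = cls X R y" by (simp add: cls_def)
qed

lemma rel_ideal_ideal: "ideal (rel_ideal X R) (free_halg X)"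
proof -
  have "Rel X R \<inter> free_on X = Rel X R" using Rel_free_on by blast
  then show ?thesis
    using ideal_of_closed[OF Rel_hclosed] Rel_mult_left Rel_mult_right by (simp add: rel_ideal_Rel)
qed

lemma presented_carrier: "carrier (presented X R) = cls X R ` free_on X"
  by (auto simp: presented_def ring.defs module.defs FactRing_def A_RCOSETS_def' carrier_free coset_cls)

lemma presented_ops:
  "x \<in> free_on X \<Longrightarrow> y \<in> free_on X \<Longrightarrow> cls X R x \<otimes>\<^bsub>presented X R\<^esub> cls X R y = cls X R (x * y)"
  "x \<in> free_on X \<Longrightarrow> y \<in> free_on X \<Longrightarrow> cls X R x \<oplus>\<^bsub>presented X R\<^esub> cls X R y = cls X R (x + y)"
  "\<zero>\<^bsub>presented X R\<^esub> = cls X R 0" "\<one>\<^bsub>presented X R\<^esub> = cls X R 1"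
  "c \<odot>\<^bsub>presented X R\<^esub> cls X R x = cls X R (c \<bullet> x)"
proof -
  interpret I: ideal "rel_ideal X R" "free_halg X" by (rule rel_ideal_ideal)
  show "x \<in> free_on X \<Longrightarrow> y \<in> free_on X \<Longrightarrow> cls X R x \<otimes>\<^bsub>presented X R\<^esub> cls X R y = cls X R (x * y)"
    using I.rcoset_mult_add[of "coef x" "coef y"]
    by (simp add: presented_def ring.defs module.defs FactRing_def coset_cls carrier_free free_ops)
  show "x \<in> free_on X \<Longrightarrow> y \<in> free_on X \<Longrightarrow> cls X R x \<oplus>\<^bsub>presented X R\<^esub> cls X R y = cls X R (x + y)"
    using I.a_rcos_sum[of "coef x" "coef y"]
    by (simp add: presented_def ring.defs module.defs FactRing_def coset_cls carrier_free free_ops)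
  show "\<zero>\<^bsub>presented X R\<^esub> = cls X R 0"
    by (simp add: presented_def ring.defs module.defs FactRing_def cls_def rel_ideal_Rel)
  show "\<one>\<^bsub>presented X R\<^esub> = cls X R 1"
    by (simp add: presented_def ring.defs module.defs FactRing_def coset_cls free_ops)
  have "(\<Union>f\<in>cls X R x. rel_ideal X R +>\<^bsub>free_halg X\<^esub> (c \<odot>\<^bsub>free_halg X\<^esub> f)) = (\<Union>j\<in>Rel X R. cls X R (c \<bullet> (j + x)))"
    by (auto simp: cls_def[of X R x] free_ops coset_cls)
  also have "\<dots> = (\<Union>j\<in>Rel X R. cls X R (c \<bullet> x))"
    by (rule SUP_cong[OF refl])
       (simp add: cls_eq_iff hs.scale_right_distrib hclosed_scale[OF Rel_hclosed])
  also have "\<dots> = cls X R (c \<bullet> x)" using hclosed_zero[OF Rel_hclosed] by auto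
  finally show "c \<odot>\<^bsub>presented X R\<^esub> cls X R x = cls X R (c \<bullet> x)"
    by (simp add: presented_def ring.defs module.defs)
qed

end

subsection \<open>Homomorphisms between presented algebras\<close>

lemma hclosed_vimage: "hlin T \<Longrightarrow> hclosed J \<Longrightarrow> hclosed {x. T x \<in> J}"
  unfolding hclosed_def[of "{x. T x \<in> J}"]
proof (intro conjI ballI allI impI; (simp add: hlin_zero hlin_add hlin_scale hclosed_zero hclosed_add hclosed_scale)?)
  fix x assume T: "hlin T" and J: "hclosed J" and *: "\<forall>n. \<exists>y. T (x - h ^ n \<bullet> y) \<in> J"
  show "T x \<in> J"
  proof (rule hclosed_limit[OF J])
    fix n obtain y where "T (x - h ^ n \<bullet> y) \<in> J" using * by blast
    then show "\<exists>y. T x - h ^ n \<bullet> y \<in> J"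
      by (intro exI[of _ "T y"]) (simp add: hlin_diff[OF T] hlin_scale[OF T])
  qed
qed

lemma hsubst_free_on:
  assumes "\<And>a. a \<in> X \<Longrightarrow> \<phi> a \<in> free_on Y" and "x \<in> free_on X"
  shows "hsubst \<phi> x \<in> free_on Y"
proof -
  have "prod_list (map \<phi> w) \<in> free_on Y" if "w \<in> lists X" for w
    using that by (induction w) (auto simp: free_on_closed intro!: free_on_mult assms(1))
  then show ?thesis
    using hlin_mem_closed[OF hlin_hsubst free_on_hclosed, of x \<phi> Y] assms(2)
    by (auto simp: free_on_def)
qed

lemma hsubst_Rel:
  assumes R: "R \<subseteq> carrier (free_halg X)" and S: "S \<subseteq> carrier (free_halg Y)"
    and \<phi>: "\<And>a. a \<in> X \<Longrightarrow> \<phi> a \<in> free_on Y"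
    and rel: "\<And>x. coef x \<in> R \<Longrightarrow> hsubst \<phi> x \<in> Rel Y S"
    and x: "x \<in> Rel X R"
  shows "hsubst \<phi> x \<in> Rel Y S"
proof -
  have "Rel X R \<subseteq> {x. hsubst \<phi> x \<in> Rel Y S}"
    by (rule Rel_minimal[OF R hclosed_vimage[OF hlin_hsubst Rel_hclosed[OF S]]])
       (auto intro: rel Rel_mult_left[OF S] Rel_mult_right[OF S] hsubst_free_on \<phi>)
  then show ?thesis using x by blast
qed

lemma alg_homI:
  assumes R: "R \<subseteq> carrier (free_halg X)" and S: "S \<subseteq> carrier (free_halg Y)"
    and \<theta>: "\<And>x. x \<in> free_on X \<Longrightarrow> \<theta> (cls X R x) = cls Y S (T x)"
    and T: "hlin T" "T 1 = 1" "\<And>x y. T (x * y) = T x * T y" "\<And>x. x \<in> free_on X \<Longrightarrow> T x \<in> free_on Y"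
  shows "\<theta> \<in> alg_hom (presented X R) (presented Y S)"
  unfolding alg_hom_def
proof (intro CollectI conjI allI ballI ring_hom_memI)
  show "\<theta> x \<in> carrier (presented Y S)" if "x \<in> carrier (presented X R)" for x
    using that T(4) by (auto simp: presented_carrier[OF R] presented_carrier[OF S] \<theta>)
  show "\<theta> (x \<otimes>\<^bsub>presented X R\<^esub> y) = \<theta> x \<otimes>\<^bsub>presented Y S\<^esub> \<theta> y"
    if "x \<in> carrier (presented X R)" "y \<in> carrier (presented X R)" for x y
    using that by (auto simp: presented_carrier[OF R] presented_ops[OF R] presented_ops[OF S] \<theta> T free_on_mult)
  show "\<theta> (x \<oplus>\<^bsub>presented X R\<^esub> y) = \<theta> x \<oplus>\<^bsub>presented Y S\<^esub> \<theta> y"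
    if "x \<in> carrier (presented X R)" "y \<in> carrier (presented X R)" for x y
    using that by (auto simp: presented_carrier[OF R] presented_ops[OF R] presented_ops[OF S] \<theta> T free_on_closed hlin_add[OF T(1)])
  show "\<theta> \<one>\<^bsub>presented X R\<^esub> = \<one>\<^bsub>presented Y S\<^esub>"
    by (simp add: presented_ops[OF R] presented_ops[OF S] \<theta> T free_on_closed)
  show "\<theta> (c \<odot>\<^bsub>presented X R\<^esub> x) = c \<odot>\<^bsub>presented Y S\<^esub> \<theta> x" if "x \<in> carrier (presented X R)" for c x
    using that by (auto simp: presented_carrier[OF R] presented_ops[OF R] presented_ops[OF S] \<theta> T free_on_closed hlin_scale[OF T(1)])
qed

text \<open>
  A linear map on free algebras that respects the ideals descends to residue classes.
\<close>

lemma induced_map: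
  assumes R: "R \<subseteq> carrier (free_halg X)" and S: "S \<subseteq> carrier (free_halg Y)"
    and T: "hlin T" "\<And>x. x \<in> Rel X R \<Longrightarrow> T x \<in> Rel Y S"
  obtains \<theta> where "\<And>x. x \<in> free_on X \<Longrightarrow> \<theta> (cls X R x) = cls Y S (T x)"
proof (rule that[of "\<lambda>K. cls Y S (T (SOME y. cls X R y = K))"])
  fix x
  assume "x \<in> free_on X"
  let ?y = "SOME y. cls X R y = cls X R x"
  have "cls X R ?y = cls X R x" by (rule someI) (rule refl)
  then have "T ?y - T x \<in> Rel Y S"
    using T(2)[of "?y - x"] by (simp add: cls_eq_iff[OF R] hlin_diff[OF T(1)])
  then show "cls Y S (T ?y) = cls Y S (T x)"
    by (simp add: cls_eq_iff[OF S])
qed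

lemma presented_map_cls:
  assumes R: "R \<subseteq> carrier (free_halg X)" and S: "S \<subseteq> carrier (free_halg Y)"
    and sub: "Rel X R \<subseteq> Rel Y S"
  shows "presented_map Y S (cls X R x) = cls Y S x"
proof -
  have "presented_map Y S (cls X R x) = (\<Union>j\<in>Rel X R. cls Y S (j + x))"
    by (auto simp: presented_map_def cls_def[of X R x] coset_cls[OF S])
  also have "\<dots> = (\<Union>j\<in>Rel X R. cls Y S x)"
    by (rule SUP_cong[OF refl]) (use sub in \<open>auto simp: cls_eq_iff[OF S]\<close>)
  also have "\<dots> = cls Y S x" using hclosed_zero[OF Rel_hclosed[OF R]] by auto
  finally show ?thesis .
qed

section \<open>Powers of \<open>q\<close>\<close>

lemma qpow_exp: "q powi n = fps_exp (of_int n)"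
proof (cases "n \<ge> 0")
  case True
  then show ?thesis by (simp add: power_int_def q_def fps_exp_power_mult)
next
  case False
  have "inverse (fps_exp (1::complex)) = fps_exp (- 1)" by (rule fps_exp_neg[symmetric])
  then show ?thesis using False by (simp add: power_int_def q_def fps_exp_power_mult)
qed

lemma qpow_add: "q powi (m + n) = q powi m * q powi n"
  by (simp add: qpow_exp fps_exp_add_mult)

lemma qpow_nth_0 [simp]: "(q powi n) $ 0 = 1"
  by (simp add: qpow_exp)

lemma qpow_mult_neg [simp]: "q powi n * q powi (- n) = 1" "q powi (- n) * q powi n = 1"
  using qpow_add[of n "- n"] qpow_add[of "- n" n] by simp_all

text \<open>
  The quotient \<open>(q\<^sup>m - q\<^sup>n) / h\<close>, with constant coefficient \<open>m - n\<close>; it is invertible for \<open>m \<noteq> n\<close>.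
\<close>

definition qdiff :: "int \<Rightarrow> int \<Rightarrow> complex fps" where
  "qdiff m n = fps_shift 1 (q powi m - q powi n)"

lemma h_qdiff: "h * qdiff m n = q powi m - q powi n"
  unfolding qdiff_def by (rule fps_ext) (auto simp: fps_X_mult_nth)

lemma qdiff_nth_0 [simp]: "qdiff m n $ 0 = of_int (m - n)"
  by (simp add: qdiff_def qpow_exp)

lemma qpow_eq_iff: "q powi m = q powi n \<longleftrightarrow> m = n"
proof
  assume "q powi m = q powi n"
  then have "h * qdiff m n = 0" by (simp add: h_qdiff)
  then have "qdiff m n = 0" by simp
  then have "(of_int (m - n) :: complex) = 0" using qdiff_nth_0[of m n] by simp
  then show "m = n" by (metis eq_iff_diff_eq_0 of_int_eq_0_iff)
qed simp

section \<open>Coordinates on \<open>\<dd>\<^sub>q\<close>\<close>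

text \<open>The basis element \<open>Mon a j\<close> stands for \<open>Z\<^sup>a D\<^sup>j\<close>.\<close>

datatype zd = Mon int int

instantiation zd :: twisted_monoid
begin
fun twist_zd :: "zd \<Rightarrow> zd \<Rightarrow> complex fps" where "twist_zd (Mon a i) (Mon b j) = q powi (i * b)"
fun tmul_zd :: "zd \<Rightarrow> zd \<Rightarrow> zd" where "tmul_zd (Mon a i) (Mon b j) = Mon (a + b) (i + j)"
definition tone_zd :: zd where "tone_zd = Mon 0 0"
instance
proof
  fix x y z :: zd
  obtain a i b j c k where eq: "x = Mon a i" "y = Mon b j" "z = Mon c k" by (metis zd.exhaust)
  show "tmul (tmul x y) z = tmul x (tmul y z)" by (simp add: eq)
  show "twist x y * twist (tmul x y) z = twist y z * twist x (tmul y z)"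
    by (simp add: eq qpow_add[symmetric] algebra_simps)
  show "tmul tone x = x" "tmul x tone = x" "twist tone x = 1" "twist x tone = 1"
    by (simp_all add: eq tone_zd_def)
qed
end

lemma single_mult_zd: "single (Mon a i) * single (Mon b j) = q powi (i * b) \<bullet> single (Mon (a + b) (i + j))"
  by (simp add: single_mult)

lemma one_zd: "(1 :: zd hs) = single (Mon 0 0)"
  by (simp add: one_hs_def tone_zd_def)

text \<open>
  Evaluation of the generators in the algebra with basis \<open>Z\<^sup>a D\<^sup>j\<close>. That its kernel is the ideal of
  relations is shown by a section \<open>dsec\<close>, which writes \<open>Z\<^sup>a D\<^sup>j\<close> as a word: every word is congruent to its
  normal form.
\<close>

fun evg :: "d_gen \<Rightarrow> zd hs" where
  "evg GZ = single (Mon 1 0)" | "evg GZinv = single (Mon (-1) 0)"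
| "evg GD = single (Mon 0 1)" | "evg GDinv = single (Mon 0 (-1))"

definition Zw :: "int \<Rightarrow> d_gen list" where
  "Zw a = (if a \<ge> 0 then replicate (nat a) GZ else replicate (nat (- a)) GZinv)"

definition Dw :: "int \<Rightarrow> d_gen list" where
  "Dw a = (if a \<ge> 0 then replicate (nat a) GD else replicate (nat (- a)) GDinv)"

fun nword :: "zd \<Rightarrow> d_gen list" where "nword (Mon a j) = Zw a @ Dw j"

definition dsec :: "zd hs \<Rightarrow> d_gen list hs" where "dsec = ext (\<lambda>m. single (nword m))"

abbreviation DR :: "d_gen list hs set" where "DR \<equiv> Rel UNIV d_rels"

lemma ev_replicate:
  "prod_list (map evg (replicate n GZ)) = single (Mon (int n) 0)"
  "prod_list (map evg (replicate n GZinv)) = single (Mon (- int n) 0)"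
  "prod_list (map evg (replicate n GD)) = single (Mon 0 (int n))"
  "prod_list (map evg (replicate n GDinv)) = single (Mon 0 (- int n))"
  by (induction n) (auto simp: one_zd single_mult_zd)

lemma ev_Zw: "prod_list (map evg (Zw a)) = single (Mon a 0)"
  and ev_Dw: "prod_list (map evg (Dw a)) = single (Mon 0 a)"
  by (simp_all only: Zw_def Dw_def ev_replicate split: if_splits) auto

lemma ev_nword: "hsubst evg (single (nword m)) = single m"
  by (cases m) (simp add: ev_Zw ev_Dw single_mult_zd)

lemma ev_dsec [simp]: "hsubst evg (dsec y) = y"
  unfolding dsec_def
  by (rule hlin_eqI[where x = y]) (auto intro!: hlin_intro simp del: hsubst_single simp: ev_nword)

lemma d_rels_carrier: "d_rels \<subseteq> carrier (free_halg UNIV)"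
  by (auto simp: d_rels_def letter_coef free_ops free_minus carrier_free)

lemma DR_hclosed: "hclosed DR"
  and DR_left: "x \<in> DR \<Longrightarrow> u * x \<in> DR"
  and DR_right: "x \<in> DR \<Longrightarrow> x * u \<in> DR"
  using Rel_hclosed[OF d_rels_carrier] Rel_mult_left[OF d_rels_carrier] Rel_mult_right[OF d_rels_carrier]
  by auto

lemma DR_relations:
  "single [GZ, GZinv] - 1 \<in> DR" "single [GZinv, GZ] - 1 \<in> DR"
  "single [GD, GDinv] - 1 \<in> DR" "single [GDinv, GD] - 1 \<in> DR"
  "single [GD, GZ] - q \<bullet> single [GZ, GD] \<in> DR"
  by (rule Rel_relation[OF d_rels_carrier];
      simp add: d_rels_def letter_coef free_ops free_minus)+

lemma ev_DR: "x \<in> DR \<Longrightarrow> hsubst evg x = 0"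
proof -
  assume x: "x \<in> DR"
  have q: "q powi 1 = q" by simp
  have "DR \<subseteq> {x. hsubst evg x \<in> {0}}"
  proof (rule Rel_minimal[OF d_rels_carrier hclosed_vimage[OF hlin_hsubst hclosed_singleton_zero]])
    fix x :: "d_gen list hs" assume "coef x \<in> d_rels"
    then have "x \<in> {single [GZ, GZinv] - 1, single [GZinv, GZ] - 1, single [GD, GDinv] - 1, single [GDinv, GD] - 1,
        single [GD, GZ] - q \<bullet> single [GZ, GD]}"
      by (auto simp: d_rels_def letter_coef free_ops free_minus coef_inject)
    then show "x \<in> {x. hsubst evg x \<in> {0}}"
      by (auto simp: single_mult_zd one_zd[symmetric])
  qed auto
  then show ?thesis using x by auto
qed

text \<open>Congruence modulo the relations of \<open>\<dd>\<^sub>q\<close>.\<close>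

definition deq :: "d_gen list hs \<Rightarrow> d_gen list hs \<Rightarrow> bool" (infix "\<approx>" 50) where
  "x \<approx> y \<longleftrightarrow> x - y \<in> DR"

lemma deq_refl [simp]: "x \<approx> x"
  by (simp add: deq_def hclosed_zero[OF DR_hclosed])

lemma deq_sym: "x \<approx> y \<Longrightarrow> y \<approx> x"
  unfolding deq_def using hclosed_minus[OF DR_hclosed] by fastforce

lemma deq_trans [trans]: "x \<approx> y \<Longrightarrow> y \<approx> z \<Longrightarrow> x \<approx> z"
  unfolding deq_def using hclosed_add[OF DR_hclosed, of "x - y" "y - z"] by simp

lemma deq_left: "x \<approx> y \<Longrightarrow> u * x \<approx> u * y"
  unfolding deq_def using DR_left[of "x - y" u] by (simp add: right_diff_distrib)

lemma deq_right: "x \<approx> y \<Longrightarrow> x * u \<approx> y * u"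
  unfolding deq_def using DR_right[of "x - y" u] by (simp add: left_diff_distrib)

lemma deq_scale: "x \<approx> y \<Longrightarrow> c \<bullet> x \<approx> c \<bullet> y"
  unfolding deq_def using hclosed_scale[OF DR_hclosed, of "x - y" c] by (simp add: hs.scale_right_diff_distrib)

lemma deq_cancel:
  "single (GZ # GZinv # w) \<approx> single w" "single (GZinv # GZ # w) \<approx> single w"
  "single (GD # GDinv # w) \<approx> single w" "single (GDinv # GD # w) \<approx> single w"
  using DR_relations(1-4)[THEN DR_right, of "single w"] by (simp_all add: deq_def left_diff_distrib one_list)

lemma deq_DZ:
  "single [GD, GZ] \<approx> q powi 1 \<bullet> single [GZ, GD]"
  "single [GD, GZinv] \<approx> q powi (-1) \<bullet> single [GZinv, GD]"
  "single [GDinv, GZ] \<approx> q powi (-1) \<bullet> single [GZ, GDinv]"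
  "single [GDinv, GZinv] \<approx> q powi 1 \<bullet> single [GZinv, GDinv]"
proof -
  show 1: "single [GD, GZ] \<approx> q powi 1 \<bullet> single [GZ, GD]"
    using DR_relations(5) by (simp add: deq_def)
  \<comment> \<open>Conjugating a commutation relation by an inverse letter inverts the power of \<open>q\<close>.\<close>
  have conj: "single [x', y] \<approx> d \<bullet> single [y, x']"
    if xy: "single [x, y] \<approx> c \<bullet> single [y, x]" and cd: "d * c = 1"
      and can: "\<And>w. single (x # x' # w) \<approx> single w" "\<And>w. single (x' # x # w) \<approx> single w" for x x' y c d
  proof -
    have "single [x', y] = single [x', y] * 1" by simp
    also have "\<dots> \<approx> single [x', y] * single [x, x']" using deq_sym[OF can(1)[of "[]"]] by (intro deq_left) (simp add: one_list)
    also have "\<dots> = single [x'] * ((d * c) \<bullet> single [y, x]) * single [x']" by (simp add: cd)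
    also have "\<dots> = d \<bullet> (single [x'] * (c \<bullet> single [y, x]) * single [x'])" by (simp del: single_mult_list)
    also have "\<dots> \<approx> d \<bullet> (single [x'] * single [x, y] * single [x'])"
      by (intro deq_scale deq_right deq_left deq_sym[OF xy])
    also have "\<dots> = d \<bullet> single (x' # x # [y, x'])" by simp
    also have "\<dots> \<approx> d \<bullet> single [y, x']" by (intro deq_scale can)
    finally show ?thesis .
  qed
  have conj': "single [x, y'] \<approx> d \<bullet> single [y', x]"
    if xy: "single [x, y] \<approx> c \<bullet> single [y, x]" and cd: "d * c = 1"
      and can: "\<And>w. single (y # y' # w) \<approx> single w" "\<And>w. single (y' # y # w) \<approx> single w" for x y y' c d
  proof -
    have "single [x, y'] = 1 * single [x, y']" by simp
    also have "\<dots> \<approx> single [y', y] * single [x, y']" using deq_sym[OF can(2)[of "[]"]] by (intro deq_right) (simp add: one_list)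
    also have "\<dots> = d \<bullet> (single [y'] * (c \<bullet> single [y, x]) * single [y'])" by (simp add: cd)
    also have "\<dots> \<approx> d \<bullet> (single [y'] * single [x, y] * single [y'])"
      by (intro deq_scale deq_right deq_left deq_sym[OF xy])
    also have "\<dots> = d \<bullet> (single [y', x] * single (y # y' # []))" by simp
    also have "\<dots> \<approx> d \<bullet> (single [y', x] * single [])" by (intro deq_scale deq_left can)
    finally show ?thesis by simp
  qed
  show "single [GDinv, GZ] \<approx> q powi (-1) \<bullet> single [GZ, GDinv]"
    by (rule conj[OF 1]) (simp_all only: qpow_mult_neg deq_cancel)
  show 2: "single [GD, GZinv] \<approx> q powi (-1) \<bullet> single [GZinv, GD]"
    by (rule conj'[OF 1]) (simp_all only: qpow_mult_neg deq_cancel)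
  show "single [GDinv, GZinv] \<approx> q powi 1 \<bullet> single [GZinv, GDinv]"
    by (rule conj[OF 2]) (simp_all only: qpow_mult_neg deq_cancel)
qed

lemma deq_past_power:
  assumes "single [x, y] \<approx> q powi m \<bullet> single [y, x]"
  shows "single (x # replicate n y) \<approx> q powi (int n * m) \<bullet> single (replicate n y @ [x])"
proof (induction n)
  case (Suc n)
  have "single (x # replicate (Suc n) y) = single [x, y] * single (replicate n y)" by simp
  also have "\<dots> \<approx> (q powi m \<bullet> single [y, x]) * single (replicate n y)" by (intro deq_right assms)
  also have "\<dots> = q powi m \<bullet> (single [y] * single (x # replicate n y))" by simp
  also have "\<dots> \<approx> q powi m \<bullet> (single [y] * (q powi (int n * m) \<bullet> single (replicate n y @ [x])))"
    by (intro deq_scale deq_left Suc)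
  also have "\<dots> = q powi (int (Suc n) * m) \<bullet> single (replicate (Suc n) y @ [x])"
    by (simp add: qpow_add distrib_right)
  finally show ?case .
qed simp

lemma deq_past_Zw:
  "single (GD # Zw a) \<approx> q powi a \<bullet> single (Zw a @ [GD])"
  "single (GDinv # Zw a) \<approx> q powi (- a) \<bullet> single (Zw a @ [GDinv])"
  using deq_past_power[OF deq_DZ(1), of "nat a"] deq_past_power[OF deq_DZ(2), of "nat (- a)"]
    deq_past_power[OF deq_DZ(3), of "nat a"] deq_past_power[OF deq_DZ(4), of "nat (- a)"]
  by (auto simp: Zw_def)

lemma deq_cons:
  "single (GZ # Zw a) \<approx> single (Zw (a + 1))" "single (GZinv # Zw a) \<approx> single (Zw (a - 1))"
  "single (GD # Dw a) \<approx> single (Dw (a + 1))" "single (GDinv # Dw a) \<approx> single (Dw (a - 1))"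
proof -
  have 1: "single (x # (if b \<ge> 0 then replicate (nat b) x else replicate (nat (- b)) x'))
      \<approx> single (if b + 1 \<ge> 0 then replicate (nat (b + 1)) x else replicate (nat (- (b + 1))) x')"
    if "\<And>w. single (x # x' # w) \<approx> single w" for x x' and b :: int
  proof (cases "b \<ge> 0")
    case True
    then show ?thesis by (simp add: nat_add_distrib)
  next
    case False
    then obtain n where "b = - int (Suc n)" by (metis int_cases not_le zero_le_imp_eq_int negative_eq_positive nat_int of_nat_0_le_iff)
    then show ?thesis using that[of "replicate n x'"] by (auto simp: nat_add_distrib)
  qed
  have 2: "single (x' # (if b \<ge> 0 then replicate (nat b) x else replicate (nat (- b)) x'))
      \<approx> single (if b - 1 \<ge> 0 then replicate (nat (b - 1)) x else replicate (nat (- (b - 1))) x')"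
    if "\<And>w. single (x' # x # w) \<approx> single w" for x x' and b :: int
  proof (cases "b \<ge> 1")
    case True
    then obtain n where "b = int (Suc n)" by (metis Suc_pred' int_one_le_iff_zero_less nat_eq_iff2 zero_less_nat_eq order.trans zero_le_one)
    then show ?thesis using that[of "replicate n x"] by (auto simp: nat_add_distrib)
  next
    case False
    then obtain n where "b = - int n" by (intro that[of "nat (- b)"]) auto
    then show ?thesis by (cases n) (auto simp: nat_add_distrib)
  qed
  show "single (GZ # Zw a) \<approx> single (Zw (a + 1))" "single (GD # Dw a) \<approx> single (Dw (a + 1))"
    unfolding Zw_def Dw_def by (rule 1, rule deq_cancel)+
  show "single (GZinv # Zw a) \<approx> single (Zw (a - 1))" "single (GDinv # Dw a) \<approx> single (Dw (a - 1))"
    unfolding Zw_def Dw_def by (rule 2, rule deq_cancel)+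
qed

text \<open>
  The inductive step of the normal form: a generator is multiplied to a word in normal form by
  cancelling it, or moving it past the power of \<open>Z\<close>.
\<close>

lemma deq_gen_nword: "single (g # nword m) \<approx> dsec (evg g * single m)"
proof (cases m)
  case (Mon a j)
  have Z: "single (x # Zw a) \<approx> single (Zw b) \<Longrightarrow> single (x # Zw a @ Dw j) \<approx> single (Zw b @ Dw j)" for x b
    using deq_right[of "single (x # Zw a)" "single (Zw b)" "single (Dw j)"] by simp
  have D: "single (x # Zw a @ Dw j) \<approx> q powi c \<bullet> single (Zw a @ Dw b)"
    if 1: "single (x # Zw a) \<approx> q powi c \<bullet> single (Zw a @ [x])" and 2: "single (x # Dw j) \<approx> single (Dw b)" for x b c
  proof -
    have "single (x # Zw a @ Dw j) = single (x # Zw a) * single (Dw j)" by simp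
    also have "\<dots> \<approx> (q powi c \<bullet> single (Zw a @ [x])) * single (Dw j)" by (intro deq_right 1)
    also have "\<dots> = q powi c \<bullet> (single (Zw a) * single (x # Dw j))" by simp
    also have "\<dots> \<approx> q powi c \<bullet> (single (Zw a) * single (Dw b))" by (intro deq_scale deq_left 2)
    finally show ?thesis by simp
  qed
  show ?thesis
    using Z[OF deq_cons(1)] Z[OF deq_cons(2)] D[OF deq_past_Zw(1) deq_cons(3)] D[OF deq_past_Zw(2) deq_cons(4)]
    by (cases g) (auto simp: Mon dsec_def single_mult_zd hlin_scale[OF hlin_ext] add.commute)
qed

lemma dsec_ev_word: "single w \<approx> dsec (hsubst evg (single w))"
proof -
  have gen: "single [g] * dsec y \<approx> dsec (evg g * y)" for g y
    unfolding deq_def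
    by (rule hlin_mem_closed[where T = "\<lambda>y. single [g] * dsec y - dsec (evg g * y)" and x = y, OF _ DR_hclosed])
       (use deq_gen_nword in \<open>auto simp: deq_def dsec_def intro!: hlin_intro\<close>)
  show ?thesis
  proof (induction w)
    case Nil
    show ?case by (simp add: one_zd dsec_def Zw_def Dw_def)
  next
    case (Cons g w)
    have "single (g # w) = single [g] * single w" by simp
    also have "\<dots> \<approx> single [g] * dsec (hsubst evg (single w))" by (intro deq_left Cons)
    also have "\<dots> \<approx> dsec (evg g * hsubst evg (single w))" by (rule gen)
    finally show ?case by simp
  qed
qed

lemma dsec_ev: "x \<approx> dsec (hsubst evg x)"
  unfolding deq_def
  by (rule hlin_mem_closed[where T = "\<lambda>x. x - dsec (hsubst evg x)", OF _ DR_hclosed])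
     (use dsec_ev_word in \<open>auto simp: deq_def dsec_def intro!: hlin_intro\<close>)

text \<open>
  The resulting isomorphism onto \<open>\<dd>\<^sub>q\<close>.
\<close>

definition dqof :: "zd hs \<Rightarrow> d_elem" where "dqof y = cls UNIV d_rels (dsec y)"

lemma dqof_ev: "cls UNIV d_rels x = dqof (hsubst evg x)"
  using dsec_ev[of x] by (simp add: dqof_def cls_eq_iff[OF d_rels_carrier] deq_def)

lemma dq_carrier: "carrier dq = range dqof"
proof -
  have "carrier dq = range (cls UNIV d_rels)"
    by (simp add: dq_def presented_carrier[OF d_rels_carrier])
  moreover have "dqof y \<in> range (cls UNIV d_rels)" for y by (simp add: dqof_def)
  moreover have "cls UNIV d_rels x \<in> range dqof" for x by (simp add: dqof_ev)
  ultimately show ?thesis by (metis (no_types, lifting) image_subset_iff subset_antisym)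
qed

lemma dqof_inject: "dqof x = dqof y \<longleftrightarrow> x = y"
proof
  assume "dqof x = dqof y"
  then have "dsec x - dsec y \<in> DR" by (simp add: dqof_def cls_eq_iff[OF d_rels_carrier])
  then have "hsubst evg (dsec x - dsec y) = 0" by (rule ev_DR)
  then show "x = y" by simp
qed simp

lemma dqof_ops:
  "dqof x \<otimes>\<^bsub>dq\<^esub> dqof y = dqof (x * y)" "dqof x \<oplus>\<^bsub>dq\<^esub> dqof y = dqof (x + y)"
  "\<zero>\<^bsub>dq\<^esub> = dqof 0" "\<one>\<^bsub>dq\<^esub> = dqof 1" "c \<odot>\<^bsub>dq\<^esub> dqof x = dqof (c \<bullet> x)"
proof -
  have 1: "cls UNIV d_rels (dsec x * dsec y) = dqof (x * y)" "cls UNIV d_rels (dsec x + dsec y) = dqof (x + y)"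
    "cls UNIV d_rels (c \<bullet> dsec x) = dqof (c \<bullet> x)"
    by (simp_all add: dqof_ev)
  show "dqof x \<otimes>\<^bsub>dq\<^esub> dqof y = dqof (x * y)" "dqof x \<oplus>\<^bsub>dq\<^esub> dqof y = dqof (x + y)"
    "c \<odot>\<^bsub>dq\<^esub> dqof x = dqof (c \<bullet> x)"
    using 1 unfolding dq_def dqof_def[of x] dqof_def[of y] by (simp_all add: presented_ops[OF d_rels_carrier])
  show "\<zero>\<^bsub>dq\<^esub> = dqof 0" "\<one>\<^bsub>dq\<^esub> = dqof 1"
    by (simp_all add: dq_def presented_ops[OF d_rels_carrier] dqof_ev)
qed

lemma ring_dq: "ring dq" and dqof_minus: "dqof x \<ominus>\<^bsub>dq\<^esub> dqof y = dqof (x - y)"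
  using ring_of_surj[of dq dqof UNIV] by (auto simp: dq_carrier dqof_ops)

lemma dqof_uminus: "\<ominus>\<^bsub>dq\<^esub> dqof x = dqof (- x)"
proof -
  interpret ring dq by (rule ring_dq)
  show ?thesis by (rule minus_equality) (auto simp: dqof_ops dq_carrier)
qed

lemma dqof_commutator: "commutator dq (dqof x) (dqof y) = dqof (x * y - y * x)"
  by (simp add: commutator_def dqof_ops dqof_minus)

text \<open>
  Here \<open>f\<close> describes the integer powers of \<open>x\<close>; the negative ones are powers of the inverse \<open>y\<close>.
\<close>

lemma dqof_int_pow:
  assumes xy: "x * y = 1" "y * x = 1" and e: "\<And>n. x ^ n = f (int n)" "\<And>n. y ^ n = f (- int n)"
  shows "dqof x [^]\<^bsub>dq\<^esub> (a::int) = dqof (f a)"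
proof -
  interpret ring dq by (rule ring_dq)
  have nat: "dqof u [^]\<^bsub>dq\<^esub> (n::nat) = dqof (u ^ n)" for u n
    by (induction n) (simp_all add: dqof_ops power_Suc2 del: power_Suc)
  have "x ^ n * y ^ n = 1 \<and> y ^ n * x ^ n = 1" for n
  proof (induction n)
    case (Suc n)
    have "x ^ Suc n * y ^ Suc n = x ^ n * (x * y) * y ^ n" by (simp only: power_Suc2[of x] power_Suc[of y] mult.assoc)
    moreover have "y ^ Suc n * x ^ Suc n = y ^ n * (y * x) * x ^ n" by (simp only: power_Suc2[of y] power_Suc[of x] mult.assoc)
    ultimately show ?case using Suc xy by simp
  qed simp
  then have "inv\<^bsub>dq\<^esub> dqof (x ^ n) = dqof (y ^ n)" for n
    by (intro inv_unique'[symmetric]) (auto simp: dqof_ops dq_carrier)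
  then show ?thesis using e(1)[of "nat a"] e(2)[of "nat (- a)"]
    by (auto simp: int_pow_def2 nat)
qed

lemma Zpow_dqof: "Zpow a = dqof (single (Mon a 0))"
proof -
  have p: "single (Mon 1 0) ^ n = single (Mon (int n) 0)" "single (Mon (-1) 0) ^ n = single (Mon (- int n) 0)" for n
    by (induction n) (auto simp: one_zd single_mult_zd)
  have "dqof (single (Mon 1 0)) [^]\<^bsub>dq\<^esub> a = dqof (single (Mon a 0))"
    by (rule dqof_int_pow[where y = "single (Mon (-1) 0)"]) (auto simp: one_zd single_mult_zd p)
  then show ?thesis by (simp add: Zpow_def pgen_cls[OF d_rels_carrier] dqof_ev)
qed

lemma Dpow_dqof: "Dpow a = dqof (single (Mon 0 a))"
proof -
  have p: "single (Mon 0 1) ^ n = single (Mon 0 (int n))" "single (Mon 0 (-1)) ^ n = single (Mon 0 (- int n))" for n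
    by (induction n) (auto simp: one_zd single_mult_zd)
  have "dqof (single (Mon 0 1)) [^]\<^bsub>dq\<^esub> a = dqof (single (Mon 0 a))"
    by (rule dqof_int_pow[where y = "single (Mon 0 (-1))"]) (auto simp: one_zd single_mult_zd p)
  then show ?thesis by (simp add: Dpow_def pgen_cls[OF d_rels_carrier] dqof_ev)
qed

lemma ZD_dqof: "ZD a j = dqof (single (Mon a j))"
  by (simp add: ZD_def Zpow_dqof Dpow_dqof dqof_ops single_mult_zd)

section \<open>Linear independence of ordered monomials\<close>

text \<open>
  The Poincare-Birkhoff-Witt theorem, in a form that allows infinite sums: a word in the basis of a
  Lie algebra is reduced to sorted words by exchanging neighbours at the price of a shorter word that
  contains their bracket. The number of inversions makes this terminate.
\<close>

fun inv_count :: "'a::linorder list \<Rightarrow> nat" where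
  "inv_count [] = 0"
| "inv_count (x # xs) = length (filter (\<lambda>y. y < x) xs) + inv_count xs"

lemma inv_count_swap: "y < x \<Longrightarrow> inv_count (u @ y # x # v) < inv_count (u @ x # y # v)"
  by (induction u) auto

definition dpos :: "'a::linorder list \<Rightarrow> nat" where
  "dpos w = (LEAST k. Suc k < length w \<and> w ! Suc k < w ! k)"

lemma dpos_descent:
  assumes "\<not> sorted w"
  shows "Suc (dpos w) < length w" "w ! Suc (dpos w) < w ! dpos w"
    "w = take (dpos w) w @ w ! dpos w # w ! Suc (dpos w) # drop (dpos w + 2) w"
proof -
  have "\<exists>k. Suc k < length w \<and> w ! Suc k < w ! k"
    using assms by (auto simp: sorted_iff_nth_Suc not_le)
  then have "Suc (dpos w) < length w \<and> w ! Suc (dpos w) < w ! dpos w"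
    unfolding dpos_def by (rule LeastI_ex)
  then show *: "Suc (dpos w) < length w" "w ! Suc (dpos w) < w ! dpos w" by auto
  then show "w = take (dpos w) w @ w ! dpos w # w ! Suc (dpos w) # drop (dpos w + 2) w"
    by (metis Cons_nth_drop_Suc Suc_lessD add_2_eq_Suc' append_take_drop_id)
qed

lemma dpos_le: "y < x \<Longrightarrow> dpos (u @ x # y # v) \<le> length u"
  unfolding dpos_def by (rule Least_le) (auto simp: nth_append)

lemma not_sorted_descent: "y < x \<Longrightarrow> \<not> sorted (u @ x # y # v)"
  by (auto simp: sorted_append)

lemma ext_add_family: "ext f X + ext g X = ext (\<lambda>t. f t + g t) X"
  by (rule hlin_eqI[where x = X]) (auto intro!: hlin_intro)

lemma ext_diff_family: "ext f X - ext g X = ext (\<lambda>t. f t - g t) X"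
  by (rule hlin_eqI[where x = X]) (auto intro!: hlin_intro)

lemma ext_swap: "ext (\<lambda>t. ext (\<lambda>s. f t s) Y) X = ext (\<lambda>s. ext (\<lambda>t. f t s) X) Y"
  by (rule hlin_eqI[where x = X]) (auto intro!: hlin_intro)

abbreviation lin1 :: "'b hs \<Rightarrow> 'b list hs" where "lin1 \<equiv> ext (\<lambda>t. single [t])"

locale lie_structure =
  fixes Br :: "'b::linorder \<Rightarrow> 'b \<Rightarrow> 'b hs"
  assumes Br_anti: "Br x y = - Br y x"
    and Br_self: "Br x x = 0"
    and Br_jacobi: "ext (\<lambda>t. Br t z) (Br x y) + ext (\<lambda>t. Br t x) (Br y z) + ext (\<lambda>t. Br t y) (Br z x) = 0"
begin

text \<open>
  Reduction at the first descent of a word.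
\<close>

function reduce :: "'b list \<Rightarrow> 'b list hs" where
  "reduce w = (if sorted w then single w
     else reduce (take (dpos w) w @ w ! Suc (dpos w) # w ! dpos w # drop (dpos w + 2) w)
       + ext (\<lambda>t. reduce (take (dpos w) w @ t # drop (dpos w + 2) w)) (Br (w ! dpos w) (w ! Suc (dpos w))))"
  by pat_completeness auto
termination
proof (relation "measures [length, inv_count]")
  fix w :: "'b list" assume w: "\<not> sorted w"
  note d = dpos_descent[OF w]
  show "(take (dpos w) w @ w ! Suc (dpos w) # w ! dpos w # drop (dpos w + 2) w, w) \<in> measures [length, inv_count]"
    using inv_count_swap[OF d(2), of "take (dpos w) w" "drop (dpos w + 2) w"] d(1,3) by auto
  show "(take (dpos w) w @ t # drop (dpos w + 2) w, w) \<in> measures [length, inv_count]" for t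
    using d(1) by auto
qed auto

declare reduce.simps [simp del]

lemma reduce_sorted: "sorted w \<Longrightarrow> reduce w = single w"
  by (simp add: reduce.simps)

definition swapped :: "'b list \<Rightarrow> 'b \<Rightarrow> 'b \<Rightarrow> 'b list \<Rightarrow> bool" where
  "swapped u x y v \<longleftrightarrow> reduce (u @ x # y # v) = reduce (u @ y # x # v) + ext (\<lambda>t. reduce (u @ t # v)) (Br x y)"

lemma swapped_first:
  assumes "y < x" "dpos (u @ x # y # v) = length u"
  shows "swapped u x y v"
  unfolding swapped_def
  by (subst reduce.simps) (simp add: assms not_sorted_descent nth_append)

lemma swapped_sym: "swapped u x y v \<Longrightarrow> swapped u y x v"
  unfolding swapped_def Br_anti[of y x] by (simp add: hlin_minus[OF hlin_ext])

lemma swapped_refl: "swapped u x x v"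
  unfolding swapped_def by (simp add: Br_self hlin_zero[OF hlin_ext])

text \<open>
  The result of the reduction does not depend on the descent at which it starts. Two descents that do
  not overlap can be treated in either order; for overlapping ones \<open>p > x > y\<close>, both orders lead to the word
  \<open>y x p\<close>, and the brackets that they leave behind agree by the Jacobi identity.
\<close>

lemma swapped_descent: "y < x \<Longrightarrow> swapped u x y v"
proof (induction "u @ x # y # v" arbitrary: u x y v rule: wf_induct[OF wf_measures[of "[length, inv_count]"], consumes 0, case_names less])
  case (less u x y v)
  have short: "swapped u' x' y' v'" if "length (u' @ x' # y' # v') < length (u @ x # y # v)" for u' x' y' v'
  proof (rule linorder_cases[of x' y'])
    assume "x' < y'"
    then have "swapped u' y' x' v'"
      using less(1)[rule_format, of "u' @ y' # x' # v'" u' y' x' v'] that by simp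
    then show ?thesis by (rule swapped_sym)
  next
    assume "y' < x'"
    then show ?thesis
      using less(1)[rule_format, of "u' @ x' # y' # v'" u' x' y' v'] that by simp
  qed (simp add: swapped_refl)
  have eq: "swapped u' x' y' v'"
    if "y' < x'" "length (u' @ x' # y' # v') = length (u @ x # y # v)"
      "inv_count (u' @ x' # y' # v') < inv_count (u @ x # y # v)" for u' x' y' v'
    using less(1)[rule_format, of "u' @ x' # y' # v'" u' x' y' v'] that by simp
  let ?k = "dpos (u @ x # y # v)"
  have k: "?k \<le> length u" by (rule dpos_le[OF less(2)])
  note d = dpos_descent[OF not_sorted_descent[OF less(2)], of u v]
  consider (eq) "?k = length u" | (overlap) "Suc ?k = length u" | (disjoint) "Suc ?k < length u"
    using k by linarith
  then show "swapped u x y v"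
  proof cases
    case eq
    then show ?thesis by (rule swapped_first[OF less(2)])
  next
    case overlap
    define u1 where "u1 = take ?k u"
    define p where "p = u ! ?k"
    have u: "u = u1 @ [p]"
      unfolding u1_def p_def using overlap by (metis lessI take_Suc_conv_app_nth take_all order_refl)
    have len: "length u1 = ?k" using overlap by (simp add: u1_def)
    have px: "x < p" using d(2) overlap len by (simp add: u nth_append)
    then have py: "y < p" using less(2) by simp
    let ?G = "ext (\<lambda>s. reduce (u1 @ s # v))"
    have 1: "swapped u1 p x (y # v)"
      by (rule swapped_first[OF px]) (use len u in simp)
    have 2: "swapped (u1 @ [x]) p y v"
      by (rule eq[OF py]) (use inv_count_swap[OF px, of u1 "y # v"] u in auto)
    have 3: "swapped u1 x y (p # v)"
      by (rule eq[OF less(2)])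
         (use inv_count_swap[OF px, of u1 "y # v"] inv_count_swap[OF py, of "u1 @ [x]" v] u in auto)
    have 4: "swapped u1 p y (x # v)"
      by (rule eq[OF py]) (use inv_count_swap[OF less(2), of "u1 @ [p]" v] u in auto)
    have 5: "swapped (u1 @ [y]) p x v"
      by (rule eq[OF px])
         (use inv_count_swap[OF less(2), of "u1 @ [p]" v] inv_count_swap[OF py, of u1 "x # v"] u in auto)
    have tp: "reduce (u1 @ t # a # v) - reduce (u1 @ a # t # v) = ?G (Br t a)" for t a
      using short[of u1 t a v] by (simp add: u swapped_def)
    have G: "ext (\<lambda>t. ?G (Br t a)) X = ?G (ext (\<lambda>t. Br t a) X)" for a X
      by (rule hlin_ext_comp[OF hlin_ext, symmetric])
    have "ext (\<lambda>t. reduce (u1 @ t # p # v)) (Br x y) - ext (\<lambda>t. reduce (u1 @ p # t # v)) (Br x y)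
      - (ext (\<lambda>t. reduce (u1 @ t # x # v)) (Br p y) - ext (\<lambda>t. reduce (u1 @ x # t # v)) (Br p y))
      + (ext (\<lambda>t. reduce (u1 @ t # y # v)) (Br p x) - ext (\<lambda>t. reduce (u1 @ y # t # v)) (Br p x))
      = ?G (ext (\<lambda>t. Br t p) (Br x y)) - ?G (ext (\<lambda>t. Br t x) (Br p y)) + ?G (ext (\<lambda>t. Br t y) (Br p x))"
      by (simp only: ext_diff_family tp G)
    also have "\<dots> = ?G (ext (\<lambda>t. Br t p) (Br x y) + ext (\<lambda>t. Br t x) (Br y p) + ext (\<lambda>t. Br t y) (Br p x))"
      by (simp only: Br_anti[of y p] hlin_add[OF hlin_ext] hlin_minus[OF hlin_ext]) simp
    also have "\<dots> = 0" by (simp add: Br_jacobi hlin_zero[OF hlin_ext])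
    finally have jac: "ext (\<lambda>t. reduce (u1 @ t # p # v)) (Br x y) + ext (\<lambda>t. reduce (u1 @ x # t # v)) (Br p y)
        + ext (\<lambda>t. reduce (u1 @ t # y # v)) (Br p x)
      = ext (\<lambda>t. reduce (u1 @ p # t # v)) (Br x y) + ext (\<lambda>t. reduce (u1 @ t # x # v)) (Br p y)
        + ext (\<lambda>t. reduce (u1 @ y # t # v)) (Br p x)"
      by (simp add: algebra_simps)
    show ?thesis
      using 1 2 3 4 5 jac by (simp add: swapped_def u algebra_simps)
  next
    case disjoint
    define u1 where "u1 = take ?k u"
    define u2 where "u2 = drop (?k + 2) u"
    define p where "p = u ! ?k"
    define r where "r = u ! Suc ?k"
    have u: "u = u1 @ p # r # u2"
      unfolding u1_def p_def r_def u2_def using disjoint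
      by (metis Cons_nth_drop_Suc Suc_lessD add_2_eq_Suc' append_take_drop_id)
    have len: "length u1 = ?k" using disjoint by (simp add: u1_def)
    have pr: "r < p" using d(2) len by (simp add: u nth_append)
    have 1: "swapped u1 p r (u2 @ x # y # v)"
      by (rule swapped_first[OF pr]) (use len u in simp)
    have 2: "swapped (u1 @ r # p # u2) x y v"
      by (rule eq[OF less(2)]) (use inv_count_swap[OF pr, of u1 "u2 @ x # y # v"] u in auto)
    have 3: "swapped (u1 @ t # u2) x y v" for t
      by (rule short) (use u in auto)
    have 4: "swapped u1 p r (u2 @ y # x # v)"
      by (rule eq[OF pr]) (use inv_count_swap[OF less(2), of "u1 @ p # r # u2" v] u in auto)
    have 5: "swapped u1 p r (u2 @ t # v)" for t
      by (rule short) (use u in auto)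
    let ?A = "ext (\<lambda>t. ext (\<lambda>s. reduce (u1 @ t # u2 @ s # v)) (Br x y)) (Br p r)"
    have X3: "ext (\<lambda>t. reduce (u1 @ t # u2 @ x # y # v)) (Br p r) =
       ext (\<lambda>t. reduce (u1 @ t # u2 @ y # x # v)) (Br p r) + ?A"
      unfolding ext_add_family using 3 by (simp add: swapped_def)
    have X5: "ext (\<lambda>s. reduce (u1 @ p # r # u2 @ s # v)) (Br x y) =
       ext (\<lambda>s. reduce (u1 @ r # p # u2 @ s # v)) (Br x y) + ?A"
      unfolding ext_swap[of _ "Br x y" "Br p r"] ext_add_family using 5 by (simp add: swapped_def)
    show ?thesis
      using 1 2 4 X3 X5 by (simp add: swapped_def u algebra_simps)
  qed
qed

lemma swapped_all: "swapped u x y v"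
  by (rule linorder_cases[of x y]) (auto intro: swapped_descent swapped_refl swapped_sym)

definition pbw :: "'b list hs \<Rightarrow> 'b list hs" where "pbw = ext reduce"

definition lbr :: "'b hs \<Rightarrow> 'b hs \<Rightarrow> 'b hs" where "lbr X Y = ext (\<lambda>s. ext (\<lambda>t. Br s t) Y) X"

lemma hlin_lbr [hlin_intro]: "hlin T \<Longrightarrow> hlin (\<lambda>x. lbr (T x) Y)" "hlin T \<Longrightarrow> hlin (\<lambda>x. lbr X (T x))"
  unfolding lbr_def by (intro hlin_intro; assumption)+

lemma hlin_pbw: "hlin pbw"
  by (simp add: pbw_def hlin_ext)

lemma pbw_sorted: "sorted w \<Longrightarrow> pbw (single w) = single w"
  by (simp add: pbw_def reduce_sorted)

text \<open>
  The normal form vanishes on the relations of the enveloping algebra, while it fixes sorted words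
  (\<open>pbw_sorted\<close>): this is the linear independence of ordered monomials.
\<close>

lemma pbw_bracket:
  "pbw (u * (lin1 X * lin1 Y - lin1 Y * lin1 X - lin1 (lbr X Y)) * v) = 0"
proof -
  define F where "F u X Y v = pbw (u * (lin1 X * lin1 Y - lin1 Y * lin1 X - lin1 (lbr X Y)) * v)" for u X Y v
  have lin: "hlin (\<lambda>u. F u X Y v)" "hlin (\<lambda>X. F u X Y v)" "hlin (\<lambda>Y. F u X Y v)" "hlin (\<lambda>v. F u X Y v)" for u X Y v
    unfolding F_def pbw_def by (intro hlin_intro)+
  have "F (single u) (single x) (single y) (single v) = 0" for u x y v
  proof -
    have 1: "pbw (single u * lin1 X * single v) = ext (\<lambda>t. reduce (u @ t # v)) X" for X
      by (rule hlin_eqI[where x = X]) (auto intro!: hlin_intro simp: pbw_def)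
    show ?thesis
      using swapped_all[of u x y v] 1[of "Br x y"]
      by (simp add: F_def lbr_def swapped_def pbw_def algebra_simps hlin_diff[OF hlin_ext] hlin_add[OF hlin_ext])
  qed
  then have "F u (single x) (single y) (single v) = 0" for u x y v
    using hlin_eqI[OF lin(1) hlin_zero_intro] by blast
  then have "F u X (single y) (single v) = 0" for u X y v
    using hlin_eqI[OF lin(2) hlin_zero_intro] by blast
  then have "F u X Y (single v) = 0" for u X Y v
    using hlin_eqI[OF lin(3) hlin_zero_intro] by blast
  then have "F u X Y v = 0" for u X Y v
    using hlin_eqI[OF lin(4) hlin_zero_intro] by blast
  then show ?thesis by (simp add: F_def)
qed

end

section \<open>The Lie algebra \<open>\<dd>\<^sub>q\<close> and its central extension in coordinates\<close>

lemma int_interval_telescope: "(\<Sum>i = - int n..-1. g (i + 1) - g i) = g 0 - g (- int n)"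
  for g :: "int \<Rightarrow> 'a::ab_group_add"
proof (induction n)
  case (Suc n)
  have "{- int (Suc n)..-1} = insert (- int (Suc n)) {- int n..-1}" by auto
  then show ?case using Suc by (simp add: add.commute)
qed simp

text \<open>
  The cocycle in terms of both actual exponents of \<open>D\<close>; \<open>cocycle_val\<close> takes the negative of the second.
\<close>

definition bcoc :: "int \<Rightarrow> int \<Rightarrow> int \<Rightarrow> int \<Rightarrow> complex fps" where
  "bcoc a i b j = cocycle_val a i b (- j)"

lemma bcoc_anti: "bcoc a i b j = - bcoc b j a i"
  by (auto simp: bcoc_def cocycle_val_def algebra_simps)

lemma bcoc_eq_0: "i + j \<noteq> 0 \<Longrightarrow> bcoc a i b j = 0"
  by (auto simp: bcoc_def cocycle_val_def)

text \<open>
  Away from total degree zero the cocycle is the coboundary of \<open>Z\<^sup>s \<mapsto> 1 / (q\<^sup>s - 1)\<close>: its defining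
  sum is geometric with ratio \<open>q\<^sup>a\<^sup>+\<^sup>b\<close>.
\<close>

lemma bcoc_geometric:
  assumes "i + j = 0"
  shows "(q powi (a + b) - 1) * bcoc a i b j = q powi (b * i) - q powi (- (a * i))"
proof -
  have pos: "(q powi (a + b) - 1) * bcoc a i b (- i) = q powi (b * i) - q powi (- (a * i))" if "i > 0" for a i b
  proof -
    define n where "n = nat i"
    have n: "i = int n" using that by (simp add: n_def)
    define g where "g k = q powi ((a + b) * k + b * i)" for k
    have "g k = q powi (a * k + b * (k + i))" for k
      unfolding g_def by (rule arg_cong[where f = "\<lambda>m. q powi m"]) (simp add: algebra_simps)
    moreover have "bcoc a i b (- i) = (\<Sum>k = - i..-1. q powi (a * k + b * (k + i)))"
      using that by (simp only: bcoc_def cocycle_val_def minus_minus if_True simp_thms)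
    ultimately have "bcoc a i b (- i) = (\<Sum>k = - int n..-1. g k)"
      by (simp only: n)
    moreover have "(q powi (a + b) - 1) * g k = g (k + 1) - g k" for k
    proof -
      have "(a + b) * (k + 1) + b * i = (a + b) + ((a + b) * k + b * i)" by (simp add: algebra_simps)
      then have "g (k + 1) = q powi (a + b) * g k" unfolding g_def by (simp only: qpow_add)
      then show ?thesis by (simp add: left_diff_distrib)
    qed
    ultimately have "(q powi (a + b) - 1) * bcoc a i b (- i) = (\<Sum>k = - int n..-1. g (k + 1) - g k)"
      by (simp add: sum_distrib_left)
    also have "\<dots> = g 0 - g (- int n)" by (rule int_interval_telescope)
    also have "\<dots> = q powi (b * i) - q powi (- (a * i))" by (simp add: g_def n algebra_simps)
    finally show ?thesis .
  qed
  have j: "j = - i" using assms by simp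
  consider "i > 0" | "i = 0" | "j > 0" using assms by linarith
  then show ?thesis
  proof cases
    case 1 then show ?thesis using pos[of i a b] by (simp add: j)
  next
    case 2 then show ?thesis by (simp add: j bcoc_def cocycle_val_def)
  next
    case 3
    then show ?thesis using pos[of j b a] bcoc_anti[of a i b j] by (simp add: j algebra_simps)
  qed
qed

lemma bcoc_degree_0:
  assumes "i + j = 0" "a + b = 0"
  shows "bcoc a i b j = of_int i * q powi (b * i)"
proof -
  have pos: "bcoc a i (- a) (- i) = of_int i * q powi (- (a * i))" if "i > 0" for a i
    using that by (simp add: bcoc_def cocycle_val_def algebra_simps)
  have j: "j = - i" "b = - a" using assms by simp_all
  consider "i > 0" | "i = 0" | "j > 0" using assms by linarith
  then show ?thesis
  proof cases
    case 1 then show ?thesis using pos[of i a] by (simp add: j)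
  next
    case 2 then show ?thesis by (simp add: j bcoc_def cocycle_val_def)
  next
    case 3
    then show ?thesis using pos[of j b] bcoc_anti[of a i b j] by (simp add: j)
  qed
qed

text \<open>Identities between characters of \<open>\<int>\<close>, used for \<open>E n = q\<^sup>n\<close>.\<close>

lemma character_identities:
  fixes E :: "int \<Rightarrow> 'a::comm_ring_1"
  assumes E: "\<And>m n. E m * E n = E (m + n)"
  shows "(E (i * b) - E (j * a)) * (E ((i + j) * c) - E (k * (a + b)))
      + (E (j * c) - E (k * b)) * (E ((j + k) * a) - E (i * (b + c)))
      + (E (k * a) - E (i * c)) * (E ((k + i) * b) - E (j * (c + a))) = 0"
    and "k = - i - j \<Longrightarrow> c = - a - b \<Longrightarrow>
      (E (i * b) - E (j * a)) * (of_int (i + j) * E (c * (i + j)))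
      + (E (j * c) - E (k * b)) * (of_int (j + k) * E (a * (j + k)))
      + (E (k * a) - E (i * c)) * (of_int (k + i) * E (b * (k + i))) = 0"
    and "k = - i - j \<Longrightarrow>
      (E (i * b) - E (j * a)) * (E (c * (i + j)) - E (- ((a + b) * (i + j))))
      + (E (j * c) - E (k * b)) * (E (a * (j + k)) - E (- ((b + c) * (j + k))))
      + (E (k * a) - E (i * c)) * (E (b * (k + i)) - E (- ((c + a) * (k + i)))) = 0"
proof -
  show "(E (i * b) - E (j * a)) * (E ((i + j) * c) - E (k * (a + b)))
      + (E (j * c) - E (k * b)) * (E ((j + k) * a) - E (i * (b + c)))
      + (E (k * a) - E (i * c)) * (E ((k + i) * b) - E (j * (c + a))) = 0"
    by (simp add: algebra_simps E)
  assume k: "k = - i - j"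
  show "(E (i * b) - E (j * a)) * (E (c * (i + j)) - E (- ((a + b) * (i + j))))
      + (E (j * c) - E (k * b)) * (E (a * (j + k)) - E (- ((b + c) * (j + k))))
      + (E (k * a) - E (i * c)) * (E (b * (k + i)) - E (- ((c + a) * (k + i)))) = 0"
    unfolding k by (simp add: algebra_simps E)
  assume c: "c = - a - b"
  show "(E (i * b) - E (j * a)) * (of_int (i + j) * E (c * (i + j)))
      + (E (j * c) - E (k * b)) * (of_int (j + k) * E (a * (j + k)))
      + (E (k * a) - E (i * c)) * (of_int (k + i) * E (b * (k + i))) = 0"
    unfolding k c by (simp add: algebra_simps E)
qed

text \<open>
  The cocycle identity. In total degree \<open>s \<noteq> 0\<close> it holds since a coboundary is a cocycle, after
  multiplication by \<open>q\<^sup>s - 1\<close>; in degree \<open>0\<close> the value \<open>i q\<^sup>b\<^sup>i\<close> is explicit.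
\<close>

lemma bcoc_cocycle:
  "(q powi (i * b) - q powi (j * a)) * bcoc (a + b) (i + j) c k
    + (q powi (j * c) - q powi (k * b)) * bcoc (b + c) (j + k) a i
    + (q powi (k * a) - q powi (i * c)) * bcoc (c + a) (k + i) b j = 0"
proof (cases "i + j + k = 0")
  case False
  then show ?thesis by (simp add: bcoc_eq_0 algebra_simps)
next
  case deg: True
  then have k: "k = - i - j" by simp
  show ?thesis
  proof (cases "a + b + c = 0")
    case True
    then have c: "c = - a - b" by simp
    have "bcoc (a + b) (i + j) c k = of_int (i + j) * q powi (c * (i + j))"
      "bcoc (b + c) (j + k) a i = of_int (j + k) * q powi (a * (j + k))"
      "bcoc (c + a) (k + i) b j = of_int (k + i) * q powi (b * (k + i))"
      by (rule bcoc_degree_0; use deg True in simp)+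
    then show ?thesis
      using character_identities(2)[of "\<lambda>n. q powi n", OF qpow_add[symmetric] k c] by (simp only:)
  next
    case s: False
    let ?t = "q powi (a + b + c) - 1"
    have t: "?t \<noteq> 0" using s qpow_eq_iff[of "a + b + c" 0] by simp
    have 1: "?t * bcoc (a + b) (i + j) c k = q powi (c * (i + j)) - q powi (- ((a + b) * (i + j)))"
      using bcoc_geometric[of "i + j" k "a + b" c] deg by (simp add: add.assoc)
    have 2: "?t * bcoc (b + c) (j + k) a i = q powi (a * (j + k)) - q powi (- ((b + c) * (j + k)))"
      using bcoc_geometric[of "j + k" i "b + c" a] deg by (simp add: add_ac)
    have 3: "?t * bcoc (c + a) (k + i) b j = q powi (b * (k + i)) - q powi (- ((c + a) * (k + i)))"
      using bcoc_geometric[of "k + i" j "c + a" b] deg by (simp add: add_ac)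
    let ?L = "(q powi (i * b) - q powi (j * a)) * bcoc (a + b) (i + j) c k
      + (q powi (j * c) - q powi (k * b)) * bcoc (b + c) (j + k) a i
      + (q powi (k * a) - q powi (i * c)) * bcoc (c + a) (k + i) b j"
    have "?t * ?L = (q powi (i * b) - q powi (j * a)) * (?t * bcoc (a + b) (i + j) c k)
      + (q powi (j * c) - q powi (k * b)) * (?t * bcoc (b + c) (j + k) a i)
      + (q powi (k * a) - q powi (i * c)) * (?t * bcoc (c + a) (k + i) b j)"
      by (simp only: distrib_left mult.left_commute)
    also have "\<dots> = 0"
      unfolding 1 2 3 by (rule character_identities(3)[of "\<lambda>n. q powi n", OF qpow_add[symmetric] k])
    finally show ?thesis using t by simp
  qed
qed

instantiation zd :: linorder
begin
fun less_eq_zd :: "zd \<Rightarrow> zd \<Rightarrow> bool" where "less_eq_zd (Mon a i) (Mon b j) \<longleftrightarrow> a < b \<or> a = b \<and> i \<le> j"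
definition less_zd :: "zd \<Rightarrow> zd \<Rightarrow> bool" where "less_zd x y \<longleftrightarrow> x \<le> y \<and> \<not> y \<le> x"
instance
proof
  fix x y z :: zd
  obtain a i b j c k where eq: "x = Mon a i" "y = Mon b j" "z = Mon c k" by (metis zd.exhaust)
  show "x < y \<longleftrightarrow> x \<le> y \<and> \<not> y \<le> x" by (rule less_zd_def)
  show "x \<le> x" "x \<le> y \<Longrightarrow> y \<le> z \<Longrightarrow> x \<le> z" "x \<le> y \<Longrightarrow> y \<le> x \<Longrightarrow> x = y" "x \<le> y \<or> y \<le> x"
    by (auto simp: eq)
qed
end

text \<open>
  The index \<open>None\<close> is the central element and \<open>Some (Mon a j)\<close> is \<open>Z\<^sup>a D\<^sup>j\<close>.
\<close>

fun dbr :: "zd option \<Rightarrow> zd option \<Rightarrow> zd option hs" where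
  "dbr (Some (Mon a i)) (Some (Mon b j)) =
     (q powi (i * b) - q powi (j * a)) \<bullet> single (Some (Mon (a + b) (i + j))) + bcoc a i b j \<bullet> single None"
| "dbr _ _ = 0"

lemma dbr_None [simp]: "dbr None x = 0" "dbr x None = 0"
  by (cases x; simp)+

lemma ext_zero_family [simp]: "ext (\<lambda>t. 0) X = 0"
  by (rule hlin_eqI[where x = X]) (auto intro!: hlin_intro)

interpretation lie_structure dbr
proof
  fix x y z :: "zd option"
  have anti: "dbr x y = - dbr y x" for x y
  proof (cases "x = None \<or> y = None")
    case False
    then obtain a i b j where eq: "x = Some (Mon a i)" "y = Some (Mon b j)"
      by (metis not_None_eq zd.exhaust)
    show ?thesis
      unfolding eq by (rule hs_eqI) (simp add: bcoc_anti[of a i b j] add.commute)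
  qed auto
  show "dbr x y = - dbr y x" by (rule anti)
  show "dbr x x = 0"
  proof (cases "x = None")
    case False
    then obtain a i where eq: "x = Some (Mon a i)" by (metis not_None_eq zd.exhaust)
    have "bcoc a i a i = 0" using bcoc_anti[of a i a i] by simp
    then show ?thesis by (simp add: eq)
  qed simp
  show "ext (\<lambda>t. dbr t z) (dbr x y) + ext (\<lambda>t. dbr t x) (dbr y z) + ext (\<lambda>t. dbr t y) (dbr z x) = 0"
  proof (cases "x = None \<or> y = None \<or> z = None")
    case False
    then obtain a i b j c k where eq: "x = Some (Mon a i)" "y = Some (Mon b j)" "z = Some (Mon c k)"
      by (metis not_None_eq zd.exhaust)
    have m: "(q powi (i * b) - q powi (j * a)) * (q powi ((i + j) * c) - q powi (k * (a + b)))
      + (q powi (j * c) - q powi (k * b)) * (q powi ((j + k) * a) - q powi (i * (b + c)))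
      + (q powi (k * a) - q powi (i * c)) * (q powi ((k + i) * b) - q powi (j * (c + a))) = 0"
      by (rule character_identities(1)[of "\<lambda>n. q powi n", OF qpow_add[symmetric]])
    have idx: "Mon (b + c + a) (j + k + i) = Mon (a + b + c) (i + j + k)"
      "Mon (c + a + b) (k + i + j) = Mon (a + b + c) (i + j + k)" by simp_all
    show ?thesis
      using m bcoc_cocycle[of i b j a c k]
      by (simp add: eq hlin_add[OF hlin_ext] hlin_scale[OF hlin_ext] hlin_zero[OF hlin_ext] hs.scale_right_distrib idx
          hs.scale_left_distrib[symmetric] add.assoc[symmetric])
        (rule hs_eqI, simp)
  qed (auto simp: hlin_zero[OF hlin_ext])
qed

text \<open>
  The variant of \<open>hlin_eqI\<close> for a single coefficient of the two sides.
\<close>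

lemma coef_hlin_eqI:
  assumes "hlin S" "hlin T" "\<And>i. coef (S (single i)) j = coef (T (single i)) k"
  shows "coef (S x) j = coef (T x) k"
proof -
  have "hlin (\<lambda>x. coef (S x) j \<bullet> single ())" "hlin (\<lambda>x. coef (T x) k \<bullet> single ())"
    using assms(1,2) by (auto simp: hlin_def hs.scale_left_distrib)
  then have "coef (S x) j \<bullet> single () = coef (T x) k \<bullet> single ()"
    by (rule hlin_eqI) (simp add: assms(3))
  then have "coef (coef (S x) j \<bullet> single ()) () = coef (coef (T x) k \<bullet> single ()) ()" by simp
  then show ?thesis by simp
qed

text \<open>
  An element of the central extension is its \<open>\<dd>\<^sub>q\<close>-part together with its coefficient at \<open>None\<close>; \<open>barof\<close>
  identifies it with an element of \<open>bar_dq\<close>.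
\<close>

definition dpart :: "zd option hs \<Rightarrow> zd hs" where
  "dpart = ext (\<lambda>t. case t of None \<Rightarrow> 0 | Some m \<Rightarrow> single m)"

definition demb :: "zd hs \<Rightarrow> zd option hs" where "demb = ext (\<lambda>m. single (Some m))"

definition dphi :: "zd hs \<Rightarrow> zd hs \<Rightarrow> complex fps" where
  "dphi x y = coef (lbr (demb x) (demb y)) None"

definition barof :: "zd option hs \<Rightarrow> d_elem \<times> complex fps" where
  "barof x = (dqof (dpart x), coef x None)"

lemma hlin_dpart: "hlin dpart" and hlin_demb: "hlin demb"
  by (simp_all add: dpart_def demb_def hlin_ext)

lemma dpart_simps [simp]:
  "dpart (single None) = 0" "dpart (single (Some m)) = single m" "dpart (x + y) = dpart x + dpart y"
  "dpart (c \<bullet> x) = c \<bullet> dpart x" "dpart 0 = 0" "dpart (x - y) = dpart x - dpart y"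
  by (simp_all add: hlin_add[OF hlin_dpart] hlin_scale[OF hlin_dpart] hlin_zero[OF hlin_dpart] hlin_diff[OF hlin_dpart])
     (simp_all add: dpart_def)

lemma demb_simps [simp]:
  "demb (single m) = single (Some m)" "demb (x + y) = demb x + demb y" "demb (c \<bullet> x) = c \<bullet> demb x"
  by (simp_all add: hlin_add[OF hlin_demb] hlin_scale[OF hlin_demb])
     (simp add: demb_def)

lemma dpart_demb [simp]: "dpart (demb y) = y"
  by (rule hlin_eqI[where x = y]) (auto intro!: hlin_comp[OF hlin_dpart hlin_demb] hlin_intro)

lemma coef_demb_None [simp]: "coef (demb y) None = 0"
  using coef_hlin_eqI[of demb "\<lambda>_. 0 :: unit hs" None "()" y] by (simp add: hlin_demb hlin_intro)

lemma demb_dpart: "demb (dpart x) + coef x None \<bullet> single None = x"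
proof -
  have "hlin (\<lambda>x. demb (dpart x) + coef x None \<bullet> single None)"
    by (intro hlin_add_intro hlin_comp[OF hlin_demb hlin_dpart]) (simp add: hlin_def hs.scale_left_distrib)
  then show ?thesis
  proof (rule hlin_eqI[OF _ hlin_id_intro])
    fix i :: "zd option"
    show "demb (dpart (single i)) + coef (single i) None \<bullet> single None = single i"
      by (cases i) (auto simp: hlin_zero[OF hlin_demb])
  qed
qed

lemma barof_inject: "barof x = barof y \<longleftrightarrow> x = y"
proof
  assume "barof x = barof y"
  then have "dpart x = dpart y" "coef x None = coef y None" by (simp_all add: barof_def dqof_inject)
  then show "x = y" by (metis demb_dpart)
qed simp

lemma lbr_single: "lbr (single s) (single t) = dbr s t"
  by (simp add: lbr_def)

lemma hlin_lbr1: "hlin (\<lambda>x. lbr x y)" and hlin_lbr2: "hlin (\<lambda>y. lbr x y)"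
  by (intro hlin_intro)+

lemmas lbr_simps = hlin_add[OF hlin_lbr1] hlin_add[OF hlin_lbr2] hlin_scale[OF hlin_lbr1] hlin_scale[OF hlin_lbr2]
  hlin_diff[OF hlin_lbr1] hlin_diff[OF hlin_lbr2] hlin_zero[OF hlin_lbr1] hlin_zero[OF hlin_lbr2]
  hlin_minus[OF hlin_lbr1] hlin_minus[OF hlin_lbr2]

lemma dpart_lbr: "dpart (lbr x y) = dpart x * dpart y - dpart y * dpart x"
proof -
  have 1: "dpart (lbr (single s) (single t)) = dpart (single s) * dpart (single t) - dpart (single t) * dpart (single s)" for s t
  proof (cases "s = None \<or> t = None")
    case False
    then obtain a i b j where eq: "s = Some (Mon a i)" "t = Some (Mon b j)" by (metis not_None_eq zd.exhaust)
    show ?thesis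
      by (simp add: eq lbr_single single_mult_zd hs.scale_left_diff_distrib add.commute)
  qed (auto simp: lbr_single)
  have lin: "hlin (\<lambda>x. dpart x * y - y * dpart x)" "hlin (\<lambda>x. y * dpart x - dpart x * y)" for y
    by (intro hlin_diff_intro hlin_mult_intro hlin_dpart)+
  have "dpart (lbr x (single t)) = dpart x * dpart (single t) - dpart (single t) * dpart x" for t
    by (rule hlin_eqI[OF hlin_comp[OF hlin_dpart hlin_lbr1] lin(1)]) (rule 1)
  then show ?thesis
    by (rule hlin_eqI[OF hlin_comp[OF hlin_dpart hlin_lbr2] lin(2)])
qed

lemma coef_lbr_None: "coef (lbr x y) None = dphi (dpart x) (dpart y)"
proof -
  have 1: "coef (lbr (single s) (single t)) None = coef (lbr (demb (dpart (single s))) (demb (dpart (single t)))) None" for s t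
    by (cases s; cases t) (auto simp: lbr_single hlin_zero[OF hlin_demb] lbr_simps)
  have "coef (lbr x (single t)) None = coef (lbr (demb (dpart x)) (demb (dpart (single t)))) None" for t
    by (rule coef_hlin_eqI[where x = x, OF hlin_lbr1 hlin_lbr(1)[OF hlin_comp[OF hlin_demb hlin_dpart]]]) (rule 1)
  then show ?thesis
    unfolding dphi_def
    by (rule coef_hlin_eqI[where x = y, OF hlin_lbr2 hlin_lbr(2)[OF hlin_comp[OF hlin_demb hlin_dpart]]])
qed

lemma is_cocycle_dphi: "is_cocycle_d (\<lambda>X Y. dphi (inv_into UNIV dqof X) (inv_into UNIV dqof Y))"
proof -
  have "inj dqof" by (auto simp: inj_def dqof_inject)
  then have inv: "inv_into UNIV dqof (dqof x) = x" for x by (rule inv_f_f)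
  have "dphi (single (Mon a j)) (single (Mon b (- j'))) = cocycle_val a j b j'" for a j b j'
    by (simp add: dphi_def lbr_single bcoc_def)
  then show ?thesis
    by (auto simp: is_cocycle_d_def dq_carrier dqof_ops inv ZD_dqof dphi_def lbr_simps)
qed

text \<open>
  Any map satisfying \<open>is_cocycle_d\<close> is bilinear, hence continuous, and therefore determined by its values
  on the basis.
\<close>

lemma cocycle_d_dqof: "cocycle_d (dqof x) (dqof y) = dphi x y"
proof -
  have c: "is_cocycle_d cocycle_d"
    unfolding cocycle_d_def by (rule someI[where P = is_cocycle_d, OF is_cocycle_dphi])
  have add: "cocycle_d (dqof (x + y)) (dqof z) = cocycle_d (dqof x) (dqof z) + cocycle_d (dqof y) (dqof z)"
    "cocycle_d (dqof z) (dqof (x + y)) = cocycle_d (dqof z) (dqof x) + cocycle_d (dqof z) (dqof y)" for x y z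
    using c unfolding is_cocycle_d_def dq_carrier dqof_ops(2)[symmetric] by blast+
  have sc: "cocycle_d (dqof (c \<bullet> x)) (dqof y) = c * cocycle_d (dqof x) (dqof y)"
    "cocycle_d (dqof x) (dqof (c \<bullet> y)) = c * cocycle_d (dqof x) (dqof y)" for c x y
    using c unfolding is_cocycle_d_def dq_carrier dqof_ops(5)[symmetric] by blast+
  have 0: "cocycle_d (dqof (single m)) (dqof (single m')) = dphi (single m) (single m')" for m m'
  proof -
    obtain a j b k where eq: "m = Mon a j" "m' = Mon b k" by (metis zd.exhaust)
    have "cocycle_d (ZD a j) (ZD b (- (- k))) = cocycle_val a j b (- k)"
      using c unfolding is_cocycle_d_def by blast
    then show ?thesis by (simp add: eq ZD_dqof dphi_def lbr_single bcoc_def)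
  qed
  have lin: "hlin (\<lambda>x. cocycle_d (dqof x) (dqof y) \<bullet> single ())" "hlin (\<lambda>x. cocycle_d (dqof y) (dqof x) \<bullet> single ())"
    "hlin (\<lambda>x. dphi x y \<bullet> single ())" "hlin (\<lambda>x. dphi y x \<bullet> single ())" for y
    by (auto simp: hlin_def add sc hs.scale_left_distrib dphi_def lbr_simps)
  have "cocycle_d (dqof x) (dqof (single m')) \<bullet> single () = dphi x (single m') \<bullet> single ()" for m'
    by (rule hlin_eqI[OF lin(1) lin(3)]) (simp add: 0)
  then have "cocycle_d (dqof x) (dqof y) \<bullet> single () = dphi x y \<bullet> single ()"
    by (rule hlin_eqI[OF lin(2) lin(4)])
  then have "coef (cocycle_d (dqof x) (dqof y) \<bullet> single ()) () = coef (dphi x y \<bullet> single ()) ()" by simp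
  then show ?thesis by simp
qed

lemma bar_dq_carrier: "carrier bar_dq = range barof"
proof -
  have "(dqof y, s) = barof (demb y + s \<bullet> single None)" for y s by (simp add: barof_def)
  then have "range dqof \<times> UNIV \<subseteq> range barof" by fast
  moreover have "range barof \<subseteq> range dqof \<times> UNIV" by (auto simp: barof_def)
  ultimately show ?thesis by (simp add: bar_dq_def dq_carrier)
qed

lemma bar_dq_ops:
  "lie_add bar_dq (barof x) (barof y) = barof (x + y)"
  "lie_smult bar_dq c (barof x) = barof (c \<bullet> x)"
  "lie_bracket bar_dq (barof x) (barof y) = barof (lbr x y)"
  by (simp_all add: bar_dq_def barof_def dqof_ops dqof_commutator cocycle_d_dqof dpart_lbr coef_lbr_None)

subsection \<open>The subalgebra\<close>

text \<open>
  The power of \<open>h\<close> with which \<open>Z\<^sup>a D\<^sup>j\<close> enters the spanning set of \<open>bar_dq0\<close>.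
\<close>

fun wt :: "int \<Rightarrow> nat" where "wt j = (if j = 0 then 1 else nat \<bar>j\<bar> - 1)"

fun gen0 :: "zd option \<Rightarrow> zd option hs" where
  "gen0 None = single None"
| "gen0 (Some (Mon a j)) = h ^ wt j \<bullet> single (Some (Mon a j))"

definition ix0 :: "zd option set" where "ix0 = - {Some (Mon 0 0)}"

inductive_set L0 :: "zd option hs set" where
  base: "b \<in> ix0 \<Longrightarrow> gen0 b \<in> L0"
| add: "x \<in> L0 \<Longrightarrow> y \<in> L0 \<Longrightarrow> x + y \<in> L0"
| smult: "x \<in> L0 \<Longrightarrow> c \<bullet> x \<in> L0"

declare wt.simps [simp del]

lemma L0_zero: "0 \<in> L0"
  using L0.smult[OF L0.base[of None], of 0] by (simp add: ix0_def)

lemma bar_dq0_carrier: "carrier bar_dq0 = barof ` L0"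
proof -
  let ?G = "{(\<zero>\<^bsub>dq\<^esub>, 1)} \<union> {(h \<odot>\<^bsub>dq\<^esub> ZD k 0, 0) | k. k \<noteq> 0} \<union>
      {(h ^ (j - 1) \<odot>\<^bsub>dq\<^esub> ZD i (int j), 0) | i j. 1 \<le> j} \<union>
      {(h ^ (j - 1) \<odot>\<^bsub>dq\<^esub> ZD i (- int j), 0) | i j. 1 \<le> j}"
  have g: "barof (gen0 None) = (\<zero>\<^bsub>dq\<^esub>, 1)"
    "barof (gen0 (Some (Mon k j))) = (h ^ wt j \<odot>\<^bsub>dq\<^esub> ZD k j, 0)" for k j
    by (simp_all add: barof_def dqof_ops ZD_dqof)
  have sub: "p \<in> barof ` gen0 ` ix0" if p: "p \<in> ?G" for p
  proof -
    consider "p = (\<zero>\<^bsub>dq\<^esub>, 1)" | k where "k \<noteq> 0" "p = (h \<odot>\<^bsub>dq\<^esub> ZD k 0, 0)"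
      | i j where "1 \<le> j" "p = (h ^ (j - 1) \<odot>\<^bsub>dq\<^esub> ZD i (int j), 0)"
      | i j where "1 \<le> j" "p = (h ^ (j - 1) \<odot>\<^bsub>dq\<^esub> ZD i (- int j), 0)"
      using p unfolding Un_iff mem_Collect_eq singleton_iff by blast
    then show ?thesis
    proof cases
      case 1
      then show ?thesis using g(1) by (auto simp: ix0_def intro!: image_eqI[of _ _ "gen0 None"])
    next
      case (2 k)
      then have "p = barof (gen0 (Some (Mon k 0)))" "Some (Mon k 0) \<in> ix0" by (simp_all only: g) (simp_all add: wt.simps ix0_def)
      then show ?thesis by blast
    next
      case (3 i j)
      then have "p = barof (gen0 (Some (Mon i (int j))))" "Some (Mon i (int j)) \<in> ix0" by (simp_all only: g) (simp_all add: wt.simps ix0_def)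
      then show ?thesis by blast
    next
      case (4 i j)
      then have "p = barof (gen0 (Some (Mon i (- int j))))" "Some (Mon i (- int j)) \<in> ix0" by (simp_all only: g) (simp_all add: wt.simps ix0_def)
      then show ?thesis by blast
    qed
  qed
  have sup: "barof (gen0 b) \<in> ?G" if "b \<in> ix0" for b
  proof (cases b)
    case None
    then show ?thesis using g(1) by simp
  next
    case (Some m)
    obtain k j where m: "m = Mon k j" by (cases m)
    consider "j = 0" | "j > 0" | "j < 0" by linarith
    then show ?thesis
    proof cases
      case 1
      then have "barof (gen0 b) = (h \<odot>\<^bsub>dq\<^esub> ZD k 0, 0)" "k \<noteq> 0"
        using that by (simp_all only: Some m g) (simp_all add: wt.simps ix0_def Some m)
      then show ?thesis by blast
    next
      case 2
      then have "barof (gen0 b) = (h ^ (nat j - 1) \<odot>\<^bsub>dq\<^esub> ZD k (int (nat j)), 0)" "1 \<le> nat j"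
        by (simp_all only: Some m g) (simp_all add: wt.simps)
      then show ?thesis by blast
    next
      case 3
      then have "barof (gen0 b) = (h ^ (nat (- j) - 1) \<odot>\<^bsub>dq\<^esub> ZD k (- int (nat (- j))), 0)" "1 \<le> nat (- j)"
        by (simp_all only: Some m g) (simp_all add: wt.simps)
      then show ?thesis by blast
    qed
  qed
  have "lie_span bar_dq ?G = barof ` L0"
  proof (intro equalityI subsetI)
    fix p assume "p \<in> lie_span bar_dq ?G"
    then show "p \<in> barof ` L0"
    proof induction
      case (base x)
      then show ?case using sub[of x] L0.base by blast
    qed (auto simp: bar_dq_ops intro: L0.add L0.smult)
  next
    fix p assume "p \<in> barof ` L0"
    then obtain x where x: "x \<in> L0" "p = barof x" by blast
    from x(1) have "barof x \<in> lie_span bar_dq ?G"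
    proof induction
      case (base b)
      then show ?case by (intro lie_span.base sup)
    next
      case (add x y)
      then show ?case using lie_span.add[of "barof x" bar_dq ?G "barof y"] by (simp only: bar_dq_ops)
    next
      case (smult x c)
      then show ?case using lie_span.smult[of "barof x" bar_dq ?G c] by (simp only: bar_dq_ops)
    qed
    then show "p \<in> lie_span bar_dq ?G" by (simp only: x)
  qed
  then show ?thesis by (simp add: bar_dq0_def)
qed

lemma bar_dq0_ops:
  "lie_add bar_dq0 (barof x) (barof y) = barof (x + y)"
  "lie_smult bar_dq0 c (barof x) = barof (c \<bullet> x)"
  "lie_bracket bar_dq0 (barof x) (barof y) = barof (lbr x y)"
  using bar_dq_ops by (simp_all add: bar_dq0_def)

lemma L0_dvd:
  assumes "h ^ wt j dvd c" "Mon a j \<noteq> Mon 0 0"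
  shows "c \<bullet> single (Some (Mon a j)) \<in> L0"
proof -
  obtain d where d: "c = h ^ wt j * d" using assms(1) by blast
  have "d \<bullet> gen0 (Some (Mon a j)) \<in> L0" using assms(2) by (intro L0.smult L0.base) (simp add: ix0_def)
  then show ?thesis by (simp add: d mult.commute)
qed

lemma L0_central: "c \<bullet> single None \<in> L0"
  using L0.smult[OF L0.base[of None]] by (simp add: ix0_def)

text \<open>
  The bracket gains one factor \<open>h\<close> from \<open>q\<^sup>m - q\<^sup>n\<close>, which is exactly what the powers of \<open>h\<close> in
  the spanning set require.
\<close>

lemma L0_lbr_gen0: "b \<in> ix0 \<Longrightarrow> b' \<in> ix0 \<Longrightarrow> lbr (gen0 b) (gen0 b') \<in> L0"
proof (cases "b = None \<or> b' = None")
  case True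
  then have "lbr (gen0 b) (gen0 b') = 0"
    by (cases b rule: gen0.cases; cases b' rule: gen0.cases) (auto simp: lbr_simps lbr_single)
  then show ?thesis by (simp add: L0_zero)
next
  case False
  then obtain a i a' j where eq: "b = Some (Mon a i)" "b' = Some (Mon a' j)" by (metis not_None_eq zd.exhaust)
  have 1: "(h ^ wt i * h ^ wt j * (q powi (i * a') - q powi (j * a))) \<bullet> single (Some (Mon (a + a') (i + j))) \<in> L0"
  proof (cases "Mon (a + a') (i + j) = Mon 0 0")
    case True
    then have "a' = - a" "j = - i" by auto
    then show ?thesis by (simp add: L0_zero)
  next
    case False
    have "wt (i + j) \<le> wt i + wt j + 1" by (auto simp: wt.simps)
    then have "h ^ wt (i + j) dvd h ^ (wt i + wt j + 1)" by (rule le_imp_power_dvd)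
    then have "h ^ wt (i + j) dvd h ^ (wt i + wt j + 1) * qdiff (i * a') (j * a)" by (rule dvd_mult2)
    then have "h ^ wt (i + j) dvd h ^ wt i * h ^ wt j * (q powi (i * a') - q powi (j * a))"
      unfolding h_qdiff[symmetric] by (simp add: power_add mult_ac)
    then show ?thesis by (rule L0_dvd) (use False in simp)
  qed
  have "lbr (gen0 b) (gen0 b') = (h ^ wt i * h ^ wt j * (q powi (i * a') - q powi (j * a))) \<bullet> single (Some (Mon (a + a') (i + j)))
      + (h ^ wt i * h ^ wt j * bcoc a i a' j) \<bullet> single None"
    by (simp only: eq gen0.simps lbr_simps lbr_single dbr.simps hs.scale_right_distrib hs.scale_scale mult.assoc mult.left_commute)
  then show ?thesis using L0.add[OF 1 L0_central] by simp
qed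

lemma L0_lbr:
  assumes "x \<in> L0" "y \<in> L0"
  shows "lbr x y \<in> L0"
proof -
  have "lbr (gen0 b) y \<in> L0" if "b \<in> ix0" for b
    using assms(2)
    by induction (simp_all only: L0_lbr_gen0 that lbr_simps L0.add L0.smult)
  with assms(1) show ?thesis
    by induction (simp_all only: lbr_simps L0.add L0.smult)
qed

section \<open>Enveloping algebras\<close>

abbreviation bra :: "'a::ring \<Rightarrow> 'a \<Rightarrow> 'a" where "bra x y \<equiv> x * y - y * x"

abbreviation lt :: "zd option hs \<Rightarrow> (d_elem \<times> complex fps) list hs" where "lt x \<equiv> single [barof x]"

lemma image_family_2:
  assumes "\<And>x y. x \<in> A \<Longrightarrow> y \<in> A \<Longrightarrow> f (b x) (b y) = c (g x y)"
  shows "{f x y | x y. x \<in> b ` A \<and> y \<in> b ` A} = c ` {g x y | x y. x \<in> A \<and> y \<in> A}" (is "?L = ?R")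
proof (intro equalityI subsetI)
  fix p assume "p \<in> ?L"
  then obtain x y where "x \<in> A" "y \<in> A" "p = f (b x) (b y)" by blast
  then have "p = c (g x y)" "g x y \<in> {g x y | x y. x \<in> A \<and> y \<in> A}" using assms by auto
  then show "p \<in> ?R" by (rule image_eqI)
next
  fix p assume "p \<in> ?R"
  then obtain x y where "x \<in> A" "y \<in> A" "p = c (g x y)" by blast
  then have "p = f (b x) (b y)" "b x \<in> b ` A" "b y \<in> b ` A" using assms by auto
  then show "p \<in> ?L" by blast
qed

lemma image_family_1:
  assumes "\<And>k x. x \<in> A \<Longrightarrow> f k (b x) = c (g k x)"
  shows "{f k x | k x. x \<in> b ` A} = c ` {g k x | k x. x \<in> A}" (is "?L = ?R")
proof (intro equalityI subsetI)
  fix p assume "p \<in> ?L"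
  then obtain k x where "x \<in> A" "p = f k (b x)" by blast
  then have "p = c (g k x)" "g k x \<in> {g k x | k x. x \<in> A}" using assms by auto
  then show "p \<in> ?R" by (rule image_eqI)
next
  fix p assume "p \<in> ?R"
  then obtain k x where "x \<in> A" "p = c (g k x)" by blast
  then have "p = f k (b x)" "b x \<in> b ` A" using assms by auto
  then show "p \<in> ?L" by blast
qed

text \<open>
  The two Lie algebras \<open>bar_dq\<close> and \<open>bar_dq0\<close> in coordinates, treated in parallel.
\<close>

locale bar_lie =
  fixes L :: "(d_elem \<times> complex fps) hlie" and A :: "zd option hs set"
  assumes car: "carrier L = barof ` A"
    and ops: "lie_add L (barof x) (barof y) = barof (x + y)"
      "lie_smult L c (barof x) = barof (c \<bullet> x)"
      "lie_bracket L (barof x) (barof y) = barof (lbr x y)"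
    and A: "x \<in> A \<Longrightarrow> y \<in> A \<Longrightarrow> x + y \<in> A" "x \<in> A \<Longrightarrow> c \<bullet> x \<in> A"
      "x \<in> A \<Longrightarrow> y \<in> A \<Longrightarrow> lbr x y \<in> A" "0 \<in> A"
begin

abbreviation "F \<equiv> free_on (carrier L)"
abbreviation "U \<equiv> Rel (carrier L) (uea_rels L)"

lemma lt_F: "x \<in> A \<Longrightarrow> lt x \<in> F"
  by (simp add: free_on_single car)

lemma uea_rels_eq: "uea_rels L = coef ` (
    {lt (x + y) - (lt x + lt y) | x y. x \<in> A \<and> y \<in> A} \<union>
    {lt (c \<bullet> x) - c \<bullet> lt x | c x. x \<in> A} \<union>
    {bra (lt x) (lt y) - lt (lbr x y) | x y. x \<in> A \<and> y \<in> A})" (is "_ = coef ` (?A \<union> ?B \<union> ?C)")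
proof -
  let ?F = "free_halg (carrier L)"
  have 1: "letter (barof (x + y)) \<ominus>\<^bsub>?F\<^esub> (letter (barof x) \<oplus>\<^bsub>?F\<^esub> letter (barof y)) = coef (lt (x + y) - (lt x + lt y))"
    if "x \<in> A" "y \<in> A" for x y
    using that by (simp add: letter_coef free_ops free_minus lt_F A free_on_closed)
  have 2: "letter (barof (c \<bullet> x)) \<ominus>\<^bsub>?F\<^esub> c \<odot>\<^bsub>?F\<^esub> letter (barof x) = coef (lt (c \<bullet> x) - c \<bullet> lt x)"
    if "x \<in> A" for c x
    using that by (simp add: letter_coef free_ops free_minus lt_F A free_on_closed)
  have 3: "commutator ?F (letter (barof x)) (letter (barof y)) \<ominus>\<^bsub>?F\<^esub> letter (barof (lbr x y)) =
      coef (bra (lt x) (lt y) - lt (lbr x y))"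
    if "x \<in> A" "y \<in> A" for x y
    using that unfolding commutator_def letter_coef free_ops
    by (simp only: free_minus lt_F A free_on_closed free_on_mult)
  have "{letter (lie_add L x y) \<ominus>\<^bsub>?F\<^esub> (letter x \<oplus>\<^bsub>?F\<^esub> letter y) | x y. x \<in> carrier L \<and> y \<in> carrier L} = coef ` ?A"
    unfolding car by (rule image_family_2) (simp only: ops 1[unfolded car])
  moreover have "{letter (lie_smult L c x) \<ominus>\<^bsub>?F\<^esub> c \<odot>\<^bsub>?F\<^esub> letter x | c x. x \<in> carrier L} = coef ` ?B"
    unfolding car by (rule image_family_1) (simp only: ops 2[unfolded car])
  moreover have "{commutator ?F (letter x) (letter y) \<ominus>\<^bsub>?F\<^esub> letter (lie_bracket L x y) | x y.
      x \<in> carrier L \<and> y \<in> carrier L} = coef ` ?C"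
    unfolding car by (rule image_family_2) (simp only: ops 3[unfolded car])
  ultimately show ?thesis unfolding uea_rels_def Let_def image_Un by simp
qed

lemma uea_rels_carrier: "uea_rels L \<subseteq> carrier (free_halg (carrier L))"
  unfolding uea_rels_eq carrier_free
  by (intro image_mono) (auto simp: lt_F A free_on_closed free_on_mult simp del: single_mult_list)

lemma U_relations:
  "x \<in> A \<Longrightarrow> y \<in> A \<Longrightarrow> lt (x + y) - (lt x + lt y) \<in> U"
  "x \<in> A \<Longrightarrow> lt (c \<bullet> x) - c \<bullet> lt x \<in> U"
  "x \<in> A \<Longrightarrow> y \<in> A \<Longrightarrow> bra (lt x) (lt y) - lt (lbr x y) \<in> U"
proof -
  have *: "z \<in> U" if "coef z \<in> uea_rels L" for z
    using that by (rule Rel_relation[OF uea_rels_carrier])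
  show "x \<in> A \<Longrightarrow> y \<in> A \<Longrightarrow> lt (x + y) - (lt x + lt y) \<in> U"
    by (rule *, unfold uea_rels_eq, rule imageI) blast
  show "x \<in> A \<Longrightarrow> lt (c \<bullet> x) - c \<bullet> lt x \<in> U"
    by (rule *, unfold uea_rels_eq, rule imageI) blast
  show "x \<in> A \<Longrightarrow> y \<in> A \<Longrightarrow> bra (lt x) (lt y) - lt (lbr x y) \<in> U"
    by (rule *, unfold uea_rels_eq, rule imageI) blast
qed

lemmas U_hclosed = Rel_hclosed[OF uea_rels_carrier]
lemmas U_left = Rel_mult_left[OF uea_rels_carrier]
lemmas U_right = Rel_mult_right[OF uea_rels_carrier]

text \<open>\<open>rep z p\<close>: modulo the relations, \<open>z\<close> is the image of the Lie algebra element \<open>p\<close>.\<close>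

definition rep :: "(d_elem \<times> complex fps) list hs \<Rightarrow> zd option hs \<Rightarrow> bool" where
  "rep z p \<longleftrightarrow> z \<in> F \<and> p \<in> A \<and> z - lt p \<in> U"

lemma rep_lt: "p \<in> A \<Longrightarrow> rep (lt p) p"
  by (simp add: rep_def lt_F hclosed_zero[OF U_hclosed])

lemma rep_add:
  assumes "rep x p" "rep y p'" shows "rep (x + y) (p + p')"
proof -
  have "(x - lt p) + (y - lt p') - (lt (p + p') - (lt p + lt p')) \<in> U"
    using assms unfolding rep_def
    by (elim conjE) (rule hclosed_diff[OF U_hclosed hclosed_add[OF U_hclosed] U_relations(1)]; assumption)
  moreover have "(x - lt p) + (y - lt p') - (lt (p + p') - (lt p + lt p')) = x + y - lt (p + p')" by simp
  ultimately show ?thesis using assms by (simp add: rep_def A free_on_closed)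
qed

lemma rep_scale:
  assumes "rep x p" shows "rep (c \<bullet> x) (c \<bullet> p)"
proof -
  have "c \<bullet> (x - lt p) - (lt (c \<bullet> p) - c \<bullet> lt p) \<in> U"
    using assms unfolding rep_def
    by (elim conjE) (rule hclosed_diff[OF U_hclosed hclosed_scale[OF U_hclosed] U_relations(2)]; assumption)
  moreover have "c \<bullet> (x - lt p) - (lt (c \<bullet> p) - c \<bullet> lt p) = c \<bullet> x - lt (c \<bullet> p)"
    by (simp add: hs.scale_right_diff_distrib)
  ultimately show ?thesis using assms by (simp add: rep_def A free_on_closed)
qed

lemma rep_minus: "rep x p \<Longrightarrow> rep (- x) (- p)"
  using rep_scale[of x p "- 1"] by simp

lemma rep_diff: "rep x p \<Longrightarrow> rep y p' \<Longrightarrow> rep (x - y) (p - p')"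
  using rep_add[OF _ rep_minus] by fastforce

lemma rep_bra:
  assumes "rep x p" "rep y p'" shows "rep (bra x y) (lbr p p')"
proof -
  have xy: "x \<in> F" "y \<in> F" "p \<in> A" "p' \<in> A" "x - lt p \<in> U" "y - lt p' \<in> U" using assms by (auto simp: rep_def)
  have "(x - lt p) * y + lt p * (y - lt p') - (y - lt p') * x - lt p' * (x - lt p)
      + (bra (lt p) (lt p') - lt (lbr p p')) \<in> U"
    by (rule hclosed_add[OF U_hclosed hclosed_diff[OF U_hclosed hclosed_diff[OF U_hclosed hclosed_add[OF U_hclosed
          U_right[OF xy(5,2)] U_left[OF xy(6) lt_F[OF xy(3)]]] U_right[OF xy(6,1)]] U_left[OF xy(5) lt_F[OF xy(4)]]]
          U_relations(3)[OF xy(3,4)]])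
  moreover have "(x - lt p) * y + lt p * (y - lt p') - (y - lt p') * x - lt p' * (x - lt p)
      + (bra (lt p) (lt p') - lt (lbr p p')) = bra x y - lt (lbr p p')"
    by (simp add: algebra_simps del: single_mult_list)
  ultimately have "bra x y - lt (lbr p p') \<in> U" by (simp only:)
  then show ?thesis using xy by (simp add: rep_def A free_on_closed free_on_mult)
qed

lemma rep_0: "rep 0 0"
  using rep_scale[OF rep_lt[OF A(4)], of 0] by simp

lemma rep_sum: "(\<And>a. a \<in> B \<Longrightarrow> rep (f a) (g a)) \<Longrightarrow> rep (sum f B) (sum g B)"
  by (induction B rule: infinite_finite_induct) (auto intro: rep_add rep_0)

lemma lt_0: "lt 0 \<in> U"
  using U_relations(2)[of 0 0] A(4) by simp

lemma rep_zero_iff: "rep x 0 \<Longrightarrow> x \<in> U"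
  using hclosed_add[OF U_hclosed _ lt_0, of "x - lt 0"] by (simp add: rep_def)

end

interpretation U: bar_lie bar_dq UNIV
  by unfold_locales (simp_all add: bar_dq_carrier bar_dq_ops)

interpretation U0: bar_lie bar_dq0 L0
  by unfold_locales (simp_all add: bar_dq0_carrier bar_dq0_ops L0.add L0.smult L0_lbr L0_zero)

lemma F0_sub: "U0.F \<subseteq> U.F"
proof -
  have "lists (carrier bar_dq0) \<subseteq> lists (carrier bar_dq)"
    unfolding bar_dq0_carrier bar_dq_carrier by (intro lists_mono image_mono subset_UNIV)
  then show ?thesis unfolding free_on_def by blast
qed

lemma U0_sub: "U0.U \<subseteq> U.U"
proof (rule Rel_minimal[OF U0.uea_rels_carrier U.U_hclosed])
  fix x assume "coef x \<in> uea_rels bar_dq0"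
  moreover have "uea_rels bar_dq0 \<subseteq> uea_rels bar_dq"
    unfolding U0.uea_rels_eq U.uea_rels_eq by (intro image_mono) auto
  ultimately show "x \<in> U.U" by (intro Rel_relation[OF U.uea_rels_carrier]) auto
qed (use F0_sub in \<open>auto intro: U.U_left U.U_right\<close>)

lemma uea_incl_cls: "uea_incl bar_dq (cls (carrier bar_dq0) (uea_rels bar_dq0) x) = cls (carrier bar_dq) (uea_rels bar_dq) x"
  unfolding uea_incl_def by (rule presented_map_cls[OF U0.uea_rels_carrier U.uea_rels_carrier U0_sub])

lemma uea_incl_hom: "uea_incl bar_dq \<in> alg_hom (uea bar_dq0) (uea bar_dq)"
  unfolding uea_def
  by (rule alg_homI[where T = "\<lambda>x. x", OF U0.uea_rels_carrier U.uea_rels_carrier])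
     (use F0_sub in \<open>auto simp: uea_incl_cls hlin_id_intro\<close>)

text \<open>
  Expands each letter, which may be any element of \<open>bar_dq\<close>, in the basis. The result is a series of
  words in basis elements, to which \<open>pbw\<close> applies.
\<close>

definition coords :: "(d_elem \<times> complex fps) list hs \<Rightarrow> zd option list hs" where
  "coords = hsubst (\<lambda>p. lin1 (inv_into UNIV barof p))"

lemma coords_lt: "coords (lt x) = lin1 x"
proof -
  have "inj barof" by (auto simp: inj_def barof_inject)
  then show ?thesis by (simp add: coords_def)
qed

lemma hlin_coords: "hlin coords"
  by (simp add: coords_def hlin_hsubst)

lemma coords_simps:
  "coords (x + y) = coords x + coords y" "coords (x - y) = coords x - coords y"
  "coords (c \<bullet> x) = c \<bullet> coords x" "coords (x * y) = coords x * coords y" "coords 1 = 1"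
  by (simp_all add: coords_def)

lemma hclosed_all:
  assumes J: "\<And>i. hclosed (J i)"
  shows "hclosed {x. \<forall>i. x \<in> J i}"
  unfolding hclosed_def[of "{x. \<forall>i. x \<in> J i}"] mem_Collect_eq
proof (intro conjI allI impI ballI)
  fix x i assume "\<forall>n. \<exists>y. \<forall>i. x - h ^ n \<bullet> y \<in> J i"
  then show "x \<in> J i" by (intro hclosed_limit[OF J]) blast
qed (use J in \<open>auto intro: hclosed_zero hclosed_add hclosed_scale\<close>)

text \<open>
  Normal forms are well defined on the enveloping algebra: the elements whose two-sided multiples all
  have normal form \<open>0\<close> are a closed ideal that contains the relations.
\<close>

lemma pbw_coords_Rel: "z \<in> U.U \<Longrightarrow> pbw (coords z) = 0"
proof -
  let ?J = "{z. \<forall>uv. pbw (fst uv * coords z * snd uv) = 0}"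
  assume z: "z \<in> U.U"
  have "U.U \<subseteq> ?J"
  proof (rule Rel_minimal[OF U.uea_rels_carrier])
    have "hclosed {z. pbw (fst uv * coords z * snd uv) \<in> {0}}" for uv
      by (rule hclosed_vimage[OF hlin_comp[OF hlin_pbw hlin_mult_intro(1)[OF hlin_mult_intro(2)[OF hlin_coords]]] hclosed_singleton_zero])
    then have "hclosed {z. \<forall>uv. z \<in> {z. pbw (fst uv * coords z * snd uv) \<in> {0}}}" by (rule hclosed_all)
    then show "hclosed ?J" by simp
  next
    fix x assume "coef x \<in> uea_rels bar_dq"
    then have "x \<in> {lt (x + y) - (lt x + lt y) | x y. x \<in> UNIV \<and> y \<in> UNIV} \<union> {lt (c \<bullet> x) - c \<bullet> lt x | c x. x \<in> UNIV} \<union>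
       {bra (lt x) (lt y) - lt (lbr x y) | x y. x \<in> UNIV \<and> y \<in> UNIV}"
      unfolding U.uea_rels_eq by (simp only: image_iff coef_inject) blast
    then consider a b where "x = lt (a + b) - (lt a + lt b)" | c a where "x = lt (c \<bullet> a) - c \<bullet> lt a"
      | a b where "x = bra (lt a) (lt b) - lt (lbr a b)"
      by blast
    then have "coords x = 0 \<or> (\<exists>a b. coords x = bra (lin1 a) (lin1 b) - lin1 (lbr a b))"
    proof cases
      case (3 a b)
      then have "coords x = bra (lin1 a) (lin1 b) - lin1 (lbr a b)"
        by (simp only: coords_simps coords_lt)
      then show ?thesis by blast
    qed (simp_all add: coords_simps coords_lt hlin_add[OF hlin_ext] hlin_scale[OF hlin_ext])
    then consider "coords x = 0" | a b where "coords x = bra (lin1 a) (lin1 b) - lin1 (lbr a b)" by blast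
    then show "x \<in> ?J"
      by cases (simp_all add: hlin_zero[OF hlin_pbw] pbw_bracket)
  next
    fix x u assume x: "x \<in> ?J"
    have "pbw (fst uv * coords (u * x) * snd uv) = 0" for uv
      using x[unfolded mem_Collect_eq, rule_format, of "(fst uv * coords u, snd uv)"] by (simp add: coords_simps mult.assoc)
    then show "u * x \<in> ?J" by blast
    have "pbw (fst uv * coords (x * u) * snd uv) = 0" for uv
      using x[unfolded mem_Collect_eq, rule_format, of "(fst uv, coords u * snd uv)"] by (simp add: coords_simps mult.assoc)
    then show "x * u \<in> ?J" by blast
  qed
  then have "z \<in> ?J" using z by blast
  then have "pbw (fst (1, 1 :: zd option list hs) * coords z * snd (1 :: zd option list hs, 1)) = 0"
    unfolding mem_Collect_eq by (metis fst_conv snd_conv)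
  then show ?thesis by simp
qed

section \<open>The relations of the toroidal algebra\<close>

abbreviation te :: "int \<Rightarrow> tor_gen list hs" where "te i \<equiv> single [Ee i]"
abbreviation tf :: "int \<Rightarrow> tor_gen list hs" where "tf i \<equiv> single [Ff i]"
abbreviation tH :: "int \<Rightarrow> tor_gen list hs" where "tH i \<equiv> single [Hh i]"

definition qp :: "complex fps" where "qp = 1 + q + q powi (-1)"

text \<open>
  Coefficient of \<open>(z - q\<^sup>-\<^sup>1w)(z - q w)(z - w) [x(z), x(w)]\<close>, where \<open>qp\<close> is the coefficient of \<open>z w\<^sup>2\<close> in the cubic.
\<close>

definition cub :: "(int \<Rightarrow> 'b::twisted_monoid hs) \<Rightarrow> int \<Rightarrow> int \<Rightarrow> 'b hs" where
  "cub x i j = bra (x (i + 3)) (x j) - qp \<bullet> bra (x (i + 2)) (x (j + 1))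
     + qp \<bullet> bra (x (i + 1)) (x (j + 2)) - bra (x i) (x (j + 3))"

definition ser :: "(int \<Rightarrow> 'b::ring) \<Rightarrow> (nat \<Rightarrow> int) \<Rightarrow> 'b" where
  "ser x i = (\<Sum>\<sigma> | \<sigma> permutes {1, 2, 3}. bra (x (i (\<sigma> 1))) (bra (x (i (\<sigma> 2) + 1)) (x (i (\<sigma> 3) - 1))))"

lemma mult_z_cw_coef: "mult_z_cw tor_free c (\<lambda>i j. coef (a i j)) = (\<lambda>i j. coef (a (i + 1) j - c \<bullet> a i (j + 1)))"
  and mult_w_cz_coef: "mult_w_cz tor_free c (\<lambda>i j. coef (a i j)) = (\<lambda>i j. coef (a i (j + 1) - c \<bullet> a (i + 1) j))"
  by (simp_all add: mult_z_cw_def mult_w_cz_def free_ops free_minus)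

lemma qinv [simp]: "inverse q * q = 1" "q * inverse q = 1"
  using qpow_mult_neg[of 1] by simp_all

lemma cubic_coef:
  "cubic_zw tor_free (\<lambda>i j. coef (a i j)) i j =
     coef (a (i + 3) j - qp \<bullet> a (i + 2) (j + 1) + qp \<bullet> a (i + 1) (j + 2) - a i (j + 3))"
  "cubic_wz tor_free (\<lambda>i j. coef (a i j)) i j =
     coef (a i (j + 3) - qp \<bullet> a (i + 1) (j + 2) + qp \<bullet> a (i + 2) (j + 1) - a (i + 3) j)"
proof -
  have 3: "k + 3 = k + 1 + 1 + 1" and 2: "k + 2 = k + 1 + 1" for k :: int by simp_all
  show "cubic_zw tor_free (\<lambda>i j. coef (a i j)) i j =
     coef (a (i + 3) j - qp \<bullet> a (i + 2) (j + 1) + qp \<bullet> a (i + 1) (j + 2) - a i (j + 3))"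
    unfolding cubic_zw_def mult_z_cw_coef qp_def 2 3
    by (rule arg_cong[where f = coef]) (simp add: hs.scale_right_diff_distrib hs.scale_left_distrib del: add.assoc)
  show "cubic_wz tor_free (\<lambda>i j. coef (a i j)) i j =
     coef (a i (j + 3) - qp \<bullet> a (i + 1) (j + 2) + qp \<bullet> a (i + 2) (j + 1) - a (i + 3) j)"
    unfolding cubic_wz_def mult_w_cz_coef qp_def 2 3
    by (rule arg_cong[where f = coef]) (simp add: hs.scale_right_diff_distrib hs.scale_left_distrib del: add.assoc)
qed

lemma finsum_coef: "finite B \<Longrightarrow> (\<Oplus>\<^bsub>tor_free\<^esub>a\<in>B. coef (f a)) = coef (sum f B)"
proof (induction B rule: finite_induct)
  case empty
  interpret ring tor_free by (rule ring_free)
  show ?case by (simp add: free_ops)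
next
  case (insert a B)
  interpret ring tor_free by (rule ring_free)
  show ?case using insert by (subst finsum_insert) (auto simp: carrier_free free_ops simp del: coef_sum coef_simps)
qed

lemma commutator_coef: "commutator tor_free (coef x) (coef y) = coef (bra x y)"
  by (simp add: commutator_def free_ops free_minus)

lemma serre_coef: "serre tor_free (\<lambda>i. coef (x i)) i = coef (ser x i)"
  by (simp add: serre_def ser_def commutator_coef finsum_coef finite_permutations)

text \<open>
  The relations, with both sides of the cubic relations combined to commutators.
\<close>

definition trels :: "tor_gen list hs set" where
  "trels = {bra (tH i) (tH j) | i j. True} \<union> {bra (te i) (tf j) - tH (i + j) | i j. True} \<union>
     {cub te i j | i j. True} \<union> {- cub tf i j | i j. True} \<union>
     {bra (tH i) (te j) - (- ((1 - q powi i) * (1 - q powi (-i)))) \<bullet> te (i + j) | i j. True} \<union>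
     {bra (tH i) (tf j) - ((1 - q powi i) * (1 - q powi (-i))) \<bullet> tf (i + j) | i j. True} \<union>
     {ser te i | i. True} \<union> {ser tf i | i. True}"

lemma tor_rels_eq: "tor_rels = coef ` trels"
proof -
  have 1: "cubic_zw tor_free (\<lambda>i j. coef (te i) \<otimes>\<^bsub>tor_free\<^esub> coef (te j)) i j \<oplus>\<^bsub>tor_free\<^esub>
       cubic_wz tor_free (\<lambda>i j. coef (te j) \<otimes>\<^bsub>tor_free\<^esub> coef (te i)) i j = coef (cub te i j)" for i j
    unfolding free_ops cubic_coef cub_def
    by (rule arg_cong[where f = coef]) (simp add: hs.scale_right_diff_distrib del: single_mult_list)
  have 2: "cubic_wz tor_free (\<lambda>i j. coef (tf i) \<otimes>\<^bsub>tor_free\<^esub> coef (tf j)) i j \<oplus>\<^bsub>tor_free\<^esub>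
       cubic_zw tor_free (\<lambda>i j. coef (tf j) \<otimes>\<^bsub>tor_free\<^esub> coef (tf i)) i j = coef (- cub tf i j)" for i j
    unfolding free_ops cubic_coef cub_def
    by (rule arg_cong[where f = coef]) (simp add: hs.scale_right_diff_distrib del: single_mult_list)
  have UN: "coef ` {f i j | i j. True} = {coef (f i j) | i j. True}" "coef ` {g i | i. True} = {coef (g i) | i. True}"
    for f :: "int \<Rightarrow> int \<Rightarrow> tor_gen list hs" and g :: "(nat \<Rightarrow> int) \<Rightarrow> tor_gen list hs"
    by auto
  show ?thesis
    unfolding tor_rels_def trels_def Let_def letter_coef image_Un UN 1 2 serre_coef commutator_coef
    by (simp add: free_ops free_minus del: single_mult_list)
qed

lemma tor_rels_carrier: "tor_rels \<subseteq> carrier (free_halg UNIV)"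
  by (auto simp: tor_rels_eq carrier_free)

lemma sum_permutes_3:
  "(\<Sum>\<sigma> | \<sigma> permutes {1, 2, 3::nat}. g (\<sigma> 1) (\<sigma> 2) (\<sigma> 3)) =
     g 1 2 3 + g 1 3 2 + g 2 1 3 + g 2 3 1 + g 3 1 2 + (g 3 2 1 :: 'a::ab_group_add)"
proof -
  have f123: "finite {2, 3::nat}" "1 \<notin> {2, 3::nat}" by auto
  have f23: "finite {3::nat}" "2 \<notin> {3::nat}" by auto
  show ?thesis
    unfolding sum_over_permutations_insert[OF f123]
    unfolding sum_over_permutations_insert[OF f23]
    unfolding permutes_sing
    by (simp add: transpose_def)
qed

section \<open>The homomorphism on generators\<close>

fun tg :: "tor_gen \<Rightarrow> zd option hs" where
  "tg (Ee i) = single (Some (Mon i 1))"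
| "tg (Ff i) = (- (q powi (- i))) \<bullet> single (Some (Mon i (- 1)))"
| "tg (Hh i) = (- (1 - q powi (- i))) \<bullet> single (Some (Mon i 0)) + (- (q powi (- i))) \<bullet> single None"

lemma tg_L0: "tg g \<in> L0"
proof (cases g)
  case (Ee i)
  then show ?thesis using L0_dvd[of 1 1 i] by (simp add: wt.simps)
next
  case (Ff i)
  show ?thesis unfolding Ff tg.simps by (rule L0_dvd) (simp_all add: wt.simps)
next
  case (Hh i)
  have "(- (1 - q powi (- i))) \<bullet> single (Some (Mon i 0)) \<in> L0"
  proof (cases "i = 0")
    case False
    have "h dvd q powi (- i) - q powi 0" unfolding h_qdiff[symmetric] by simp
    then show ?thesis using False by (intro L0_dvd) (simp_all add: wt.simps)
  qed (simp add: L0_zero)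
  then show ?thesis unfolding Hh tg.simps by (intro L0.add L0_central)
qed

definition Th :: "tor_gen list hs \<Rightarrow> (d_elem \<times> complex fps) list hs" where
  "Th = hsubst (\<lambda>g. lt (tg g))"

lemma Th_simps:
  "Th (x + y) = Th x + Th y" "Th (x - y) = Th x - Th y" "Th (c \<bullet> x) = c \<bullet> Th x" "Th (x * y) = Th x * Th y"
  "Th 1 = 1" "Th (- x) = - Th x" "Th (sum f B) = (\<Sum>a\<in>B. Th (f a))"
  by (simp_all add: Th_def)

lemma Th_gen: "Th (single [g]) = lt (tg g)"
  by (simp add: Th_def)

lemma hlin_Th: "hlin Th"
  by (simp add: Th_def hlin_hsubst)

lemma Th_F: "Th x \<in> U0.F"
  unfolding Th_def by (rule hsubst_free_on[of UNIV]) (auto simp: U0.lt_F tg_L0 simp del: single_mult_list)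

lemma lbr_e:
  assumes "a + b = s"
  shows "lbr (c \<bullet> single (Some (Mon a i))) (d \<bullet> single (Some (Mon b j))) =
    (c * d * (q powi (i * b) - q powi (j * a))) \<bullet> single (Some (Mon s (i + j)))
    + (c * d * bcoc a i b j) \<bullet> single None"
  using assms by (simp add: lbr_simps lbr_single hs.scale_right_distrib mult_ac)

lemma lbr_ee: "a + b = s \<Longrightarrow> i + j \<noteq> 0 \<Longrightarrow>
  lbr (c \<bullet> single (Some (Mon a i))) (d \<bullet> single (Some (Mon b j))) =
    (c * d * (q powi (i * b) - q powi (j * a))) \<bullet> single (Some (Mon s (i + j)))"
  by (simp add: lbr_e bcoc_eq_0)

text \<open>
  The numbers \<open>q\<^sup>j - q\<^sup>i\<close> satisfy the recursion whose characteristic polynomial has the roots \<open>1\<close>, \<open>q\<close>, \<open>q\<^sup>-\<^sup>1\<close>.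
\<close>

lemma cub_identity:
  fixes E :: "int \<Rightarrow> 'a::comm_ring_1"
  assumes E: "\<And>m n. E m * E n = E (m + n)"
  shows "(E j - E (i + 3)) - (1 + E 1 + E (-1)) * (E (j + 1) - E (i + 2))
      + (1 + E 1 + E (-1)) * (E (j + 2) - E (i + 1)) - (E (j + 3) - E i) = 0"
  by (simp add: algebra_simps E)

lemma ser_identity:
  fixes E :: "int \<Rightarrow> 'a::comm_ring_1"
  assumes E: "\<And>m n. E m * E n = E (m + n)"
  defines "g \<equiv> \<lambda>a b c. (E (c - 1) - E (b + 1)) * (E (b + c) - E (2 * a))"
  shows "g x y z + g x z y + g y x z + g y z x + g z x y + g z y x = 0"
  by (simp add: g_def algebra_simps E)

lemma rep_gen: "U0.rep (Th (single [g])) (tg g)"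
  unfolding Th_gen by (rule U0.rep_lt) (rule tg_L0)

lemma Th_cub: "U0.rep (Th (cub (\<lambda>i. single [g i]) i j)) (lbr (tg (g (i + 3))) (tg (g j))
   - qp \<bullet> lbr (tg (g (i + 2))) (tg (g (j + 1))) + qp \<bullet> lbr (tg (g (i + 1))) (tg (g (j + 2))) - lbr (tg (g i)) (tg (g (j + 3))))"
  unfolding cub_def Th_simps(1-4)
  by (rule U0.rep_diff[OF U0.rep_add[OF U0.rep_diff[OF U0.rep_bra U0.rep_scale[OF U0.rep_bra]]
        U0.rep_scale[OF U0.rep_bra]] U0.rep_bra]; rule rep_gen)

lemma Th_ser: "U0.rep (Th (ser (\<lambda>i. single [g i]) i))
   (\<Sum>\<sigma> | \<sigma> permutes {1, 2, 3}. lbr (tg (g (i (\<sigma> 1)))) (lbr (tg (g (i (\<sigma> 2) + 1))) (tg (g (i (\<sigma> 3) - 1)))))"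
  unfolding ser_def Th_simps(7) Th_simps(1-4)
  by (rule U0.rep_sum[OF U0.rep_bra[OF rep_gen U0.rep_bra[OF rep_gen rep_gen]]])

lemma scale_cub_combine: "a \<bullet> s - c \<bullet> (b \<bullet> s) + c \<bullet> (d \<bullet> s) - e \<bullet> s = (a - c * b + c * d - e) \<bullet> s"
  by (simp add: hs.scale_left_diff_distrib hs.scale_left_distrib)

lemma qpow_char: "q powi (e * m) * q powi (e * n) = q powi (e * (m + n))"
  by (simp only: qpow_add[symmetric] distrib_left)

text \<open>
  The positive half is the case \<open>\<epsilon> = 1\<close> and the negative half the case \<open>\<epsilon> = - 1\<close>. The scalars \<open>c\<close> account
  for \<open>- D\<^sup>-\<^sup>1 Z\<^sup>a = - q\<^sup>-\<^sup>a Z\<^sup>a D\<^sup>-\<^sup>1\<close>; their products depend on the total degree only.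
\<close>

context
  fixes x :: "int \<Rightarrow> zd option hs" and c \<gamma> \<delta> :: "int \<Rightarrow> complex fps" and \<epsilon> :: int
  assumes x: "\<And>a. x a = c a \<bullet> single (Some (Mon a \<epsilon>))" and \<epsilon>: "\<epsilon> = 1 \<or> \<epsilon> = - 1"
    and c\<gamma>: "\<And>a b. c a * c b = \<gamma> (a + b)" and c\<delta>: "\<And>a b. c a * \<gamma> b = \<delta> (a + b)"
begin

lemma lbr_degree_1:
  assumes "a + b = s"
  shows "lbr (x a) (x b) = (q powi (\<epsilon> * b) - q powi (\<epsilon> * a)) \<bullet> \<gamma> s \<bullet> single (Some (Mon s (2 * \<epsilon>)))"
proof -
  have "\<epsilon> + \<epsilon> \<noteq> 0" using \<epsilon> by auto
  then show ?thesis
    unfolding x by (subst lbr_ee[OF assms]) (simp_all add: c\<gamma> assms mult.commute)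
qed

lemma lbr_lbr_degree_1:
  assumes "a + (b + d) = s"
  shows "lbr (x a) (lbr (x b) (x d)) =
    ((q powi (\<epsilon> * d) - q powi (\<epsilon> * b)) * (q powi (\<epsilon> * (b + d)) - q powi (\<epsilon> * (2 * a)))) \<bullet> \<delta> s \<bullet> single (Some (Mon s (3 * \<epsilon>)))"
proof -
  have nz: "\<epsilon> + 2 * \<epsilon> \<noteq> 0" using \<epsilon> by auto
  have c3s: "c a * \<gamma> (b + d) = \<delta> s" using c\<delta>[of a "b + d"] assms by simp
  show ?thesis
    unfolding lbr_degree_1[OF refl] unfolding x hs.scale_scale
    by (subst lbr_ee[OF assms nz]) (simp add: c3s[symmetric] mult_ac)
qed

lemma cubic_degree_1: "lbr (x (i + 3)) (x j) - qp \<bullet> lbr (x (i + 2)) (x (j + 1))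
    + qp \<bullet> lbr (x (i + 1)) (x (j + 2)) - lbr (x i) (x (j + 3)) = 0"
proof -
  let ?s = "i + j + 3"
  have s: "i + 3 + j = ?s" "i + 2 + (j + 1) = ?s" "i + 1 + (j + 2) = ?s" "i + (j + 3) = ?s" by simp_all
  have qp: "qp = 1 + q powi (\<epsilon> * 1) + q powi (\<epsilon> * (- 1))" using \<epsilon> by (auto simp: qp_def)
  show ?thesis
    unfolding lbr_degree_1[OF s(1)] lbr_degree_1[OF s(2)] lbr_degree_1[OF s(3)] lbr_degree_1[OF s(4)]
    by (simp only: scale_cub_combine qp cub_identity[of "\<lambda>n. q powi (\<epsilon> * n)", OF qpow_char] hs.scale_zero_left)
qed

lemma serre_degree_1: "(\<Sum>\<sigma> | \<sigma> permutes {1, 2, 3::nat}. lbr (x (i (\<sigma> 1))) (lbr (x (i (\<sigma> 2) + 1)) (x (i (\<sigma> 3) - 1)))) = 0"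
proof -
  let ?s = "i 1 + i 2 + i 3"
  have 1: "lbr (x a) (lbr (x (b + 1)) (x (d - 1))) =
      ((q powi (\<epsilon> * (d - 1)) - q powi (\<epsilon> * (b + 1))) * (q powi (\<epsilon> * (b + d)) - q powi (\<epsilon> * (2 * a)))) \<bullet> \<delta> ?s \<bullet> single (Some (Mon ?s (3 * \<epsilon>)))"
    if "a + b + d = ?s" for a b d
    using lbr_lbr_degree_1[of a "b + 1" "d - 1" ?s] that by (simp add: add.assoc)
  have eqs: "i 1 + i 3 + i 2 = ?s" "i 2 + i 1 + i 3 = ?s" "i 2 + i 3 + i 1 = ?s" "i 3 + i 1 + i 2 = ?s" "i 3 + i 2 + i 1 = ?s"
    by simp_all
  show ?thesis
    unfolding sum_permutes_3[of "\<lambda>k l m. lbr (x (i k)) (lbr (x (i l + 1)) (x (i m - 1)))"]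
      1[OF refl] 1[OF eqs(1)] 1[OF eqs(2)] 1[OF eqs(3)] 1[OF eqs(4)] 1[OF eqs(5)] hs.scale_left_distrib[symmetric]
      ser_identity[of "\<lambda>n. q powi (\<epsilon> * n)", OF qpow_char] by (rule hs.scale_zero_left)
qed

end

lemma qneg_char: "q powi (- m) * q powi (- n) = q powi (- (m + n))"
  by (simp only: qpow_add[symmetric] minus_add_distrib)

text \<open>
  Both sides of a relation represent elements of the Lie algebra (\<open>rep\<close>), so only an identity in the
  Lie algebra has to be checked.
\<close>

lemma Th_trels: "x \<in> trels \<Longrightarrow> Th x \<in> U0.U"
proof -
  assume x: "x \<in> trels"
  have lbr_H: "lbr (tg (Hh i)) (c \<bullet> single (Some (Mon j k))) =
      (- (1 - q powi (- i)) * c * (1 - q powi (k * i))) \<bullet> single (Some (Mon (i + j) k)) 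
      + (- (1 - q powi (- i)) * c * bcoc i 0 j k) \<bullet> single None" for i j k c
    by (simp add: lbr_simps lbr_single hs.scale_right_distrib mult_ac)
  have HH: "lbr (tg (Hh i)) (tg (Hh j)) = 0" for i j
    by (simp add: lbr_simps lbr_single bcoc_def cocycle_val_def)
  have EF: "lbr (tg (Ee i)) (tg (Ff j)) - tg (Hh (i + j)) = 0" for i j
  proof -
    have "bcoc i 1 j (- 1) = q powi (- i)" by (simp add: bcoc_def cocycle_val_def)
    moreover have m: "q powi (- j) * q powi j = 1" "q powi (- j) * q powi (- i) = q powi (- (i + j))"
      by (simp_all only: qneg_char qpow_mult_neg add.commute)
    ultimately have "lbr (tg (Ee i)) (tg (Ff j)) =
       (- (q powi (- j)) * (q powi j - q powi (- i))) \<bullet> single (Some (Mon (i + j) 0))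
       + (- (q powi (- j)) * q powi (- i)) \<bullet> single None"
      unfolding tg.simps using lbr_e[of i j "i + j" 1 1 "- (q powi (- j))" "- 1"] by simp
    also have "- (q powi (- j)) * (q powi j - q powi (- i)) = - (1 - q powi (- (i + j)))"
      unfolding right_diff_distrib mult_minus_left m by simp
    also have "- (q powi (- j)) * q powi (- i) = - (q powi (- (i + j)))"
      unfolding mult_minus_left m by simp
    finally show ?thesis by simp
  qed
  have HE: "lbr (tg (Hh i)) (tg (Ee j)) - (- ((1 - q powi i) * (1 - q powi (- i)))) \<bullet> tg (Ee (i + j)) = 0" for i j
  proof -
    have "lbr (tg (Hh i)) (tg (Ee j)) = (- (1 - q powi (- i)) * 1 * (1 - q powi (1 * i))) \<bullet> tg (Ee (i + j))"
      using lbr_H[of i 1 j 1] by (simp add: bcoc_eq_0)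
    also have "- (1 - q powi (- i)) * 1 * (1 - q powi (1 * i)) = - ((1 - q powi i) * (1 - q powi (- i)))"
      by (simp only: mult_1_left mult_1_right mult_minus_left mult.commute[of "1 - q powi i"])
    finally show ?thesis by simp
  qed
  have HF: "lbr (tg (Hh i)) (tg (Ff j)) - ((1 - q powi i) * (1 - q powi (- i))) \<bullet> tg (Ff (i + j)) = 0" for i j
  proof -
    have m: "q powi (- j) = q powi i * q powi (- (i + j))" by (simp add: qpow_add[symmetric])
    have "lbr (tg (Hh i)) (tg (Ff j)) =
       (- (1 - q powi (- i)) * (- (q powi (- j))) * (1 - q powi (- i))) \<bullet> single (Some (Mon (i + j) (- 1)))"
      using lbr_H[of i "- (q powi (- j))" j "- 1"] by (simp add: bcoc_eq_0)
    also have "- (1 - q powi (- i)) * (- (q powi (- j))) * (1 - q powi (- i))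
       = ((1 - q powi i) * (1 - q powi (- i))) * (- (q powi (- (i + j))))"
    proof -
      have id: "- (1 - y) * (- (x * z)) * (1 - y) = ((1 - x) * (1 - y)) * (- z)" if "x * y = 1" for x y z :: "complex fps"
      proof -
        have "(1 - y) * x = x - 1" by (simp only: left_diff_distrib mult_1_left mult.commute[of y x] that)
        moreover have "- (1 - y) * (- (x * z)) * (1 - y) = ((1 - y) * x) * ((1 - y) * z)"
          by (simp only: mult_minus_left mult_minus_right minus_minus mult_ac)
        moreover have "(x - 1) * ((1 - y) * z) = ((1 - x) * (1 - y)) * (- z)"
          by (simp add: algebra_simps)
        ultimately show ?thesis by (simp only:)
      qed
      show ?thesis unfolding m by (rule id) (rule qpow_mult_neg)
    qed
    finally show ?thesis by simp
  qed
  have rep0: "Th z \<in> U0.U" if "U0.rep (Th z) p" "p = 0" for z p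
    using that U0.rep_zero_iff by simp
  consider i j where "x = bra (tH i) (tH j)" | i j where "x = bra (te i) (tf j) - tH (i + j)"
    | i j where "x = cub te i j" | i j where "x = - cub tf i j"
    | i j where "x = bra (tH i) (te j) - (- ((1 - q powi i) * (1 - q powi (-i)))) \<bullet> te (i + j)"
    | i j where "x = bra (tH i) (tf j) - ((1 - q powi i) * (1 - q powi (-i))) \<bullet> tf (i + j)"
    | i where "x = ser te i" | i where "x = ser tf i"
    using x unfolding trels_def Un_iff mem_Collect_eq by blast
  then show ?thesis
  proof cases
    case (1 i j)
    show ?thesis unfolding 1
      by (rule rep0[OF _ HH]) (unfold Th_simps(1-4), rule U0.rep_bra[OF rep_gen rep_gen])
  next
    case (2 i j)
    show ?thesis unfolding 2
      by (rule rep0[OF _ EF]) (unfold Th_simps(1-4), rule U0.rep_diff[OF U0.rep_bra[OF rep_gen rep_gen] rep_gen])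
  next
    case (3 i j)
    show ?thesis unfolding 3 by (rule rep0[OF Th_cub cubic_degree_1[where c = "\<lambda>_. 1" and \<gamma> = "\<lambda>_. 1" and \<delta> = "\<lambda>_. 1" and \<epsilon> = 1]]) simp_all
  next
    case (4 i j)
    have "Th (cub tf i j) \<in> U0.U" 
      by (rule rep0[OF Th_cub cubic_degree_1[where c = "\<lambda>a. - (q powi (- a))"
          and \<gamma> = "\<lambda>a. q powi (- a)" and \<delta> = "\<lambda>a. - (q powi (- a))" and \<epsilon> = "- 1"]])
        (simp_all only: tg.simps mult_minus_left mult_minus_right minus_minus qneg_char simp_thms)
    then show ?thesis unfolding 4 Th_simps(6) by (rule hclosed_minus[OF U0.U_hclosed])
  next
    case (5 i j)
    show ?thesis unfolding 5
      by (rule rep0[OF _ HE]) (unfold Th_simps(1-4), rule U0.rep_diff[OF U0.rep_bra[OF rep_gen rep_gen] U0.rep_scale[OF rep_gen]])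
  next
    case (6 i j)
    show ?thesis unfolding 6
      by (rule rep0[OF _ HF]) (unfold Th_simps(1-4), rule U0.rep_diff[OF U0.rep_bra[OF rep_gen rep_gen] U0.rep_scale[OF rep_gen]])
  next
    case (7 i)
    show ?thesis unfolding 7 by (rule rep0[OF Th_ser serre_degree_1[where c = "\<lambda>_. 1" and \<gamma> = "\<lambda>_. 1" and \<delta> = "\<lambda>_. 1" and \<epsilon> = 1]]) simp_all
  next
    case (8 i)
    show ?thesis unfolding 8 
      by (rule rep0[OF Th_ser serre_degree_1[where c = "\<lambda>a. - (q powi (- a))"
          and \<gamma> = "\<lambda>a. q powi (- a)" and \<delta> = "\<lambda>a. - (q powi (- a))" and \<epsilon> = "- 1"]])
        (simp_all only: tg.simps mult_minus_left mult_minus_right minus_minus qneg_char simp_thms)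
  qed
qed

abbreviation TR :: "tor_gen list hs set" where "TR \<equiv> Rel UNIV tor_rels"

lemma Th_TR: "x \<in> TR \<Longrightarrow> Th x \<in> U0.U"
  unfolding Th_def
proof (rule hsubst_Rel[OF tor_rels_carrier U0.uea_rels_carrier])
  show "lt (tg g) \<in> U0.F" for g by (rule U0.lt_F) (rule tg_L0)
  show "hsubst (\<lambda>g. lt (tg g)) x \<in> U0.U" if "coef x \<in> tor_rels" for x
    using that Th_trels unfolding tor_rels_eq Th_def by (auto simp: coef_inject)
qed

section \<open>The classical limit of the positive half\<close>

lemma int_affine:
  fixes d :: "int \<Rightarrow> complex"
  assumes "\<And>a. d (a + 1) - d a = g"
  shows "d a = d 0 + of_int a * g"
proof (induction a rule: int_induct[where k = 0])
  case (step1 i)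
  then show ?case using assms[of i] by (simp add: algebra_simps)
next
  case (step2 i)
  then show ?case using assms[of "i - 1"] by (simp add: algebra_simps)
qed simp

text \<open>
  Degree 2. The recursion says that the third differences vanish, so \<open>u\<close> is a quadratic polynomial; of
  those, the antisymmetric ones are the multiples of \<open>s - 2 a\<close>.
\<close>

lemma affine_antisymmetric:
  fixes u :: "int \<Rightarrow> complex"
  assumes rec: "\<And>a. u (a + 3) - 3 * u (a + 2) + 3 * u (a + 1) - u a = 0" and anti: "\<And>a. u (s - a) = - u a"
  obtains w where "\<And>a. u a = of_int (s - 2 * a) * w"
proof -
  define d where "d a = u (a + 1) - u a" for a
  define d2 where "d2 a = d (a + 1) - d a" for a
  have "d2 (a + 1) - d2 a = 0" for a
    using rec[of a] by (simp add: d2_def d_def algebra_simps)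
  then have d2: "d (a + 1) - d a = d2 0" for a
    using int_affine[of d2 0 a] by (simp add: d2_def)
  have d: "d a = d 0 + of_int a * d2 0" for a
    by (rule int_affine) (rule d2)
  define v where "v a = u a - of_int (a * (a - 1)) / 2 * d2 0" for a
  have "v (a + 1) - v a = d 0" for a
  proof -
    have "of_int ((a + 1) * (a + 1 - 1)) / 2 * d2 0 - of_int (a * (a - 1)) / 2 * d2 0 = of_int a * d2 0"
      by (simp add: field_simps)
    moreover have "(x - y) - (x' - y') = (x - x') - (y - y')" for x y x' y' :: complex by simp
    ultimately have "v (a + 1) - v a = d a - of_int a * d2 0" unfolding v_def d_def by (simp only:)
    then show ?thesis using d[of a] by simp
  qed
  then have v: "v a = v 0 + of_int a * d 0" for a by (rule int_affine)
  have u: "u a = u 0 + of_int a * d 0 + of_int (a * (a - 1)) / 2 * d2 0" for a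
  proof -
    have "u a = v a + of_int (a * (a - 1)) / 2 * d2 0" "v 0 = u 0" by (simp_all add: v_def)
    then show ?thesis using v[of a] by (simp only:)
  qed
  have a0: "u s + u 0 = 0" and a1: "u (s - 1) + u 1 = 0" and a2: "u (s - 2) + u 2 = 0"
    using anti[of 0] anti[of 1] anti[of 2] by simp_all
  have "d2 0 = 0"
    using a0 a1 a2 u[of s] u[of "s - 1"] u[of "s - 2"] u[of 1] u[of 2] by (auto simp: field_simps)
  then have lin: "u a = u 0 + of_int a * d 0" for a using u[of a] by simp
  have "u 0 + of_int s * d 0 + u 0 = 0" using a0 lin[of s] by (simp only:)
  then have "2 * u 0 = - (of_int s * d 0)" by (simp add: eq_neg_iff_add_eq_0 algebra_simps)
  then have u0: "u 0 = (- (of_int s * d 0)) / 2" by (simp only: eq_divide_eq mult.commute) simp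
  have "u a = of_int (s - 2 * a) * (- d 0 / 2)" for a
    unfolding lin[of a] u0 by (simp add: field_simps)
  then show thesis by (rule that)
qed

text \<open>
  Degree 3. Exchanging \<open>G (a + 1) + G b\<close> for \<open>G a + G (b + 1)\<close> shows that \<open>G\<close> has constant differences.
\<close>

lemma affine_sum_zero:
  fixes G :: "int \<Rightarrow> complex"
  assumes G: "\<And>a b. G a + G b + G (s - a - b) = 0"
  obtains w where "\<And>a. G a = of_int (s - 3 * a) * w"
proof -
  have "G (a + 1) - G a = G 1 - G 0" for a
  proof -
    have "s - (a + 1) - 0 = s - a - 1" by simp
    then have "G (a + 1) + G 0 + G (s - a - 1) = G a + G 1 + G (s - a - 1)"
      using G[of "a + 1" 0] G[of a 1] by (simp only:)
    then show ?thesis by (simp add: algebra_simps)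
  qed
  then have a: "G a = G 0 + of_int a * (G 1 - G 0)" for a by (rule int_affine)
  have "3 * G 0 + of_int s * (G 1 - G 0) = 0"
    using G[of 0 0] a[of s] by (simp add: algebra_simps)
  then have "G 0 = - of_int s * (G 1 - G 0) / 3" by (simp add: field_simps)
  then show thesis
    by (intro that[of "- (G 1 - G 0) / 3"], subst a) (simp add: field_simps)
qed

text \<open>
  The functional equation that the Jacobi identity imposes in degree \<open>N \<ge> 4\<close>. The affine function
  \<open>P a = s - N a\<close> is a solution, and any other solution can be normalised to vanish at \<open>m\<close>; its values
  at \<open>m \<plusminus> 1\<close> and \<open>m \<plusminus> 2\<close> then satisfy four linear equations, from which the multiple of the value at
  \<open>m + 1\<close> by \<open>p (p\<^sup>2 - 2 (N - 2) (N - 3))\<close>, where \<open>p = P m\<close>, vanishes. As \<open>p\<close> is large for \<open>m\<close> far to the left,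
  this determines the solution on a half-line, and by the equation itself everywhere.
\<close>

lemma four_equations:
  fixes x y u v p M :: complex
  assumes "(p - M) * y = (p + M) * x" "(p - 2) * u = - 4 * x" "(p + 2) * v = 4 * y"
    "(p - 2 * M) * v = (p + 2 * M) * u"
  shows "p * (p * p - 2 * M * (M - 1)) * x = 0"
proof -
  have "(p + 2) * (p - 2) * (p - M) * ((p - 2 * M) * v) = (p + 2) * (p - 2) * (p - M) * ((p + 2 * M) * u)"
    using assms(4) by simp
  then have "(p - 2) * (p - M) * (p - 2 * M) * ((p + 2) * v) = (p + 2) * (p - M) * (p + 2 * M) * ((p - 2) * u)"
    by (simp only: mult_ac)
  then have "4 * (p - 2) * (p - 2 * M) * ((p - M) * y) = - 4 * (p + 2) * (p - M) * (p + 2 * M) * x"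
    unfolding assms(2,3) by (simp only: mult_ac)
  then have "8 * (p * (p * p - 2 * M * (M - 1)) * x) = 0"
    unfolding assms(1) by (simp add: algebra_simps)
  then show ?thesis by simp
qed

lemma affine_jacobi:
  fixes f K :: "int \<Rightarrow> complex" and s N :: int
  assumes N: "N \<ge> 4"
  defines "P \<equiv> \<lambda>a. s - N * a"
  assumes H1: "\<And>a b. of_int (P b + (b - a)) * f a - of_int (P a + (a - b)) * f b = of_int (b - a) * K (a + b)"
    and H2: "\<And>m. P m \<noteq> 0 \<Longrightarrow> K (2 * m) = 2 * f m"
  obtains w where "\<And>a. f a = of_int (P a) * w"
proof -
  have adjacent: "of_int (P m) * f (m + 1) = of_int (P (m + 1)) * f m" if m: "P m > 2 * N" for m
  proof -
    define g where "g t = of_int (P m) * f (m + t) - of_int (P (m + t)) * f m" for t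
    have Pt: "P (m + t) = P m - N * t" for t by (simp add: P_def algebra_simps)
    have rel: "of_int (P (m + t) + (t - r)) * g r - of_int (P (m + r) + (r - t)) * g t = of_int (t - r) * (2 * g k)"
      if k: "r + t = 2 * k" and Pk: "P (m + k) \<noteq> 0" for r t k
    proof -
      have K: "K ((m + r) + (m + t)) = 2 * f (m + k)"
        using H2[OF Pk] k by (simp add: algebra_simps)
      have H: "of_int (P (m + t) + (t - r)) * f (m + r) - of_int (P (m + r) + (r - t)) * f (m + t) = of_int (t - r) * (2 * f (m + k))"
        using H1[of "m + t" "m + r"] unfolding K by simp
      have t: "t = 2 * k - r" using k by simp
      have Q: "of_int (P (m + t) + (t - r)) * of_int (P (m + r)) - of_int (P (m + r) + (r - t)) * of_int (P (m + t))
          = of_int (t - r) * (2 * of_int (P (m + k)) :: complex)"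
        unfolding Pt t by (simp add: algebra_simps)
      have "of_int (P (m + t) + (t - r)) * g r - of_int (P (m + r) + (r - t)) * g t
        = of_int (P m) * (of_int (P (m + t) + (t - r)) * f (m + r) - of_int (P (m + r) + (r - t)) * f (m + t))
        - f m * (of_int (P (m + t) + (t - r)) * of_int (P (m + r)) - of_int (P (m + r) + (r - t)) * of_int (P (m + t)))"
        by (simp add: g_def algebra_simps)
      also have "\<dots> = of_int (t - r) * (2 * g k)"
        unfolding H Q by (simp add: g_def algebra_simps)
      finally show ?thesis .
    qed
    have g0: "g 0 = 0" by (simp add: g_def)
    have nz: "P (m + k) \<noteq> 0" if "\<bar>k\<bar> \<le> 1" for k
    proof -
      have "N * k \<le> N * 1" using that N by (intro mult_left_mono) auto
      then show ?thesis using m N unfolding Pt by linarith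
    qed
    define p where "p = (of_int (P m) :: complex)"
    define M where "M = (of_int (N - 2) :: complex)"
    note rel' = rel[unfolded Pt] and nz' = nz[unfolded Pt]
    have e1: "(p - M) * g (- 1) = (p + M) * g 1"
      using rel'[of "- 1" 1 0] nz'[of 0] g0 by (simp add: p_def M_def algebra_simps)
    have e2: "(p - 2) * g 2 = - 4 * g 1"
      using rel'[of 0 2 1] nz'[of 1] g0 by (simp add: p_def algebra_simps)
    have e3: "(p + 2) * g (- 2) = 4 * g (- 1)"
      using rel'[of "- 2" 0 "- 1"] nz'[of "- 1"] g0 by (simp add: p_def algebra_simps)
    have e4: "(p - 2 * M) * g (- 2) = (p + 2 * M) * g 2"
      using rel'[of "- 2" 2 0] nz'[of 0] g0 by (simp add: p_def M_def algebra_simps)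
    have "P m * P m \<ge> (2 * N) * (2 * N)" using m N by (intro mult_mono) auto
    moreover have "2 * (N - 2) * (N - 2 - 1) < (2 * N) * (2 * N)"
    proof -
      have "(N - 2) * (N - 2 - 1) \<le> N * N" using N by (intro mult_mono) auto
      moreover have "N * N > 0" using N by simp
      ultimately have "2 * ((N - 2) * (N - 2 - 1)) < 4 * (N * N)" by linarith
      then show ?thesis by (simp only: mult.assoc)
    qed
    ultimately have "P m * P m - 2 * (N - 2) * (N - 2 - 1) \<noteq> 0" "P m \<noteq> 0" using m N by auto
    then have "(of_int (P m * (P m * P m - 2 * (N - 2) * (N - 2 - 1))) :: complex) \<noteq> 0"
      unfolding of_int_eq_0_iff by simp
    then have "p * (p * p - 2 * M * (M - 1)) \<noteq> 0" by (simp add: p_def M_def)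
    then have "g 1 = 0" using four_equations[OF e1 e2 e3 e4] by simp
    then show ?thesis by (simp add: g_def)
  qed
  define m0 where "m0 = - \<bar>s\<bar> - 3"
  have far: "P m > 2 * N" if "m \<le> m0" for m
  proof -
    have "N * m \<le> N * m0" using that N by simp
    moreover have "N * m0 = - (N * \<bar>s\<bar>) - 3 * N" by (simp add: m0_def algebra_simps)
    moreover have "N * \<bar>s\<bar> \<ge> 1 * \<bar>s\<bar>" using N by (intro mult_right_mono) auto
    ultimately show ?thesis unfolding P_def using N by linarith
  qed
  define w where "w = f m0 / of_int (P m0)"
  have half: "f m = of_int (P m) * w" if "m \<le> m0" for m
    using that
  proof (induction m rule: int_le_induct)
    case base
    then show ?case using far[of m0] N by (simp add: w_def)
  next
    case (step i)
    have "P i \<noteq> 0" using far[of i] step N by auto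
    moreover have "of_int (P (i - 1)) * f i = of_int (P i) * f (i - 1)"
      using adjacent[of "i - 1"] far[of "i - 1"] step(1) by simp
    ultimately show ?case using step by (simp add: field_simps)
  qed
  show thesis
  proof (rule that[of w])
    fix b
    define t where "t = \<bar>b\<bar> + \<bar>m0\<bar> + \<bar>s\<bar> + N * \<bar>b\<bar> + 1"
    define F where "F x = f x - of_int (P x) * w" for x
    have Nb: "N * \<bar>b\<bar> \<ge> 0" using N by simp
    have le: "b - 2 * t \<le> m0" "b - t \<le> m0" using Nb by (simp_all add: t_def)
    have F0: "F (b - 2 * t) = 0" "F (b - t) = 0" using half le by (simp_all add: F_def)
    have Pt: "P (b - t) \<noteq> 0" using far[OF le(2)] N by auto
    have K: "K ((b - 2 * t) + b) = 2 * f (b - t)" using H2[OF Pt] by (simp add: algebra_simps)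
    have "of_int (P (b - 2 * t) + (b - 2 * t - b)) * F b = of_int (P (b - 2 * t) + (b - 2 * t - b)) * f b
        - of_int (P (b - 2 * t) + (b - 2 * t - b)) * (of_int (P b) * w)"
      by (simp add: F_def right_diff_distrib)
    also have "of_int (P (b - 2 * t) + (b - 2 * t - b)) * f b =
       of_int (P b + (b - (b - 2 * t))) * f (b - 2 * t) - of_int (b - (b - 2 * t)) * (2 * f (b - t))"
      using H1[of b "b - 2 * t"] unfolding K by (simp add: algebra_simps)
    also have "f (b - 2 * t) = of_int (P (b - 2 * t)) * w" using half le by simp
    also have "f (b - t) = of_int (P (b - t)) * w" using half le by simp
    finally have "of_int (P (b - 2 * t) + (b - 2 * t - b)) * F b = 0"
      by (simp add: P_def algebra_simps)
    moreover have "P (b - 2 * t) + (b - 2 * t - b) \<noteq> 0"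
    proof -
      have "P (b - 2 * t) + (b - 2 * t - b) = s - N * b + (2 * N - 2) * t" by (simp add: P_def algebra_simps)
      moreover have "(2 * N - 2) * t \<ge> 1 * t" using N by (intro mult_right_mono) (auto simp: t_def)
      moreover have "N * b \<le> N * \<bar>b\<bar>" using N by simp
      moreover have "s - N * \<bar>b\<bar> + t > 0" unfolding t_def by linarith
      ultimately show ?thesis by linarith
    qed
    ultimately have "F b = 0" by (metis mult_eq_0_iff of_int_eq_0_iff)
    then show "f b = of_int (P b) * w" by (simp add: F_def)
  qed
qed

locale complex_algebra = vector_space sc for sc :: "complex \<Rightarrow> 'r::ring_1 \<Rightarrow> 'r" +
  assumes sc_left: "sc c x * y = sc c (x * y)" and sc_right: "x * sc c y = sc c (x * y)"
begin

lemma bra_sc [simp]: "bra (sc c x) y = sc c (bra x y)" "bra x (sc c y) = sc c (bra x y)"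
  by (simp_all add: sc_left sc_right scale_right_diff_distrib)

lemma functional:
  assumes "Vector_Spaces.linear sc (*) \<phi>"
  shows "\<phi> (x + y) = \<phi> x + \<phi> y" "\<phi> (sc c x) = c * \<phi> x" "\<phi> (x - y) = \<phi> x - \<phi> y" "\<phi> (- x) = - \<phi> x" "\<phi> 0 = 0"
proof -
  have a: "\<phi> (x + y) = \<phi> x + \<phi> y" and s: "\<phi> (sc c x) = c * \<phi> x" for x y c
    using assms unfolding Vector_Spaces.linear_iff by auto
  show "\<phi> (x + y) = \<phi> x + \<phi> y" "\<phi> (sc c x) = c * \<phi> x" by (fact a s)+
  show m: "\<phi> (- x) = - \<phi> x" using s[of "- 1" x] by simp
  show "\<phi> (x - y) = \<phi> x - \<phi> y" using a[of "x - y" y] by simp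
  show "\<phi> 0 = 0" using a[of 0 0] by simp
qed

text \<open>
  Linear functionals separate points; this turns functional equations with values in the algebra into
  scalar ones.
\<close>

lemma eq_by_functionals:
  assumes "\<And>\<phi>. Vector_Spaces.linear sc (*) \<phi> \<Longrightarrow> \<phi> x = (\<phi> y :: complex)"
  shows "x = y"
proof (rule ccontr)
  assume "x \<noteq> y"
  interpret V: vector_space_pair sc "(*) :: complex \<Rightarrow> complex \<Rightarrow> complex"
    by unfold_locales (simp_all add: algebra_simps)
  have "independent {x - y}" using \<open>x \<noteq> y\<close> by simp
  from V.linear_independent_extend[OF this, of "\<lambda>_. 1"]
  obtain g where g: "Vector_Spaces.linear sc (*) g" "g (x - y) = 1" by auto
  then show False using functional(3)[OF g(1), of x y] assms[OF g(1)] by simp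
qed

text \<open>
  The element \<open>Xr e n s\<close> spans bidegree \<open>(s, n + 1)\<close> in the Lie algebra generated by the \<open>e a\<close>. To generate it
  one may use any bracket \<open>[e a, Xr e (n - 1) (s - a)]\<close> with nonzero coefficient \<open>s - (n + 1) a\<close>: \<open>a = 0\<close> will
  do unless \<open>s = 0\<close>.
\<close>

fun Xr :: "(int \<Rightarrow> 'r) \<Rightarrow> nat \<Rightarrow> int \<Rightarrow> 'r" where
  "Xr e 0 s = e s"
| "Xr e (Suc n) s = (if s \<noteq> 0 then sc (1 / of_int s) (bra (e 0) (Xr e n s))
     else sc (- 1 / of_nat (n + 2)) (bra (e 1) (Xr e n (- 1))))"

declare Xr.simps(2) [simp del]

lemma bra_zero [simp]: "bra (x :: 'r) 0 = 0" "bra 0 (x :: 'r) = 0"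
  by simp_all

lemma jacobi: "bra (x::'r) (bra y z) - bra y (bra x z) = bra (bra x y) z"
  by (simp add: algebra_simps)

definition poisson_rule :: "(int \<Rightarrow> 'r) \<Rightarrow> nat \<Rightarrow> bool" where
  "poisson_rule e n \<longleftrightarrow> (\<forall>a b. bra (e a) (Xr e n b) = sc (of_int (b - int (n + 1) * a)) (Xr e (Suc n) (a + b)))"

lemma poisson_ruleD: "poisson_rule e n \<Longrightarrow> bra (e a) (Xr e n b) = sc (of_int (b - int (n + 1) * a)) (Xr e (Suc n) (a + b))"
  by (simp add: poisson_rule_def)

text \<open>
  It suffices that \<open>[e a, Xr e n (s - a)]\<close> is proportional to the expected coefficient as a function of \<open>a\<close>;
  the factor of proportionality is then \<open>Xr e (n + 1) s\<close> by definition.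
\<close>

lemma poisson_ruleI:
  assumes "\<And>\<phi> s. Vector_Spaces.linear sc (*) \<phi> \<Longrightarrow>
     \<exists>w. \<forall>a. \<phi> (bra (e a) (Xr e n (s - a))) = of_int (s - int (n + 2) * a) * w"
  shows "poisson_rule e n"
  unfolding poisson_rule_def
proof (intro allI eq_by_functionals)
  fix a b :: int and \<phi> assume \<phi>: "Vector_Spaces.linear sc (*) (\<phi> :: 'r \<Rightarrow> complex)"
  define s where "s = a + b"
  obtain w where w: "\<phi> (bra (e a) (Xr e n (s - a))) = of_int (s - int (n + 2) * a) * w" for a
    using assms[OF \<phi>, of s] by blast
  have "\<phi> (Xr e (Suc n) s) = w"
  proof (cases "s = 0")
    case True
    define k where "k = (of_nat (n + 2) :: complex)"
    have k: "k \<noteq> 0" unfolding k_def of_nat_eq_0_iff by simp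
    have "\<phi> (bra (e 1) (Xr e n (- 1))) = - k * w"
      using w[of 1] True by (simp only: k_def) simp
    moreover have "Xr e (Suc n) s = sc (- 1 / k) (bra (e 1) (Xr e n (- 1)))"
      using True by (simp only: k_def Xr.simps(2)) simp
    ultimately show ?thesis using k by (simp only: functional(2)[OF \<phi>]) simp
  next
    case False
    then show ?thesis using w[of 0] by (simp add: functional[OF \<phi>] Xr.simps(2))
  qed
  moreover have "s - int (n + 2) * a = b - int (n + 1) * a" by (simp add: s_def algebra_simps)
  moreover have "s - a = b" by (simp add: s_def)
  ultimately show "\<phi> (bra (e a) (Xr e n b)) = \<phi> (sc (of_int (b - int (n + 1) * a)) (Xr e (Suc n) (a + b)))"
    using w[of a] by (simp only: functional(2)[OF \<phi>] s_def[symmetric])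
qed

lemma poisson_rule_0:
  assumes rec: "\<And>i j. bra (e (i + 3)) (e j) - sc 3 (bra (e (i + 2)) (e (j + 1)))
     + sc 3 (bra (e (i + 1)) (e (j + 2))) - bra (e i) (e (j + 3)) = 0"
  shows "poisson_rule e 0"
proof (rule poisson_ruleI)
  fix \<phi> and s :: int assume \<phi>: "Vector_Spaces.linear sc (*) (\<phi> :: 'r \<Rightarrow> complex)"
  let ?u = "\<lambda>a. \<phi> (bra (e a) (e (s - a)))"
  have "\<phi> (bra (e (a + 3)) (e (s - a - 3)) - sc 3 (bra (e (a + 2)) (e (s - a - 3 + 1)))
     + sc 3 (bra (e (a + 1)) (e (s - a - 3 + 2))) - bra (e a) (e (s - a - 3 + 3))) = 0" for a
    unfolding rec by (rule functional(5)[OF \<phi>])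
  moreover have "s - a - 3 = s - (a + 3)" "s - a - 3 + 1 = s - (a + 2)" "s - a - 3 + 2 = s - (a + 1)" "s - a - 3 + 3 = s - a" for a
    by simp_all
  ultimately have 1: "?u (a + 3) - 3 * ?u (a + 2) + 3 * ?u (a + 1) - ?u a = 0" for a
    by (simp only: functional(1,2,3)[OF \<phi>])
  have 2: "?u (s - a) = - ?u a" for a
    by (simp add: functional[OF \<phi>])
  obtain w where "?u a = of_int (s - 2 * a) * w" for a
    using affine_antisymmetric[of ?u s, OF 1 2] by blast
  then show "\<exists>w. \<forall>a. \<phi> (bra (e a) (Xr e 0 (s - a))) = of_int (s - int (0 + 2) * a) * w" by auto
qed

lemma poisson_rule_1:
  assumes ser: "\<And>i. ser e i = 0" and g0: "poisson_rule e 0"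
  shows "poisson_rule e 1"
proof (rule poisson_ruleI)
  fix \<phi> and s :: int assume \<phi>: "Vector_Spaces.linear sc (*) (\<phi> :: 'r \<Rightarrow> complex)"
  let ?G = "\<lambda>a. \<phi> (bra (e a) (Xr e 1 (s - a)))"
  have ee: "bra (e b) (e c) = sc (of_int (c - b)) (Xr e 1 (b + c))" for b c
    using poisson_ruleD[OF g0, of b c] by simp
  have G: "?G a + ?G b + ?G c = 0" if s: "a + b + c = s" for a b c
  proof -
    define i where "i k = (if k = 1 then a else if k = 2 then b else c)" for k :: nat
    have i: "i 1 = a" "i 2 = b" "i 3 = c" by (simp_all add: i_def)
    have t: "\<phi> (bra (e x) (bra (e (y + 1)) (e (z - 1)))) = (of_int (z - y) - 2) * ?G x" if "x + y + z = s" for x y z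
    proof -
      have "y + 1 + (z - 1) = s - x" using that by simp
      then have "bra (e x) (bra (e (y + 1)) (e (z - 1))) = sc (of_int (z - 1 - (y + 1))) (bra (e x) (Xr e 1 (s - x)))"
        by (simp only: ee bra_sc)
      then have "\<phi> (bra (e x) (bra (e (y + 1)) (e (z - 1)))) = of_int (z - 1 - (y + 1)) * ?G x"
        by (simp only: functional(2)[OF \<phi>])
      moreover have "(of_int (z - 1 - (y + 1)) :: complex) = of_int (z - y) - 2" by simp
      ultimately show ?thesis by (simp only:)
    qed
    have "0 = \<phi> (ser e i)" unfolding ser by (rule functional(5)[OF \<phi>, symmetric])
    also have "\<dots> = \<phi> (bra (e a) (bra (e (b + 1)) (e (c - 1)))) + \<phi> (bra (e a) (bra (e (c + 1)) (e (b - 1))))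
        + \<phi> (bra (e b) (bra (e (a + 1)) (e (c - 1)))) + \<phi> (bra (e b) (bra (e (c + 1)) (e (a - 1))))
        + \<phi> (bra (e c) (bra (e (a + 1)) (e (b - 1)))) + \<phi> (bra (e c) (bra (e (b + 1)) (e (a - 1))))"
      unfolding ser_def sum_permutes_3[of "\<lambda>x y z. bra (e (i x)) (bra (e (i y + 1)) (e (i z - 1)))"] i
      by (simp only: functional(1)[OF \<phi>])
    also have "\<dots> = - 4 * (?G a + ?G b + ?G c)"
    proof -
      have p: "a + c + b = s" "b + a + c = s" "b + c + a = s" "c + a + b = s" "c + b + a = s" using s by simp_all
      show ?thesis
        unfolding t[OF s] t[OF p(1)] t[OF p(2)] t[OF p(3)] t[OF p(4)] t[OF p(5)] by (simp add: algebra_simps)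
    qed
    finally have "0 = - 4 * (?G a + ?G b + ?G c)" .
    moreover have "0 = - 4 * x \<Longrightarrow> x = 0" for x :: complex by simp
    ultimately show ?thesis by blast
  qed
  have "?G a + ?G b + ?G (s - a - b) = 0" for a b by (rule G) simp
  then obtain w where "?G a = of_int (s - 3 * a) * w" for a
    using affine_sum_zero[of ?G s] by blast
  then show "\<exists>w. \<forall>a. \<phi> (bra (e a) (Xr e 1 (s - a))) = of_int (s - int (1 + 2) * a) * w" by auto
qed

text \<open>
  Brackets with degree 2 are known as soon as those with two elements of degree 1 are.
\<close>

lemma bra_X2:
  assumes "poisson_rule e 0" "poisson_rule e m" "poisson_rule e (Suc m)"
  shows "bra (Xr e 1 t) (Xr e m c) = sc (of_int (2 * c - int (m + 1) * t)) (Xr e (m + 2) (t + c))"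
proof -
  obtain a b where ab: "a + b = t" "b - a \<noteq> 0"
  proof (cases "t = 0")
    case True
    then show ?thesis by (intro that[of 1 "- 1"]) auto
  next
    case False
    then show ?thesis by (intro that[of 0 t]) auto
  qed
  have nest: "bra (e x) (bra (e y) (Xr e m c)) =
      sc (of_int (c - int (m + 1) * y) * of_int (y + c - int (Suc m + 1) * x)) (Xr e (m + 2) (t + c))"
    if "x + y = t" for x y
  proof -
    have "x + (y + c) = t + c" using that by simp
    moreover have "m + 2 = Suc (Suc m)" by simp
    ultimately show ?thesis
      by (simp only: poisson_ruleD[OF assms(2)] bra_sc poisson_ruleD[OF assms(3)] scale_scale)
  qed
  have "sc (of_int (b - a)) (bra (Xr e 1 t) (Xr e m c)) = bra (bra (e a) (e b)) (Xr e m c)"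
    using poisson_ruleD[OF assms(1), of a b] ab by simp
  also have "\<dots> = bra (e a) (bra (e b) (Xr e m c)) - bra (e b) (bra (e a) (Xr e m c))"
    by (rule jacobi[symmetric])
  also have "\<dots> = sc (of_int (c - int (m + 1) * b) * of_int (b + c - int (Suc m + 1) * a)
      - of_int (c - int (m + 1) * a) * of_int (a + c - int (Suc m + 1) * b)) (Xr e (m + 2) (t + c))"
    unfolding nest[OF ab(1)] nest[OF trans[OF add.commute ab(1)]] by (rule scale_left_diff_distrib[symmetric])
  also have "(of_int (c - int (m + 1) * b) * of_int (b + c - int (Suc m + 1) * a)
      - of_int (c - int (m + 1) * a) * of_int (a + c - int (Suc m + 1) * b) :: complex) = of_int (b - a) * of_int (2 * c - int (m + 1) * t)"
    unfolding ab(1)[symmetric] by (simp add: algebra_simps)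
  finally have "sc (of_int (b - a)) (bra (Xr e 1 t) (Xr e m c)) =
     sc (of_int (b - a)) (sc (of_int (2 * c - int (m + 1) * t)) (Xr e (m + 2) (t + c)))" by simp
  moreover have "(of_int (b - a) :: complex) \<noteq> 0" using ab(2) unfolding of_int_eq_0_iff .
  ultimately show ?thesis by (simp only: scale_left_imp_eq)
qed

text \<open>
  The two hypotheses of \<open>affine_jacobi\<close>, for \<open>K t = [Xr e 1 t, Xr e (m + 1) (s - t)]\<close>, are the Jacobi
  identities for \<open>e a\<close>, \<open>e b\<close>, \<open>Xr e (m + 1) (s - a - b)\<close> and for \<open>e a\<close>, \<open>Xr e 1 (2 a)\<close>, \<open>Xr e m (s - 3 a)\<close>.
\<close>

lemma poisson_rule_step:
  assumes g: "poisson_rule e 0" "poisson_rule e 1" "poisson_rule e m" "poisson_rule e (Suc m)"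
  shows "poisson_rule e (m + 2)"
proof (rule poisson_ruleI)
  fix \<phi> and s :: int assume \<phi>: "Vector_Spaces.linear sc (*) (\<phi> :: 'r \<Rightarrow> complex)"
  define N where "N = int (m + 4)"
  have N: "N \<ge> 4" by (simp add: N_def)
  let ?f = "\<lambda>a. \<phi> (bra (e a) (Xr e (m + 2) (s - a)))"
  let ?K = "\<lambda>t. \<phi> (bra (Xr e 1 t) (Xr e (Suc m) (s - t)))"
  have H1: "of_int (s - N * b + (b - a)) * ?f a - of_int (s - N * a + (a - b)) * ?f b = of_int (b - a) * ?K (a + b)" for a b
  proof -
    have j: "bra (e x) (bra (e y) (Xr e (Suc m) (s - x - y))) = sc (of_int (s - N * y + (y - x))) (bra (e x) (Xr e (m + 2) (s - x)))" for x y
    proof -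
      have "y + (s - x - y) = s - x" "s - x - y - int (Suc m + 1) * y = s - N * y + (y - x)"
        by (simp_all add: N_def algebra_simps)
      then show ?thesis using poisson_ruleD[OF g(4), of y "s - x - y"] by (simp only: bra_sc) simp
    qed
    have "s - b - a = s - a - b" by simp
    then have "sc (of_int (s - N * b + (b - a))) (bra (e a) (Xr e (m + 2) (s - a)))
        - sc (of_int (s - N * a + (a - b))) (bra (e b) (Xr e (m + 2) (s - b)))
      = bra (e a) (bra (e b) (Xr e (Suc m) (s - a - b))) - bra (e b) (bra (e a) (Xr e (Suc m) (s - a - b)))"
      using j[of a b] j[of b a] by (simp only:)
    also have "\<dots> = bra (bra (e a) (e b)) (Xr e (Suc m) (s - a - b))" by (rule jacobi)
    also have "\<dots> = sc (of_int (b - a)) (bra (Xr e 1 (a + b)) (Xr e (Suc m) (s - (a + b))))"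
      using poisson_ruleD[OF g(1), of a b] by (simp add: diff_diff_eq)
    finally have "\<phi> (sc (of_int (s - N * b + (b - a))) (bra (e a) (Xr e (m + 2) (s - a)))
        - sc (of_int (s - N * a + (a - b))) (bra (e b) (Xr e (m + 2) (s - b)))) = 
      \<phi> (sc (of_int (b - a)) (bra (Xr e 1 (a + b)) (Xr e (Suc m) (s - (a + b)))))" by (rule arg_cong)
    then show ?thesis by (simp only: functional[OF \<phi>])
  qed
  have H2: "?K (2 * a) = 2 * ?f a" if P: "s - N * a \<noteq> 0" for a
  proof -
    \<comment> \<open>\<open>e a\<close> commutes with \<open>Xr e 1 (2 * a)\<close>; compare both orders on \<open>Xr e m (s - 3 * a)\<close>.\<close>
    have 0: "bra (e a) (Xr e 1 (2 * a)) = 0" using poisson_ruleD[OF g(2), of a "2 * a"] by simp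
    have 1: "bra (e a) (bra (Xr e 1 (2 * a)) (Xr e m (s - 3 * a))) = sc (2 * of_int (s - N * a)) (bra (e a) (Xr e (m + 2) (s - a)))"
    proof -
      have "2 * a + (s - 3 * a) = s - a" "2 * (s - 3 * a) - int (m + 1) * (2 * a) = 2 * (s - N * a)"
        by (simp_all add: N_def algebra_simps)
      then show ?thesis using bra_X2[OF g(1,3,4), of "2 * a" "s - 3 * a"] by (simp only: bra_sc) simp
    qed
    have 2: "bra (Xr e 1 (2 * a)) (bra (e a) (Xr e m (s - 3 * a))) = sc (of_int (s - N * a)) (bra (Xr e 1 (2 * a)) (Xr e (Suc m) (s - 2 * a)))"
    proof -
      have "a + (s - 3 * a) = s - 2 * a" "s - 3 * a - int (m + 1) * a = s - N * a"
        by (simp_all add: N_def algebra_simps)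
      then show ?thesis using poisson_ruleD[OF g(3), of a "s - 3 * a"] by (simp only: bra_sc)
    qed
    have "sc (2 * of_int (s - N * a)) (bra (e a) (Xr e (m + 2) (s - a))) - sc (of_int (s - N * a)) (bra (Xr e 1 (2 * a)) (Xr e (Suc m) (s - 2 * a))) = 0"
      unfolding 1[symmetric] 2[symmetric] jacobi 0 by (rule bra_zero)
    then have "\<phi> (sc (2 * of_int (s - N * a)) (bra (e a) (Xr e (m + 2) (s - a)))
       - sc (of_int (s - N * a)) (bra (Xr e 1 (2 * a)) (Xr e (Suc m) (s - 2 * a)))) = 0"
      using functional(5)[OF \<phi>] by (simp only:)
    then have "of_int (s - N * a) * (2 * ?f a) = of_int (s - N * a) * ?K (2 * a)"
      by (simp only: functional[OF \<phi>] right_minus_eq mult_ac)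
    moreover have "(of_int (s - N * a) :: complex) \<noteq> 0" using P unfolding of_int_eq_0_iff .
    ultimately show ?thesis by (simp only: mult_cancel_left) simp
  qed
  obtain w where "?f a = of_int (s - N * a) * w" for a
    using affine_jacobi[OF N, of s ?f ?K, OF H1 H2] by blast
  then show "\<exists>w. \<forall>a. \<phi> (bra (e a) (Xr e (m + 2) (s - a))) = of_int (s - int (m + 2 + 2) * a) * w"
  proof -
    have "N = int (m + 2 + 2)" by (simp add: N_def)
    then show ?thesis using \<open>\<And>a. ?f a = of_int (s - N * a) * w\<close> by blast
  qed
qed

text \<open>
  Each bidegree of the Lie algebra generated by the \<open>e a\<close> is spanned by one element, as in the
  Poisson algebra with \<open>{x\<^sup>a y\<^sup>i, x\<^sup>b y\<^sup>j} = (i b - j a) x\<^sup>a\<^sup>+\<^sup>b y\<^sup>i\<^sup>+\<^sup>j\<close>.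
\<close>

theorem poisson_rule_all:
  assumes rec: "\<And>i j. bra (e (i + 3)) (e j) - sc 3 (bra (e (i + 2)) (e (j + 1)))
     + sc 3 (bra (e (i + 1)) (e (j + 2))) - bra (e i) (e (j + 3)) = 0"
    and ser: "\<And>i. ser e i = 0"
  shows "poisson_rule e n"
proof (induction n rule: less_induct)
  case (less n)
  have 0: "poisson_rule e 0" by (rule poisson_rule_0[OF rec])
  have 1: "poisson_rule e 1" by (rule poisson_rule_1[OF ser 0])
  consider "n = 0" | "n = 1" | m where "n = m + 2"
    by (metis One_nat_def Suc_1 add_Suc_right add_0_right not0_implies_Suc)
  then show ?case
  proof cases
    case (3 m)
    then show ?thesis using poisson_rule_step[OF 0 1 less[of m] less[of "Suc m"]] by simp
  qed (use 0 1 in auto)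
qed

lemma bra_Xr_Xr:
  assumes g: "\<And>n. poisson_rule e n"
  shows "\<exists>k. bra (Xr e n a) (Xr e m b) = sc k (Xr e (n + m + 1) (a + b))"
proof (induction n arbitrary: a b m)
  case 0
  show ?case using poisson_ruleD[OF g, of a m b] by auto
next
  case (Suc n)
  obtain c a1 a2 where X: "Xr e (Suc n) a = sc c (bra (e a1) (Xr e n a2))" "a1 + a2 = a"
  proof (cases "a = 0")
    case True
    have X0: "Xr e (Suc n) a = sc (- 1 / of_nat (n + 2)) (bra (e 1) (Xr e n (- 1)))"
      using True by (simp only: Xr.simps(2)) simp
    show ?thesis using True by (intro that[OF X0]) simp
  next
    case False
    then show ?thesis by (intro that[of "1 / of_int a" 0 a]) (auto simp: Xr.simps(2))
  qed
  obtain k1 where k1: "bra (Xr e n a2) (Xr e m b) = sc k1 (Xr e (n + m + 1) (a2 + b))" using Suc by blast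
  obtain k2 where k2: "bra (Xr e n a2) (Xr e (Suc m) (a1 + b)) = sc k2 (Xr e (n + Suc m + 1) (a2 + (a1 + b)))" using Suc by blast
  have s: "a1 + (a2 + b) = a + b" "a2 + (a1 + b) = a + b" using X by auto
  have "bra (Xr e (Suc n) a) (Xr e m b) = sc c (bra (e a1) (bra (Xr e n a2) (Xr e m b)) - bra (Xr e n a2) (bra (e a1) (Xr e m b)))"
    unfolding X(1) bra_sc jacobi ..
  also have "\<dots> = sc (c * (k1 * of_int (a2 + b - int (n + m + 1 + 1) * a1) - of_int (b - int (m + 1) * a1) * k2)) (Xr e (Suc n + m + 1) (a + b))"
    unfolding k1 bra_sc poisson_ruleD[OF g] k2 s by (simp add: scale_left_diff_distrib scale_right_diff_distrib algebra_simps)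
  finally show ?case by blast
qed

text \<open>
  The positive and the negative half commute except in degree 1, because the \<open>H i\<close> are central.
\<close>

lemma bra_mixed:
  assumes eH: "\<And>i j. bra (H i) (e j) = 0" and fH: "\<And>i j. bra (H i) (f j) = 0"
    and ef: "\<And>i j. bra (e i) (f j) = H (i + j)"
  shows "bra (H i) (Xr e n a) = 0" "bra (H i) (Xr f n a) = 0"
    and "bra (Xr e n a) (Xr f m b) = (if n = 0 \<and> m = 0 then H (a + b) else 0)"
proof -
  have HX: "bra (H i) (Xr x n a) = 0" if "\<And>i j. bra (H i) (x j) = 0" for x i n a
  proof (induction n arbitrary: a)
    case (Suc n)
    have "bra (H i) (bra (x b) (Xr x n c)) = 0" for b c
      using jacobi[of "H i" "x b" "Xr x n c"] that[of i b] Suc by simp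
    then show ?case by (simp only: Xr.simps bra_sc scale_zero_right split: if_splits) simp
  qed (use that in simp)
  show He: "bra (H i) (Xr e n a) = 0" and Hf: "bra (H i) (Xr f n a) = 0" for i n a
    using HX eH fH by blast+
  have swap: "bra x y = 0 \<Longrightarrow> bra y x = 0" for x y :: 'r by simp
  have e: "bra (e a) (Xr f m b) = (if m = 0 then H (a + b) else 0)" for a m b
  proof (induction m arbitrary: b)
    case (Suc m)
    have "bra (e a) (bra (f c) (Xr f m d)) = 0" for c d
    proof -
      have "bra (e a) (bra (f c) (Xr f m d)) = bra (bra (e a) (f c)) (Xr f m d) + bra (f c) (bra (e a) (Xr f m d))"
        using jacobi[of "e a" "f c" "Xr f m d"] by (simp only: diff_eq_eq)
      also have "bra (bra (e a) (f c)) (Xr f m d) = 0" unfolding ef by (rule Hf)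
      also have "bra (f c) (bra (e a) (Xr f m d)) = 0"
        unfolding Suc using swap[OF fH] by simp
      finally show ?thesis by simp
    qed
    then show ?case by (simp only: Xr.simps bra_sc scale_zero_right split: if_splits) simp
  qed (simp add: ef)
  show "bra (Xr e n a) (Xr f m b) = (if n = 0 \<and> m = 0 then H (a + b) else 0)"
  proof (induction n arbitrary: a)
    case 0
    show ?case using e[of a m b] by simp
  next
    case (Suc n)
    have "bra (bra (e c) (Xr e n d)) (Xr f m b) = 0" for c d
    proof -
      have "bra (bra (e c) (Xr e n d)) (Xr f m b) = bra (e c) (bra (Xr e n d) (Xr f m b)) - bra (Xr e n d) (bra (e c) (Xr f m b))"
        by (rule jacobi[symmetric])
      also have "bra (e c) (bra (Xr e n d) (Xr f m b)) = 0"
        unfolding Suc using swap[OF eH] by simp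
      also have "bra (Xr e n d) (bra (e c) (Xr f m b)) = 0"
        unfolding e using swap[OF He] by simp
      finally show ?thesis by simp
    qed
    then show ?case by (simp only: Xr.simps bra_sc scale_zero_right split: if_splits) simp
  qed
qed

end

section \<open>The toroidal algebra modulo \<open>h\<close>\<close>

lifting_forget hs.lifting

lemma TR_hclosed: "hclosed TR"
  and TR_left: "x \<in> TR \<Longrightarrow> u * x \<in> TR"
  and TR_right: "x \<in> TR \<Longrightarrow> x * u \<in> TR"
  using Rel_hclosed[OF tor_rels_carrier] Rel_mult_left[OF tor_rels_carrier] Rel_mult_right[OF tor_rels_carrier]
  by auto

lemma TR_trels: "x \<in> trels \<Longrightarrow> x \<in> TR"
  by (rule Rel_relation[OF tor_rels_carrier]) (simp add: tor_rels_eq)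

text \<open>
  The ideal generated by the relations and \<open>h\<close>. The quotient \<open>tor0\<close> by it is an algebra over \<open>\<complex>\<close>.
\<close>

definition TRh :: "tor_gen list hs set" where "TRh = {x. \<exists>y. x - h \<bullet> y \<in> TR}"

lemma TRh_I: "x - h \<bullet> y \<in> TR \<Longrightarrow> x \<in> TRh"
  by (auto simp: TRh_def)

lemma TR_TRh: "x \<in> TR \<Longrightarrow> x \<in> TRh"
  by (rule TRh_I[of _ 0]) simp

lemma h_TRh: "h \<bullet> y \<in> TRh"
  by (rule TRh_I[of _ y]) (simp add: hclosed_zero[OF TR_hclosed])

lemma TRh_zero: "0 \<in> TRh"
  by (rule TR_TRh) (rule hclosed_zero[OF TR_hclosed])

lemma TRh_add: "x \<in> TRh \<Longrightarrow> y \<in> TRh \<Longrightarrow> x + y \<in> TRh"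
proof -
  assume "x \<in> TRh" "y \<in> TRh"
  then obtain x' y' where "x - h \<bullet> x' \<in> TR" "y - h \<bullet> y' \<in> TR" by (auto simp: TRh_def)
  then have "(x - h \<bullet> x') + (y - h \<bullet> y') \<in> TR" by (rule hclosed_add[OF TR_hclosed])
  then show ?thesis by (intro TRh_I[of _ "x' + y'"]) (simp add: hs.scale_right_distrib algebra_simps)
qed

lemma TRh_scale: "x \<in> TRh \<Longrightarrow> c \<bullet> x \<in> TRh"
proof -
  assume "x \<in> TRh"
  then obtain y where "x - h \<bullet> y \<in> TR" by (auto simp: TRh_def)
  then have "c \<bullet> (x - h \<bullet> y) \<in> TR" by (rule hclosed_scale[OF TR_hclosed])
  then show ?thesis by (intro TRh_I[of _ "c \<bullet> y"]) (simp add: hs.scale_right_diff_distrib mult.commute)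
qed

lemma TRh_minus: "x \<in> TRh \<Longrightarrow> - x \<in> TRh"
  using TRh_scale[of x "- 1"] by simp

lemma TRh_mult: "x \<in> TRh \<Longrightarrow> u * x \<in> TRh" "x \<in> TRh \<Longrightarrow> x * u \<in> TRh"
proof -
  assume "x \<in> TRh"
  then obtain y where y: "x - h \<bullet> y \<in> TR" by (auto simp: TRh_def)
  show "u * x \<in> TRh" using TR_left[OF y, of u] by (intro TRh_I[of _ "u * y"]) (simp add: right_diff_distrib)
  show "x * u \<in> TRh" using TR_right[OF y, of u] by (intro TRh_I[of _ "y * u"]) (simp add: left_diff_distrib)
qed

text \<open>
  The quotient is nontrivial since the normal form of the image of \<open>1\<close> is the empty word.
\<close>

lemma one_notin_TRh: "1 \<notin> TRh"
proof
  assume "1 \<in> TRh"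
  then obtain y where "1 - h \<bullet> y \<in> TR" by (auto simp: TRh_def)
  then have "Th (1 - h \<bullet> y) \<in> U.U" using Th_TR U0_sub by blast
  then have "pbw (coords (Th (1 - h \<bullet> y))) = 0" by (rule pbw_coords_Rel)
  then have "pbw 1 = h \<bullet> pbw (coords (Th y))"
    by (simp add: Th_simps coords_simps hlin_diff[OF hlin_pbw] hlin_scale[OF hlin_pbw])
  then have "single [] = h \<bullet> pbw (coords (Th y))" by (simp add: pbw_sorted one_list)
  then have "coef (single []) ([] :: zd option list) = coef (h \<bullet> pbw (coords (Th y))) ([] :: zd option list)"
    by (simp only:)
  then have "(1 :: complex fps) $ 0 = (h * coef (pbw (coords (Th y))) []) $ 0" by simp
  then show False by simp
qed

definition teq :: "tor_gen list hs \<Rightarrow> tor_gen list hs \<Rightarrow> bool" where "teq x y \<longleftrightarrow> x - y \<in> TRh"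

lemma teq_equivp: "equivp teq"
proof (rule equivpI)
  show "reflp teq" by (rule reflpI) (simp add: teq_def TRh_zero)
  show "symp teq" by (rule sympI) (use TRh_minus in \<open>fastforce simp: teq_def\<close>)
  show "transp teq"
  proof (rule transpI)
    fix x y z assume "teq x y" "teq y z"
    then have "(x - y) + (y - z) \<in> TRh" unfolding teq_def by (rule TRh_add)
    then show "teq x z" by (simp add: teq_def)
  qed
qed

quotient_type tor0 = "tor_gen list hs" / teq
  by (rule teq_equivp)

instantiation tor0 :: ring_1
begin
lift_definition zero_tor0 :: tor0 is 0 .
lift_definition one_tor0 :: tor0 is 1 .
lift_definition plus_tor0 :: "tor0 \<Rightarrow> tor0 \<Rightarrow> tor0" is "(+)"
proof -
  fix a b c d assume "teq a b" "teq c d"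
  then have "(a - b) + (c - d) \<in> TRh" unfolding teq_def by (rule TRh_add)
  then show "teq (a + c) (b + d)" by (simp add: teq_def algebra_simps)
qed
lift_definition uminus_tor0 :: "tor0 \<Rightarrow> tor0" is uminus
  unfolding teq_def using TRh_minus by fastforce
lift_definition minus_tor0 :: "tor0 \<Rightarrow> tor0 \<Rightarrow> tor0" is "(-)"
proof -
  fix a b c d assume "teq a b" "teq c d"
  then have "(a - b) + - (c - d) \<in> TRh" unfolding teq_def by (intro TRh_add TRh_minus)
  then show "teq (a - c) (b - d)" by (simp add: teq_def algebra_simps)
qed
lift_definition times_tor0 :: "tor0 \<Rightarrow> tor0 \<Rightarrow> tor0" is "(*)"
proof -
  fix a b c d assume "teq a b" "teq c d"
  then have "(a - b) * c + b * (c - d) \<in> TRh" unfolding teq_def by (intro TRh_add TRh_mult)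
  then show "teq (a * c) (b * d)" by (simp add: teq_def algebra_simps)
qed
instance
proof
  show "(0 :: tor0) \<noteq> 1" by transfer (use one_notin_TRh TRh_minus in \<open>fastforce simp: teq_def\<close>)
qed (transfer; simp add: algebra_simps teq_def TRh_zero)+
end

lift_definition sct :: "complex \<Rightarrow> tor0 \<Rightarrow> tor0" is "\<lambda>c x. fps_const c \<bullet> x"
  unfolding teq_def hs.scale_right_diff_distrib[symmetric] by (rule TRh_scale)

definition cl :: "tor_gen list hs \<Rightarrow> tor0" where "cl = abs_tor0"

lemma cl_ops: "cl (x + y) = cl x + cl y" "cl (x - y) = cl x - cl y" "cl (x * y) = cl x * cl y" "cl 0 = 0" "cl 1 = 1"
  "cl (- x) = - cl x"
  by (simp_all add: cl_def plus_tor0.abs_eq minus_tor0.abs_eq times_tor0.abs_eq zero_tor0_def one_tor0_def uminus_tor0.abs_eq)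

lemma cl_sum: "cl (sum f A) = (\<Sum>a\<in>A. cl (f a))"
  by (induction A rule: infinite_finite_induct) (auto simp: cl_ops)

lemma cl_eq_iff: "cl x = cl y \<longleftrightarrow> x - y \<in> TRh"
  by (simp add: cl_def tor0.abs_eq_iff teq_def)

lemma cl_scale: "cl (c \<bullet> x) = sct (c $ 0) (cl x)"
proof -
  have "c = fps_const (c $ 0) + h * fps_shift 1 c"
    by (rule fps_ext) (auto simp: fps_X_mult_nth)
  then have "c \<bullet> x - fps_const (c $ 0) \<bullet> x = h \<bullet> (fps_shift 1 c \<bullet> x)"
    by (metis add_diff_cancel_left' hs.scale_left_diff_distrib hs.scale_scale)
  then have "c \<bullet> x - fps_const (c $ 0) \<bullet> x \<in> TRh" by (simp only: h_TRh)
  then show ?thesis unfolding cl_def sct.abs_eq tor0.abs_eq_iff teq_def .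
qed

interpretation Q: complex_algebra sct
  by unfold_locales
     (transfer; simp add: teq_def TRh_zero hs.scale_right_distrib hs.scale_left_distrib fps_const_add[symmetric]
        fps_const_mult[symmetric] del: fps_const_add fps_const_mult)+

interpretation T: complex_algebra "\<lambda>c (x :: tor_gen list hs). fps_const c \<bullet> x"
  by unfold_locales
     (simp_all add: hs.scale_right_distrib hs.scale_left_distrib fps_const_add[symmetric]
        fps_const_mult[symmetric] del: fps_const_add fps_const_mult)

abbreviation "qe i \<equiv> cl (te i)"
abbreviation "qf i \<equiv> cl (tf i)"
abbreviation "qH i \<equiv> cl (tH i)"

lemma cl_Xr: "cl (T.Xr e n s) = Q.Xr (\<lambda>i. cl (e i)) n s"
proof (induction n arbitrary: s)
  case (Suc n)
  have "cl (fps_const c \<bullet> bra (e i) (T.Xr e n t)) = sct c (bra (cl (e i)) (Q.Xr (\<lambda>i. cl (e i)) n t))" for c i t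
    by (simp only: cl_scale cl_ops Suc fps_nth_fps_const) simp
  then show ?case by (simp only: T.Xr.simps Q.Xr.simps split: if_split) simp
qed simp

lemma cl_TR: "x \<in> TR \<Longrightarrow> cl x = 0"
  using cl_eq_iff[of x 0] TR_TRh by (simp add: cl_ops)

lemma trels_cases:
  "bra (tH i) (tH j) \<in> trels" "bra (te i) (tf j) - tH (i + j) \<in> trels" "cub te i j \<in> trels" "- cub tf i j \<in> trels"
  "bra (tH i) (te j) - (- ((1 - q powi i) * (1 - q powi (-i)))) \<bullet> te (i + j) \<in> trels"
  "bra (tH i) (tf j) - ((1 - q powi i) * (1 - q powi (-i))) \<bullet> tf (i + j) \<in> trels"
  "ser te k \<in> trels" "ser tf k \<in> trels"
  unfolding trels_def by blast+

text \<open>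
  Modulo \<open>h\<close> the structure constants \<open>(1 - q\<^sup>i)(1 - q\<^sup>-\<^sup>i)\<close> vanish.
\<close>

lemma qrel:
  "bra (qH i) (qH j) = 0" "bra (qe i) (qf j) = qH (i + j)" "bra (qH i) (qe j) = 0" "bra (qH i) (qf j) = 0"
proof -
  note t = trels_cases[THEN TR_trels, THEN cl_TR]
  show "bra (qH i) (qH j) = 0" using t(1) by (simp only: cl_ops)
  show "bra (qe i) (qf j) = qH (i + j)" using t(2)[of i j] by (simp only: cl_ops right_minus_eq)
  have z: "(- ((1 - q powi i) * (1 - q powi (-i)))) $ 0 = 0" "((1 - q powi i) * (1 - q powi (-i))) $ 0 = 0"
    by (simp_all add: fps_mult_nth_0)
  show "bra (qH i) (qe j) = 0" "bra (qH i) (qf j) = 0"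
    using t(5)[of i j] t(6)[of i j] by (simp_all only: cl_ops cl_scale z Q.scale_zero_left diff_zero)
qed

lemma qp_nth_0: "qp $ 0 = 3"
proof -
  have "q $ 0 = 1" "inverse q $ 0 = 1" using qpow_nth_0[of 1] qpow_nth_0[of "- 1"] by simp_all
  then show ?thesis by (simp add: qp_def)
qed

lemma cl_cub: "cl (cub x i j) = bra (cl (x (i + 3))) (cl (x j)) - sct 3 (bra (cl (x (i + 2))) (cl (x (j + 1))))
     + sct 3 (bra (cl (x (i + 1))) (cl (x (j + 2)))) - bra (cl (x i)) (cl (x (j + 3)))"
  unfolding cub_def by (simp only: cl_ops cl_scale qp_nth_0)

lemma cl_ser: "cl (ser x i) = ser (\<lambda>i. cl (x i)) i"
  unfolding ser_def by (simp only: cl_sum cl_ops)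

lemma poisson_rule_e: "Q.poisson_rule qe n"
proof (rule Q.poisson_rule_all)
  note t = trels_cases[THEN TR_trels, THEN cl_TR]
  show "bra (qe (i + 3)) (qe j) - sct 3 (bra (qe (i + 2)) (qe (j + 1))) + sct 3 (bra (qe (i + 1)) (qe (j + 2)))
     - bra (qe i) (qe (j + 3)) = 0" for i j
    using t(3)[of i j] by (simp only: cl_cub)
  show "ser qe i = 0" for i using t(7)[of i] by (simp only: cl_ser)
qed

lemma poisson_rule_f: "Q.poisson_rule qf n"
proof (rule Q.poisson_rule_all)
  note t = trels_cases[THEN TR_trels, THEN cl_TR]
  show "bra (qf (i + 3)) (qf j) - sct 3 (bra (qf (i + 2)) (qf (j + 1))) + sct 3 (bra (qf (i + 1)) (qf (j + 2)))
     - bra (qf i) (qf (j + 3)) = 0" for i j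
    using t(4)[of i j] by (simp only: cl_cub cl_ops neg_equal_0_iff_equal)
  show "ser qf i = 0" for i using t(8)[of i] by (simp only: cl_ser)
qed

subsection \<open>Lifts of the basis elements\<close>

text \<open>
  Lifts of the basis of \<open>bar_dq0\<close> to the free algebra. The multiple of \<open>H\<^sub>0\<close> cancels the central term in
  the image of \<open>H\<^sub>a\<close>; the elements \<open>Xr\<close> are formed with complex coefficients, so that reduction modulo \<open>h\<close>
  takes them to their classical counterparts.
\<close>

fun basis_lift :: "zd option \<Rightarrow> tor_gen list hs" where
  "basis_lift None = - tH 0"
| "basis_lift (Some (Mon a j)) = (if j = 0 then tH a - q powi (- a) \<bullet> tH 0
     else if j > 0 then T.Xr te (nat j - 1) a else T.Xr tf (nat (- j) - 1) a)"

definition lifts :: "tor_gen list hs \<Rightarrow> zd option \<Rightarrow> bool" where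
  "lifts x b \<longleftrightarrow> (\<exists>v. v $ 0 \<noteq> 0 \<and> U0.rep (Th x) (v \<bullet> gen0 b))"

text \<open>
  Each step of the recursion multiplies by a difference of two distinct powers of \<open>q\<close>, that is, by \<open>h\<close> and
  an invertible series.
\<close>

lemma lifts_Xr:
  assumes \<epsilon>: "\<epsilon> = 1 \<or> \<epsilon> = - 1" and g: "\<And>a. tg (g a) = c a \<bullet> single (Some (Mon a \<epsilon>))" "\<And>a. c a $ 0 \<noteq> 0"
  shows "lifts (T.Xr (\<lambda>a. single [g a]) n s) (Some (Mon s (\<epsilon> * int (n + 1))))"
    (is "lifts (?X n s) _")
proof (induction n arbitrary: s)
  case 0
  have "wt \<epsilon> = 0" using \<epsilon> by (auto simp: wt.simps)
  then have "U0.rep (Th (single [g s])) (c s \<bullet> gen0 (Some (Mon s \<epsilon>)))"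
    using rep_gen[of "g s"] by (simp add: g)
  then show ?case unfolding lifts_def using g(2) by (intro exI[of _ "c s"]) simp
next
  case (Suc n)
  have step: "lifts (fps_const k \<bullet> bra (single [g a]) (?X n b)) (Some (Mon s (\<epsilon> * int (Suc n + 1))))"
    if s: "a + b = s" and ne: "b \<noteq> int (n + 1) * a" and k: "k \<noteq> 0" for a b k
  proof -
    obtain v where v: "v $ 0 \<noteq> 0" "U0.rep (Th (?X n b)) (v \<bullet> gen0 (Some (Mon b (\<epsilon> * int (n + 1)))))"
      using Suc[of b] unfolding lifts_def by blast
    define u where "u = fps_const k * (c a * v * qdiff (\<epsilon> * b) (\<epsilon> * int (n + 1) * a))"
    have w: "wt (\<epsilon> * int (n + 1)) = n" "wt (\<epsilon> * int (Suc n + 1)) = Suc n"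
      using \<epsilon> by (auto simp: wt.simps nat_add_distrib)
    have nz: "\<epsilon> + \<epsilon> * int (n + 1) \<noteq> 0" using \<epsilon> by auto
    have idx: "\<epsilon> + \<epsilon> * int (n + 1) = \<epsilon> * int (Suc n + 1)" by (simp add: algebra_simps)
    have "U0.rep (Th (fps_const k \<bullet> bra (single [g a]) (?X n b)))
       (fps_const k \<bullet> lbr (tg (g a)) (v \<bullet> gen0 (Some (Mon b (\<epsilon> * int (n + 1))))))"
      unfolding Th_simps(1-4) by (intro U0.rep_scale U0.rep_bra rep_gen v(2))
    also have "lbr (tg (g a)) (v \<bullet> gen0 (Some (Mon b (\<epsilon> * int (n + 1))))) =
        lbr (c a \<bullet> single (Some (Mon a \<epsilon>))) ((v * h ^ n) \<bullet> single (Some (Mon b (\<epsilon> * int (n + 1)))))"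
      by (simp only: g gen0.simps w hs.scale_scale)
    also have "\<dots> = (c a * (v * h ^ n) * (q powi (\<epsilon> * b) - q powi (\<epsilon> * int (n + 1) * a))) \<bullet> single (Some (Mon s (\<epsilon> * int (Suc n + 1))))"
      unfolding lbr_ee[OF s nz] idx ..
    also have "fps_const k \<bullet> \<dots> = u \<bullet> gen0 (Some (Mon s (\<epsilon> * int (Suc n + 1))))"
      unfolding gen0.simps w h_qdiff[symmetric] hs.scale_scale u_def by (rule arg_cong[where f = "\<lambda>c. c \<bullet> _"]) (simp add: mult_ac)
    finally have "U0.rep (Th (fps_const k \<bullet> bra (single [g a]) (?X n b))) (u \<bullet> gen0 (Some (Mon s (\<epsilon> * int (Suc n + 1)))))" .
    moreover have "u $ 0 \<noteq> 0"
    proof -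
      have "\<epsilon> * b \<noteq> \<epsilon> * int (n + 1) * a" using ne \<epsilon> by auto
      then have "qdiff (\<epsilon> * b) (\<epsilon> * int (n + 1) * a) $ 0 \<noteq> 0"
        unfolding qdiff_nth_0 of_int_eq_0_iff by simp
      then show ?thesis using k v(1) g(2)[of a] by (simp add: u_def fps_mult_nth_0)
    qed
    ultimately show ?thesis unfolding lifts_def by blast
  qed
  show ?case
  proof (cases "s = 0")
    case True
    have "lifts (fps_const (- 1 / of_nat (n + 2)) \<bullet> bra (single [g 1]) (?X n (- 1))) (Some (Mon s (\<epsilon> * int (Suc n + 1))))"
    proof (rule step)
      have "(of_nat (n + 2) :: complex) \<noteq> 0" unfolding of_nat_eq_0_iff by simp
      then show "- 1 / (of_nat (n + 2) :: complex) \<noteq> 0" by (simp only: divide_eq_0_iff) simp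
    qed (use True in auto)
    then show ?thesis using True by (simp only: T.Xr.simps) simp
  next
    case False
    have "lifts (fps_const (1 / of_int s) \<bullet> bra (single [g 0]) (?X n s)) (Some (Mon s (\<epsilon> * int (Suc n + 1))))"
      by (rule step) (use False in auto)
    then show ?thesis using False by (simp only: T.Xr.simps) simp
  qed
qed

lemma lifts_basis_lift: "b \<in> ix0 \<Longrightarrow> lifts (basis_lift b) b"
proof (cases b)
  case None
  have "U0.rep (Th (basis_lift None)) (- tg (Hh 0))" unfolding basis_lift.simps Th_simps(6) by (intro U0.rep_minus rep_gen)
  then show ?thesis unfolding lifts_def None by (intro exI[of _ 1]) simp
next
  case (Some m)
  assume b: "b \<in> ix0"
  obtain a j where m: "m = Mon a j" by (cases m)
  consider "j = 0" | "j > 0" | "j < 0" by linarith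
  then show ?thesis
  proof cases
    case 1
    have a: "a \<noteq> 0" using b 1 by (auto simp: Some m ix0_def)
    have "U0.rep (Th (tH a - q powi (- a) \<bullet> tH 0)) (tg (Hh a) - q powi (- a) \<bullet> tg (Hh 0))"
      unfolding Th_simps(1-3) by (intro U0.rep_diff U0.rep_scale rep_gen)
    also have "tg (Hh a) - q powi (- a) \<bullet> tg (Hh 0) = (- (q powi 0 - q powi (- a))) \<bullet> single (Some (Mon a 0))"
      by (rule hs_eqI) simp
    also have "\<dots> = (- qdiff 0 (- a)) \<bullet> gen0 b"
      unfolding h_qdiff[symmetric] by (simp add: Some m 1 wt.simps mult.commute)
    finally show ?thesis unfolding lifts_def Some m using a 1 by (intro exI[of _ "- qdiff 0 (- a)"]) (simp add: Some m)
  next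
    case 2
    have "lifts (T.Xr te (nat j - 1) a) (Some (Mon a (1 * int (nat j - 1 + 1))))"
      by (rule lifts_Xr[where c = "\<lambda>_. 1"]) auto
    then show ?thesis using 2 by (simp add: Some m)
  next
    case 3
    have "lifts (T.Xr tf (nat (- j) - 1) a) (Some (Mon a (- 1 * int (nat (- j) - 1 + 1))))"
      by (rule lifts_Xr[where c = "\<lambda>a. - (q powi (- a))"]) auto
    then show ?thesis using 3 by (simp add: Some m)
  qed
qed

subsection \<open>Surjectivity\<close>

lemma L0_hit: "p \<in> L0 \<Longrightarrow> \<exists>x. U0.rep (Th x) p"
proof (induction rule: L0.induct)
  case (base b)
  obtain v where v: "v $ 0 \<noteq> 0" "U0.rep (Th (basis_lift b)) (v \<bullet> gen0 b)"
    using lifts_basis_lift[OF base] unfolding lifts_def by blast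
  have "U0.rep (Th (inverse v \<bullet> basis_lift b)) (inverse v \<bullet> v \<bullet> gen0 b)"
    unfolding Th_simps(3) by (rule U0.rep_scale[OF v(2)])
  moreover have "inverse v \<bullet> v \<bullet> gen0 b = gen0 b" using v(1) by (simp add: inverse_mult_eq_1)
  ultimately show ?case by auto
next
  case (add x y)
  then obtain x' y' where "U0.rep (Th x') x" "U0.rep (Th y') y" by blast
  then have "U0.rep (Th (x' + y')) (x + y)" unfolding Th_simps(1) by (rule U0.rep_add)
  then show ?case by blast
next
  case (smult x c)
  then obtain x' where "U0.rep (Th x') x" by blast
  then have "U0.rep (Th (c \<bullet> x')) (c \<bullet> x)" unfolding Th_simps(3) by (rule U0.rep_scale)
  then show ?case by blast
qed

lemma word_hit: "w \<in> lists (carrier bar_dq0) \<Longrightarrow> \<exists>x. single w - Th x \<in> U0.U"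
proof (induction w)
  case Nil
  have "single [] - Th 1 = 0" unfolding Th_simps(5) by (simp add: one_list)
  then show ?case using hclosed_zero[OF U0.U_hclosed] by metis
next
  case (Cons p w)
  then obtain x where x: "single w - Th x \<in> U0.U" by auto
  obtain p' where p': "p = barof p'" "p' \<in> L0" using Cons.prems by (auto simp: bar_dq0_carrier)
  then obtain y where "U0.rep (Th y) p'" using L0_hit by blast
  then have "Th y - lt p' \<in> U0.U" by (simp add: U0.rep_def)
  then have y: "lt p' - Th y \<in> U0.U" using hclosed_minus[OF U0.U_hclosed] by fastforce
  have w: "single w \<in> U0.F" using Cons.prems by (simp add: free_on_single)
  have "(lt p' - Th y) * single w + Th y * (single w - Th x) \<in> U0.U"
    by (rule hclosed_add[OF U0.U_hclosed U0.U_right[OF y w] U0.U_left[OF x Th_F]])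
  also have "(lt p' - Th y) * single w + Th y * (single w - Th x) = single (p # w) - Th (y * x)"
    by (simp add: left_diff_distrib right_diff_distrib Th_simps p')
  finally show ?case by blast
qed

text \<open>
  Words in the letters of the enveloping algebra have preimages; an arbitrary element is a convergent
  combination of words, and the corresponding combination of preimages converges too.
\<close>

lemma Th_surj: "y \<in> U0.F \<Longrightarrow> \<exists>x. y - Th x \<in> U0.U"
proof -
  assume y: "y \<in> U0.F"
  obtain X where X: "\<And>w. w \<in> lists (carrier bar_dq0) \<Longrightarrow> single w - Th (X w) \<in> U0.U"
    using word_hit by metis
  have "y - Th (ext X y) \<in> U0.U"
  proof (rule hlin_mem_closed[where T = "\<lambda>y. y - Th (ext X y)", OF _ U0.U_hclosed])
    show "hlin (\<lambda>y. y - Th (ext X y))" by (intro hlin_diff_intro hlin_id_intro hlin_comp[OF hlin_Th hlin_ext])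
    show "single w - Th (ext X (single w)) \<in> U0.U" if "w \<in> supp y" for w
    proof -
      have "w \<in> lists (carrier bar_dq0)" using that y unfolding free_on_def by blast
      then show ?thesis unfolding ext_single by (rule X)
    qed
  qed
  then show ?thesis by blast
qed

section \<open>Ordered monomials span\<close>

abbreviation eta :: "zd option \<Rightarrow> tor0" where "eta b \<equiv> cl (basis_lift b)"

abbreviation etas :: "tor0 set" where "etas \<equiv> Q.span (eta ` ix0)"

lemma etas_H: "qH a \<in> etas"
proof -
  have 0: "- qH 0 \<in> etas" by (rule Q.span_base) (auto simp: ix0_def cl_ops intro!: image_eqI[of _ _ None])
  then have 00: "qH 0 \<in> etas" using Q.span_neg by fastforce
  show ?thesis
  proof (cases "a = 0")
    case False
    have "eta (Some (Mon a 0)) \<in> etas" by (rule Q.span_base, rule imageI) (use False in \<open>simp add: ix0_def\<close>)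
    moreover have "eta (Some (Mon a 0)) = qH a - qH 0" by (simp add: cl_ops cl_scale)
    ultimately show ?thesis using Q.span_add[OF _ 00] by fastforce
  qed (simp add: 00)
qed

lemma etas_X: "Q.Xr qe n a \<in> etas" "Q.Xr qf n a \<in> etas"
proof -
  have "eta (Some (Mon a (int (n + 1)))) \<in> etas" by (rule Q.span_base, rule imageI) (simp add: ix0_def)
  moreover have "eta (Some (Mon a (int (n + 1)))) = Q.Xr qe n a" by (simp add: cl_Xr nat_add_distrib)
  ultimately show "Q.Xr qe n a \<in> etas" by simp
  have "eta (Some (Mon a (- int (n + 1)))) \<in> etas" by (rule Q.span_base, rule imageI) (simp add: ix0_def)
  moreover have "eta (Some (Mon a (- int (n + 1)))) = Q.Xr qf n a" by (simp add: cl_Xr nat_add_distrib)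
  ultimately show "Q.Xr qf n a \<in> etas" by simp
qed

lemma span_bilinear:
  assumes "x \<in> Q.span A" "y \<in> Q.span B" and W: "Q.subspace W"
    and AB: "\<And>a b. a \<in> A \<Longrightarrow> b \<in> B \<Longrightarrow> f a b \<in> W"
    and f: "\<And>a a' b. f (a + a') b = f a b + f a' b" "\<And>a b b'. f a (b + b') = f a b + f a b'"
      "\<And>c a b. f (sct c a) b = sct c (f a b)" "\<And>c a b. f a (sct c b) = sct c (f a b)"
  shows "f x y \<in> W"
proof -
  have z: "f 0 b = 0" "f a 0 = 0" for a b using f(3)[of 0 0 b] f(4)[of a 0 0] by simp_all
  have 1: "f a y \<in> W" if "a \<in> A" for a
    using assms(2)
  proof (induction rule: Q.span_induct)
    case base
    show ?case using W by (auto simp: Q.subspace_def z f)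
  next
    case (step y)
    then show ?case using AB that by blast
  qed
  show ?thesis
    using assms(1)
  proof (induction rule: Q.span_induct)
    case base
    show ?case using W by (auto simp: Q.subspace_def z f)
  next
    case (step x)
    then show ?case by (rule 1)
  qed
qed

text \<open>
  Modulo \<open>h\<close> the lifts span a Lie algebra.
\<close>

lemma etas_bra:
  assumes "b \<in> ix0" "b' \<in> ix0" shows "bra (eta b) (eta b') \<in> etas"
proof -
  define G where "G = range qH \<union> {Q.Xr qe n a | n a. True} \<union> {Q.Xr qf n a | n a. True}"
  note mixed = Q.bra_mixed[of qH qe qf, OF qrel(3) qrel(4) qrel(2)]
  have swap: "bra y x = - bra x y" for x y :: tor0 by simp
  have Hz: "bra (qH i) g = 0" if "g \<in> G" for i g
    using that mixed(1,2) qrel(1) unfolding G_def by blast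
  have Hz': "bra g (qH i) = 0" if "g \<in> G" for i g
    using Hz[OF that, of i] by simp
  have X: "bra (Q.Xr qe n a) (Q.Xr qe m c) \<in> etas" "bra (Q.Xr qf n a) (Q.Xr qf m c) \<in> etas" for n m a c
    using Q.bra_Xr_Xr[of qe n a m c, OF poisson_rule_e] Q.bra_Xr_Xr[of qf n a m c, OF poisson_rule_f] Q.span_scale[OF etas_X(1)] Q.span_scale[OF etas_X(2)]
    by metis+
  have ef: "bra (Q.Xr qe n a) (Q.Xr qf m c) \<in> etas" for n m a c
    unfolding mixed(3) using etas_H Q.span_zero by simp
  have fe: "bra (Q.Xr qf n a) (Q.Xr qe m c) \<in> etas" for n m a c
    unfolding swap[of "Q.Xr qf n a"] using Q.span_neg[OF ef] by simp
  have GG: "bra g g' \<in> etas" if gg: "g \<in> G" "g' \<in> G" for g g'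
  proof -
    consider i where "g = qH i" | i where "g' = qH i" | n a m c where "g = Q.Xr qe n a" "g' = Q.Xr qe m c"
      | n a m c where "g = Q.Xr qe n a" "g' = Q.Xr qf m c" | n a m c where "g = Q.Xr qf n a" "g' = Q.Xr qe m c"
      | n a m c where "g = Q.Xr qf n a" "g' = Q.Xr qf m c"
      using gg unfolding G_def by blast
    then show ?thesis
    proof cases
      case 1 then show ?thesis using Hz[OF gg(2)] Q.span_zero by simp
    next
      case 2 then show ?thesis using Hz'[OF gg(1)] Q.span_zero by simp
    qed (use X ef fe in blast)+
  qed
  have xi_G: "eta t \<in> Q.span G" if "t \<in> ix0" for t
  proof (cases t rule: basis_lift.cases)
    case 1
    have "- qH 0 \<in> Q.span G" by (intro Q.span_neg Q.span_base) (simp add: G_def)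
    then show ?thesis by (simp add: 1 cl_ops)
  next
    case (2 a j)
    have "qH a - qH 0 \<in> Q.span G" by (intro Q.span_diff Q.span_base) (simp_all add: G_def)
    moreover have "Q.Xr qe n a \<in> Q.span G" for n
      by (rule Q.span_base) (unfold G_def, blast)
    moreover have "Q.Xr qf n a \<in> Q.span G" for n
      by (rule Q.span_base) (unfold G_def, blast)
    ultimately show ?thesis by (simp add: 2 cl_ops cl_scale cl_Xr)
  qed
  show ?thesis
    by (rule span_bilinear[where f = "\<lambda>x y. bra x y", OF xi_G[OF assms(1)] xi_G[OF assms(2)] Q.subspace_span GG])
       (simp_all add: algebra_simps Q.sc_left Q.sc_right Q.scale_right_diff_distrib)
qed

definition lifted_monomial :: "zd option list \<Rightarrow> tor_gen list hs" where "lifted_monomial w = prod_list (map basis_lift w)"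

definition sorted_words :: "zd option list set" where "sorted_words = {w \<in> lists ix0. sorted w}"

text \<open>
  The residue classes of (convergent, hence modulo \<open>h\<close> finite) combinations of ordered monomials.
\<close>

definition monomial_span :: "tor0 set" where "monomial_span = {cl (ext lifted_monomial m) | m. supp m \<subseteq> sorted_words}"

lemma supp_single [simp]: "supp (single w) = {w}"
  by (auto simp: supp_def)

lemma supp_subset_iff: "supp m \<subseteq> S \<longleftrightarrow> (\<forall>i. i \<notin> S \<longrightarrow> coef m i = 0)"
  by (auto simp: supp_def)

lemma supp_hclosed: "hclosed {m. supp m \<subseteq> S}"
  unfolding hclosed_def supp_subset_iff mem_Collect_eq
proof (intro conjI allI impI ballI)
  fix x :: "'a hs" and i
  assume *: "\<forall>n. \<exists>y. \<forall>i. i \<notin> S \<longrightarrow> coef (x - h ^ n \<bullet> y) i = 0" and i: "i \<notin> S"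
  show "coef x i = 0"
  proof (rule h_adic_separated)
    fix n
    obtain y where "coef (x - h ^ n \<bullet> y) i = 0" using * i by blast
    then have "coef x i = h ^ n * coef y i" by simp
    then show "h ^ n dvd coef x i" by simp
  qed
qed auto

lemma monomial_span_subspace: "Q.subspace monomial_span"
  unfolding Q.subspace_def
proof (intro conjI allI ballI)
  have "0 = cl (ext lifted_monomial 0)" by (simp add: hlin_zero[OF hlin_ext] cl_ops)
  then show "0 \<in> monomial_span" unfolding monomial_span_def using hclosed_zero[OF supp_hclosed[of sorted_words]] by blast
  fix x assume "x \<in> monomial_span"
  then obtain m where m: "x = cl (ext lifted_monomial m)" "supp m \<subseteq> sorted_words" unfolding monomial_span_def by blast
  show "sct c x \<in> monomial_span" for c
  proof -
    have "sct c x = cl (ext lifted_monomial (fps_const c \<bullet> m))"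
      by (simp add: m hlin_scale[OF hlin_ext] cl_scale)
    moreover have "supp (fps_const c \<bullet> m) \<subseteq> sorted_words" using hclosed_scale[OF supp_hclosed[of sorted_words]] m(2) by blast
    ultimately show ?thesis unfolding monomial_span_def by blast
  qed
  fix y assume "y \<in> monomial_span"
  then obtain m' where m': "y = cl (ext lifted_monomial m')" "supp m' \<subseteq> sorted_words" unfolding monomial_span_def by blast
  have "x + y = cl (ext lifted_monomial (m + m'))" by (simp add: m m' hlin_add[OF hlin_ext] cl_ops)
  moreover have "supp (m + m') \<subseteq> sorted_words" using hclosed_add[OF supp_hclosed[of sorted_words]] m(2) m'(2) by blast
  ultimately show "x + y \<in> monomial_span" unfolding monomial_span_def by blast
qed

lemma cl_lifted_monomial: "cl (lifted_monomial w) = prod_list (map eta w)"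
  by (induction w) (simp_all add: lifted_monomial_def cl_ops)

text \<open>
  Sorting, by induction on length and number of inversions.
\<close>

lemma monomial_span_word: "w \<in> lists ix0 \<Longrightarrow> cl (lifted_monomial w) \<in> monomial_span"
proof (induction w rule: wf_induct[OF wf_measures[of "[length, inv_count]"], consumes 0, case_names less])
  case (less w)
  show ?case
  proof (cases "sorted w")
    case True
    then show ?thesis using less(2) unfolding monomial_span_def sorted_words_def
      by (auto intro!: exI[of _ "single w"])
  next
    case False
    define u where "u = take (dpos w) w"
    define x where "x = w ! dpos w"
    define y where "y = w ! Suc (dpos w)"
    define v where "v = drop (dpos w + 2) w"
    have w: "w = u @ x # y # v" and yx: "y < x"
      using dpos_descent[OF False] by (simp_all add: u_def x_def y_def v_def)
    have ix: "u \<in> lists ix0" "x \<in> ix0" "y \<in> ix0" "v \<in> lists ix0"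
      using less(2) unfolding w by auto
    let ?u = "prod_list (map eta u)" and ?v = "prod_list (map eta v)"
    have "cl (lifted_monomial (u @ y # x # v)) \<in> monomial_span"
      using less(1) inv_count_swap[OF yx, of u v] ix unfolding w by auto
    moreover have "?u * bra (eta x) (eta y) * ?v \<in> monomial_span"
    proof -
      have t: "?u * eta t * ?v \<in> monomial_span" if "t \<in> ix0" for t
      proof -
        have "cl (lifted_monomial (u @ t # v)) \<in> monomial_span" using less(1) ix that unfolding w by auto
        then show ?thesis by (simp add: cl_lifted_monomial mult.assoc)
      qed
      have b: "bra (eta x) (eta y) \<in> etas" by (rule etas_bra[OF ix(2,3)])
      have o: "(1::tor0) \<in> Q.span {1}" by (rule Q.span_base) simp
      show ?thesis
        using span_bilinear[where f = "\<lambda>a b. ?u * (a * b) * ?v", OF b o monomial_span_subspace] t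
        by (auto simp: algebra_simps Q.sc_left Q.sc_right)
    qed
    ultimately have "cl (lifted_monomial (u @ y # x # v)) + ?u * bra (eta x) (eta y) * ?v \<in> monomial_span"
      using monomial_span_subspace unfolding Q.subspace_def by blast
    also have "cl (lifted_monomial (u @ y # x # v)) + ?u * bra (eta x) (eta y) * ?v = cl (lifted_monomial w)"
      unfolding w cl_lifted_monomial by (simp add: algebra_simps)
    finally show ?thesis .
  qed
qed

lemma cl_gen: "cl (single [g]) \<in> etas"
proof (cases g)
  case (Ee i) then show ?thesis using etas_X(1)[of 0 i] by simp
next
  case (Ff i) then show ?thesis using etas_X(2)[of 0 i] by simp
next
  case (Hh i) then show ?thesis using etas_H[of i] by simp
qed

lemma cl_word: "cl (single w) \<in> Q.span {cl (lifted_monomial u) | u. u \<in> lists ix0}"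
proof (induction w)
  case Nil
  have "cl (single []) = cl (lifted_monomial [])" by (simp add: lifted_monomial_def one_list)
  then show ?case by (intro Q.span_base) blast
next
  case (Cons g w)
  have "cl (single (g # w)) = cl (single [g]) * cl (single w)" by (simp add: cl_ops(3)[symmetric])
  also have "\<dots> \<in> Q.span {cl (lifted_monomial u) | u. u \<in> lists ix0}"
  proof (rule span_bilinear[where f = "(*)", OF cl_gen Cons Q.subspace_span])
    fix a b assume "a \<in> eta ` ix0" "b \<in> {cl (lifted_monomial u) | u. u \<in> lists ix0}"
    then obtain t u where tu: "t \<in> ix0" "u \<in> lists ix0" "a = eta t" "b = cl (lifted_monomial u)" by blast
    have "a * b = cl (lifted_monomial (t # u))" by (simp add: tu cl_lifted_monomial)
    moreover have "t # u \<in> lists ix0" using tu by simp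
    ultimately show "a * b \<in> Q.span {cl (lifted_monomial u) | u. u \<in> lists ix0}" by (intro Q.span_base) blast
  qed (simp_all add: algebra_simps Q.sc_left Q.sc_right)
  finally show ?case .
qed

lemma monomial_span_UNIV: "cl x \<in> monomial_span"
proof -
  have sub: "Q.span {cl (lifted_monomial u) | u. u \<in> lists ix0} \<subseteq> monomial_span"
    by (rule Q.span_minimal[OF _ monomial_span_subspace]) (use monomial_span_word in blast)
  obtain y where y: "x = (\<Sum>w | \<not> h ^ 1 dvd coef x w. coef x w \<bullet> single w) + h ^ 1 \<bullet> y"
    by (rule hs_approx)
  have "cl (h ^ 1 \<bullet> y) = 0" by (simp add: cl_scale)
  then have "cl x = (\<Sum>w | \<not> h ^ 1 dvd coef x w. sct (coef x w $ 0) (cl (single w)))"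
    by (subst y) (simp only: cl_ops(1) cl_sum cl_scale add_0_right)
  also have "\<dots> \<in> monomial_span"
    by (rule Q.subspace_sum[OF monomial_span_subspace], rule Q.subspace_scale[OF monomial_span_subspace]) (use cl_word sub in blast)
  finally show ?thesis .
qed

text \<open>The geometric series \<open>\<Sum>\<^sub>k h\<^sup>k \<cdot> k\<close>, used to sum successive \<open>h\<close>-adic approximations.\<close>

definition hpows :: "nat hs" where "hpows = Abs_hs (\<lambda>k. h ^ k)"

lemma coef_hpows: "coef hpows k = h ^ k"
proof -
  have "finite {k. \<not> h ^ n dvd h ^ k}" for n :: nat
  proof (rule finite_subset[of _ "{..<n}"])
    show "{k. \<not> h ^ n dvd h ^ k} \<subseteq> {..<n}"
    proof
      fix k assume "k \<in> {k. \<not> h ^ n dvd h ^ k}"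
      then have "\<not> n \<le> k" using le_imp_power_dvd[of n k h] by blast
      then show "k \<in> {..<n}" by simp
    qed
  qed simp
  then show ?thesis unfolding hpows_def by (subst Abs_hs_inverse) auto
qed

lemma hpows_shift: "hpows = single 0 + h \<bullet> ext (\<lambda>k. single (Suc k)) hpows"
proof (rule hs_eqI)
  fix k
  have "coef (ext (\<lambda>k. single (Suc k)) hpows) (Suc n) = coef (ext single hpows) n" for n
    by (rule coef_hlin_eqI[where S = "ext (\<lambda>k. single (Suc k))" and T = "ext single", OF hlin_ext hlin_ext]) simp
  moreover have "coef (ext (\<lambda>k. single (Suc k)) hpows) 0 = coef (0 :: nat hs) 0"
    by (rule coef_hlin_eqI[where S = "ext (\<lambda>k. single (Suc k))" and T = "\<lambda>_. 0", OF hlin_ext hlin_zero_intro]) simp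
  ultimately show "coef hpows k = coef (single 0 + h \<bullet> ext (\<lambda>k. single (Suc k)) hpows) k"
    by (cases k) (simp_all add: coef_hpows)
qed

lemma ext_hpows: "ext x hpows = x 0 + h \<bullet> ext (\<lambda>k. x (Suc k)) hpows"
proof -
  have "ext x hpows = ext x (single 0 + h \<bullet> ext (\<lambda>k. single (Suc k)) hpows)"
    using hpows_shift by simp
  also have "\<dots> = x 0 + h \<bullet> ext x (ext (\<lambda>k. single (Suc k)) hpows)"
    by (simp add: hlin_add[OF hlin_ext] hlin_scale[OF hlin_ext])
  also have "ext x (ext (\<lambda>k. single (Suc k)) hpows) = ext (\<lambda>k. x (Suc k)) hpows"
    by (simp add: hlin_ext_comp[OF hlin_ext])
  finally show ?thesis .
qed

text \<open>
  Repeated approximation modulo \<open>h\<close>: if, modulo the relations, \<open>x\<^sub>k\<close> is the combination \<open>m\<^sub>k\<close> of ordered monomials up to \<open>h x\<^sub>k\<^sub>+\<^sub>1\<close>,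
  then \<open>x\<^sub>0\<close> is the combination with coefficients \<open>\<Sum>\<^sub>k h\<^sup>k m\<^sub>k\<close>, by telescoping.
\<close>

lemma spanning: "\<exists>M. supp M \<subseteq> sorted_words \<and> x - ext lifted_monomial M \<in> TR"
proof -
  have "\<exists>my. supp (fst my) \<subseteq> sorted_words \<and> x - ext lifted_monomial (fst my) - h \<bullet> snd my \<in> TR" for x
  proof -
    obtain m where m: "supp m \<subseteq> sorted_words" "cl x = cl (ext lifted_monomial m)" using monomial_span_UNIV[of x] unfolding monomial_span_def by blast
    then obtain y where "x - ext lifted_monomial m - h \<bullet> y \<in> TR" unfolding cl_eq_iff TRh_def by blast
    then show ?thesis using m by (intro exI[of _ "(m, y)"]) simp
  qed
  then obtain F where F: "\<And>x. supp (fst (F x)) \<subseteq> sorted_words" "\<And>x. x - ext lifted_monomial (fst (F x)) - h \<bullet> snd (F x) \<in> TR"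
    by metis
  define X where "X k = ((\<lambda>x. snd (F x)) ^^ k) x" for k
  define m where "m k = fst (F (X k))" for k
  have X: "X 0 = x" "X (Suc k) = snd (F (X k))" for k by (simp_all add: X_def)
  let ?T = "ext (\<lambda>k. X k - ext lifted_monomial (m k) - h \<bullet> X (Suc k))"
  have "?T hpows \<in> TR"
    by (rule hlin_mem_closed[OF hlin_ext TR_hclosed]) (use F(2) in \<open>simp add: m_def X\<close>)
  also have "?T hpows = ext X hpows - ext (\<lambda>k. ext lifted_monomial (m k)) hpows - h \<bullet> ext (\<lambda>k. X (Suc k)) hpows"
    by (rule hlin_eqI[where x = hpows]) (auto intro!: hlin_intro)
  also have "\<dots> = x - ext lifted_monomial (ext m hpows)"
    unfolding ext_hpows[of X] X(1) hlin_ext_comp[OF hlin_ext, of lifted_monomial m] by simp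
  finally have "x - ext lifted_monomial (ext m hpows) \<in> TR" .
  moreover have "ext m hpows \<in> {m. supp m \<subseteq> sorted_words}"
    by (rule hlin_mem_closed[OF hlin_ext supp_hclosed]) (use F(1) in \<open>simp add: m_def\<close>)
  ultimately show ?thesis by blast
qed

section \<open>Injectivity\<close>

text \<open>Ordered monomials in the lifted basis have, up to nonzero scalars, distinct normal forms.\<close>

lemma normal_form_lifted_monomial:
  assumes "w \<in> lists ix0"
  shows "\<exists>c. c \<noteq> 0 \<and> (\<exists>z. Th (lifted_monomial w) - z \<in> U.U \<and> coords z = c \<bullet> single w)"
  using assms
proof (induction w)
  case Nil
  have "Th (lifted_monomial []) - 1 = 0" by (simp add: lifted_monomial_def Th_simps)
  then have "Th (lifted_monomial []) - 1 \<in> U.U" using hclosed_zero[OF U.U_hclosed] by simp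
  moreover have "coords 1 = 1 \<bullet> single []" by (subst coords_simps(5)) (simp add: one_list)
  ultimately show ?case using zero_neq_one by metis
next
  case (Cons b w)
  then have b: "b \<in> ix0" and w: "w \<in> lists ix0" by auto
  obtain c z where c: "c \<noteq> 0" "Th (lifted_monomial w) - z \<in> U.U" "coords z = c \<bullet> single w" using Cons.IH w by blast
  obtain v where v: "v $ 0 \<noteq> 0" "U0.rep (Th (basis_lift b)) (v \<bullet> gen0 b)" using lifts_basis_lift[OF b] unfolding lifts_def by blast
  obtain d where d: "d \<noteq> 0" "gen0 b = d \<bullet> single b"
    by (cases b rule: gen0.cases) (auto intro: that[of 1] that[of "h ^ _"])
  have 1: "Th (basis_lift b) - lt (v \<bullet> gen0 b) \<in> U.U" using v(2) U0_sub unfolding U0.rep_def by blast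
  have F: "y \<in> U.F" if "y \<in> U0.F" for y using that F0_sub by blast
  have "(Th (basis_lift b) - lt (v \<bullet> gen0 b)) * Th (lifted_monomial w) + lt (v \<bullet> gen0 b) * (Th (lifted_monomial w) - z) \<in> U.U"
    by (rule hclosed_add[OF U.U_hclosed U.U_right[OF 1 F[OF Th_F]] U.U_left[OF c(2) U.lt_F]]) simp
  also have "(Th (basis_lift b) - lt (v \<bullet> gen0 b)) * Th (lifted_monomial w) + lt (v \<bullet> gen0 b) * (Th (lifted_monomial w) - z)
     = Th (lifted_monomial (b # w)) - lt (v \<bullet> gen0 b) * z"
    by (simp add: lifted_monomial_def Th_simps algebra_simps)
  finally have "Th (lifted_monomial (b # w)) - lt (v \<bullet> gen0 b) * z \<in> U.U" .
  moreover have "coords (lt (v \<bullet> gen0 b) * z) = (v * d * c) \<bullet> single (b # w)"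
    by (simp add: coords_simps coords_lt c(3) d(2) hlin_scale[OF hlin_ext] mult_ac)
  moreover have "v * d * c \<noteq> 0" using v(1) d(1) c(1) by auto
  ultimately show ?case by metis
qed

text \<open>
  Write \<open>x\<close> as a convergent combination \<open>M\<close> of ordered monomials. Taking normal forms of the image
  multiplies the coefficients of \<open>M\<close> by nonzero scalars \<open>C\<close>.
\<close>

lemma Th_inj: "Th x \<in> U.U \<Longrightarrow> x \<in> TR"
proof -
  assume x: "Th x \<in> U.U"
  obtain M where M: "supp M \<subseteq> sorted_words" "x - ext lifted_monomial M \<in> TR" using spanning by blast
  have "Th (x - ext lifted_monomial M) \<in> U.U" using Th_TR[OF M(2)] U0_sub by blast
  then have "Th x - Th (ext lifted_monomial M) \<in> U.U" by (simp only: Th_simps(2))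
  from hclosed_diff[OF U.U_hclosed x this] have "Th (ext lifted_monomial M) \<in> U.U" by simp
  then have 0: "pbw (coords (Th (ext lifted_monomial M))) = 0" by (rule pbw_coords_Rel)
  obtain C where C: "\<And>w. w \<in> sorted_words \<Longrightarrow> C w \<noteq> 0 \<and> (\<exists>z. Th (lifted_monomial w) - z \<in> U.U \<and> coords z = C w \<bullet> single w)"
    using normal_form_lifted_monomial unfolding sorted_words_def by (metis (no_types, lifting) mem_Collect_eq)
  define \<Phi> where "\<Phi> = (\<lambda>M. pbw (coords (Th (ext lifted_monomial M))))"
  have lin: "hlin \<Phi>"
    unfolding \<Phi>_def by (intro hlin_comp[OF hlin_pbw] hlin_comp[OF hlin_coords] hlin_comp[OF hlin_Th] hlin_ext)
  have \<Phi>w: "\<Phi> (single w) = C w \<bullet> single w" if w: "w \<in> sorted_words" for w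
  proof -
    obtain z where z: "Th (lifted_monomial w) - z \<in> U.U" "coords z = C w \<bullet> single w" using C[OF w] by blast
    have "pbw (coords (Th (lifted_monomial w) - z)) = 0" by (rule pbw_coords_Rel[OF z(1)])
    then have "pbw (coords (Th (lifted_monomial w))) = pbw (coords z)"
      by (simp add: coords_simps hlin_diff[OF hlin_pbw])
    then show ?thesis using w
      by (simp add: \<Phi>_def z(2) hlin_scale[OF hlin_pbw] pbw_sorted sorted_words_def)
  qed
  define C' where "C' w = (if w \<in> sorted_words then C w else 0)" for w
  have "\<Phi> M - ext (\<lambda>w. C' w \<bullet> single w) M \<in> {0}"
    by (rule hlin_mem_closed[where T = "\<lambda>M. \<Phi> M - ext (\<lambda>w. C' w \<bullet> single w) M", OF hlin_diff_intro[OF lin hlin_ext] hclosed_singleton_zero])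
       (use M(1) \<Phi>w in \<open>auto simp: C'_def\<close>)
  then have z: "ext (\<lambda>w. C' w \<bullet> single w) M = 0" using 0 by (simp add: \<Phi>_def)
  have "coef M w = 0" for w
  proof (cases "w \<in> sorted_words")
    case True
    have "coef (ext (\<lambda>w. C' w \<bullet> single w) M) w = coef (C' w \<bullet> M) w"
      by (rule coef_hlin_eqI[where T = "\<lambda>M. C' w \<bullet> M"]) (auto intro!: hlin_ext hlin_scale_intro hlin_id_intro)
    then have "C w * coef M w = 0" using z True by (simp add: C'_def)
    then show ?thesis using C[OF True] by simp
  next
    case False
    then show ?thesis using M(1) by (auto simp: supp_def)
  qed
  then have "M = 0" by (intro hs_eqI) simp
  then show ?thesis using M(2) by (simp add: hlin_zero[OF hlin_ext])
qed

section \<open>The isomorphism\<close>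

abbreviation clT where "clT \<equiv> cls UNIV tor_rels"
abbreviation clU where "clU \<equiv> cls (carrier bar_dq) (uea_rels bar_dq)"
abbreviation clU0 where "clU0 \<equiv> cls (carrier bar_dq0) (uea_rels bar_dq0)"

lemma theta_generators_iff:
  "theta_on_generators \<theta> \<longleftrightarrow> (\<forall>g. \<theta> (clT (single [g])) = clU (lt (tg g)))"
proof -
  have b: "barof (tg (Ee i)) = (Zpow i \<otimes>\<^bsub>dq\<^esub> Dpow 1, 0)"
    "barof (tg (Ff i)) = (\<ominus>\<^bsub>dq\<^esub> (Dpow (-1) \<otimes>\<^bsub>dq\<^esub> Zpow i), 0)"
    "barof (tg (Hh i)) = ((- (1 - q powi (-i))) \<odot>\<^bsub>dq\<^esub> Zpow i, - (q powi (-i)))" for i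
    by (simp_all add: barof_def Zpow_dqof Dpow_dqof dqof_ops dqof_uminus single_mult_zd hlin_minus[OF hlin_dpart])
  have all: "(\<forall>g. P g) \<longleftrightarrow> (\<forall>i. P (Ee i) \<and> P (Ff i) \<and> P (Hh i))" for P by (metis tor_gen.exhaust)
  show ?thesis
    unfolding theta_on_generators_def tor_e_def tor_f_def tor_H_def uea_of_def all b
      pgen_cls[OF tor_rels_carrier] pgen_cls[OF U.uea_rels_carrier] ..
qed

text \<open>
  Algebra homomorphisms are continuous because they are linear over \<open>\<complex>[[h]]\<close> and the target is
  \<open>h\<close>-adically separated.
\<close>

lemma alg_hom_unique:
  assumes \<theta>: "\<theta> \<in> alg_hom toroidal (uea bar_dq)" and gen: "\<And>g. \<theta> (clT (single [g])) = clU (lt (tg g))"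
  shows "\<theta> (clT x) = clU (Th x)"
proof -
  have hom: "\<theta> (clT (x + y)) = \<theta> (clT x) \<oplus>\<^bsub>uea bar_dq\<^esub> \<theta> (clT y)" "\<theta> (clT (x * y)) = \<theta> (clT x) \<otimes>\<^bsub>uea bar_dq\<^esub> \<theta> (clT y)"
    "\<theta> (clT (c \<bullet> x)) = c \<odot>\<^bsub>uea bar_dq\<^esub> \<theta> (clT x)" "\<theta> (clT 1) = \<one>\<^bsub>uea bar_dq\<^esub>" "\<theta> (clT x) \<in> carrier (uea bar_dq)" for x y c
    using \<theta> unfolding alg_hom_def ring_hom_def toroidal_def
    by (auto simp: presented_ops[OF tor_rels_carrier, symmetric] presented_carrier[OF tor_rels_carrier])
  have ThF: "Th x \<in> U.F" for x using Th_F F0_sub by blast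
  note ops = presented_ops[OF U.uea_rels_carrier, folded uea_def]
  have word: "\<theta> (clT (single w)) = clU (Th (single w))" for w
  proof (induction w)
    case Nil
    show ?case unfolding one_list[symmetric] hom(4) Th_simps(5) ops ..
  next
    case (Cons g w)
    have 1: "single (g # w) = single [g] * single w" by simp
    show ?case
      unfolding 1 hom(2) Th_simps(4) Cons gen Th_gen by (rule ops(1)) (simp_all add: ThF U.lt_F)
  qed
  have z0: "\<theta> (clT 0) = clU (Th 0)"
    using hom(3)[of 0 0] ops(5)[of 0] hom(5)[of 0]
    by (auto simp: uea_def presented_carrier[OF U.uea_rels_carrier] presented_ops[OF U.uea_rels_carrier] Th_def hlin_zero[OF hlin_hsubst])
  have fin: "\<theta> (clT (\<Sum>w\<in>A. c w \<bullet> single w)) = clU (Th (\<Sum>w\<in>A. c w \<bullet> single w))" if "finite A" for A c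
    using that
  proof induction
    case empty
    show ?case using z0 by simp
  next
    case (insert w A)
    then show ?case
      by (simp only: sum.insert[OF insert(1,2)] hom(1,3) word Th_simps(1,3) ops(5))
         (rule ops(2), auto intro: ThF free_on_closed)
  qed
  obtain z where z: "z \<in> U.F" "\<theta> (clT x) = clU z"
    using hom(5)[of x] by (auto simp: uea_def presented_carrier[OF U.uea_rels_carrier])
  have "z - Th x \<in> U.U"
  proof (rule hclosed_limit[OF U.U_hclosed])
    fix n
    obtain y where y: "x = (\<Sum>w | \<not> h ^ n dvd coef x w. coef x w \<bullet> single w) + h ^ n \<bullet> y" (is "_ = ?s + _")
      by (rule hs_approx)
    obtain z' where z': "z' \<in> U.F" "\<theta> (clT y) = clU z'"
      using hom(5)[of y] by (auto simp: uea_def presented_carrier[OF U.uea_rels_carrier])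
    have "clU z = \<theta> (clT (?s + h ^ n \<bullet> y))" using z(2) y by simp
    also have "\<dots> = clU (Th ?s) \<oplus>\<^bsub>uea bar_dq\<^esub> clU (h ^ n \<bullet> z')"
      unfolding hom(1,3) fin[OF finite_coef] z'(2) ops(5) ..
    also have "\<dots> = clU (Th ?s + h ^ n \<bullet> z')" by (rule ops(2)) (simp_all add: ThF free_on_closed z')
    finally have "z - (Th ?s + h ^ n \<bullet> z') \<in> U.U" by (simp add: cls_eq_iff[OF U.uea_rels_carrier])
    moreover have "Th x = Th ?s + h ^ n \<bullet> Th y" by (subst y) (simp only: Th_simps(1,3))
    ultimately show "\<exists>y. z - Th x - h ^ n \<bullet> y \<in> U.U"
      by (intro exI[of _ "z' - Th y"]) (simp add: hs.scale_right_diff_distrib algebra_simps)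
  qed
  then show ?thesis by (simp add: z(2) cls_eq_iff[OF U.uea_rels_carrier])
qed

theorem theorem5p4:
  shows "uea_incl bar_dq \<in> alg_hom (uea bar_dq0) (uea bar_dq) \<and>
    inj_on (uea_incl bar_dq) (carrier (uea bar_dq0)) \<and>
    (\<exists>\<theta> \<in> alg_hom toroidal (uea bar_dq).
       theta_on_generators \<theta> \<and>
       (\<forall>\<theta>' \<in> alg_hom toroidal (uea bar_dq).
          theta_on_generators \<theta>' \<longrightarrow> (\<forall>x \<in> carrier toroidal. \<theta>' x = \<theta> x)) \<and>
       \<theta> ` carrier toroidal \<subseteq> uea_incl bar_dq ` carrier (uea bar_dq0) \<and>
       (\<exists>\<theta>0 \<in> alg_iso toroidal (uea bar_dq0).
          \<forall>x \<in> carrier toroidal. uea_incl bar_dq (\<theta>0 x) = \<theta> x))"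
proof -
  have Tcar: "carrier toroidal = range clT"
    by (simp add: toroidal_def presented_carrier[OF tor_rels_carrier])
  have U0car: "carrier (uea bar_dq0) = clU0 ` U0.F"
    by (simp add: uea_def presented_carrier[OF U0.uea_rels_carrier])
  have ThU: "Th x \<in> U.U" if "x \<in> TR" for x using Th_TR[OF that] U0_sub by blast
  obtain \<theta> where \<theta>: "\<And>x. \<theta> (clT x) = clU (Th x)"
    using induced_map[OF tor_rels_carrier U.uea_rels_carrier hlin_Th ThU] by auto
  obtain \<theta>0 where \<theta>0: "\<And>x. \<theta>0 (clT x) = clU0 (Th x)"
    using induced_map[OF tor_rels_carrier U0.uea_rels_carrier hlin_Th Th_TR] by auto
  have hom: "\<theta> \<in> alg_hom toroidal (uea bar_dq)"
    unfolding toroidal_def uea_def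
    by (rule alg_homI[OF tor_rels_carrier U.uea_rels_carrier \<theta> hlin_Th Th_simps(5,4)]) (use Th_F F0_sub in blast)
  have hom0: "\<theta>0 \<in> alg_hom toroidal (uea bar_dq0)"
    unfolding toroidal_def uea_def
    by (rule alg_homI[OF tor_rels_carrier U0.uea_rels_carrier \<theta>0 hlin_Th Th_simps(5,4) Th_F])
  have inj0: "inj_on \<theta>0 (carrier toroidal)"
  proof (rule inj_onI)
    fix a b assume "a \<in> carrier toroidal" "b \<in> carrier toroidal" and eq: "\<theta>0 a = \<theta>0 b"
    then obtain x y where xy: "a = clT x" "b = clT y" by (auto simp: Tcar)
    have "Th (x - y) \<in> U0.U" using eq by (simp add: xy \<theta>0 cls_eq_iff[OF U0.uea_rels_carrier] Th_simps)
    then have "x - y \<in> TR" using U0_sub by (intro Th_inj) blast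
    then show "a = b" by (simp add: xy cls_eq_iff[OF tor_rels_carrier])
  qed
  have surj0: "\<theta>0 ` carrier toroidal = carrier (uea bar_dq0)"
  proof
    show "\<theta>0 ` carrier toroidal \<subseteq> carrier (uea bar_dq0)" using Th_F by (auto simp: Tcar U0car \<theta>0)
    show "carrier (uea bar_dq0) \<subseteq> \<theta>0 ` carrier toroidal"
    proof
      fix b assume "b \<in> carrier (uea bar_dq0)"
      then obtain y where y: "y \<in> U0.F" "b = clU0 y" by (auto simp: U0car)
      then obtain x where "y - Th x \<in> U0.U" using Th_surj by blast
      then have "b = \<theta>0 (clT x)" by (simp add: y \<theta>0 cls_eq_iff[OF U0.uea_rels_carrier])
      then show "b \<in> \<theta>0 ` carrier toroidal" by (auto simp: Tcar)
    qed
  qed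
  have iso: "\<theta>0 \<in> alg_iso toroidal (uea bar_dq0)"
    using hom0 inj0 surj0 by (simp add: alg_iso_def bij_betw_def)
  have comp: "uea_incl bar_dq (\<theta>0 x) = \<theta> x" if "x \<in> carrier toroidal" for x
    using that by (auto simp: Tcar \<theta>0 \<theta> uea_incl_cls)
  have inj: "inj_on (uea_incl bar_dq) (carrier (uea bar_dq0))"
  proof (rule inj_onI)
    fix a b assume "a \<in> carrier (uea bar_dq0)" "b \<in> carrier (uea bar_dq0)"
      and eq: "uea_incl bar_dq a = uea_incl bar_dq b"
    then obtain x y where xy: "a = \<theta>0 (clT x)" "b = \<theta>0 (clT y)" unfolding surj0[symmetric] Tcar by blast
    have "Th (x - y) \<in> U.U"
      using eq by (simp add: xy \<theta>0 uea_incl_cls cls_eq_iff[OF U.uea_rels_carrier] Th_simps)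
    then have "x - y \<in> TR" by (rule Th_inj)
    then have "clT x = clT y" by (simp add: cls_eq_iff[OF tor_rels_carrier])
    then show "a = b" by (simp add: xy)
  qed
  have gen: "theta_on_generators \<theta>"
    unfolding theta_generators_iff by (simp add: \<theta> Th_gen)
  have uniq: "\<theta>' x = \<theta> x"
    if "\<theta>' \<in> alg_hom toroidal (uea bar_dq)" "theta_on_generators \<theta>'" "x \<in> carrier toroidal" for \<theta>' x
  proof -
    obtain y where y: "x = clT y" using \<open>x \<in> carrier toroidal\<close> unfolding Tcar by blast
    have "\<theta>' (clT (single [g])) = clU (lt (tg g))" for g
      using \<open>theta_on_generators \<theta>'\<close> unfolding theta_generators_iff by blast
    then show ?thesis unfolding y \<theta> by (rule alg_hom_unique[OF \<open>\<theta>' \<in> alg_hom toroidal (uea bar_dq)\<close>])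
  qed
  have img: "\<theta> ` carrier toroidal \<subseteq> uea_incl bar_dq ` carrier (uea bar_dq0)"
    using comp surj0 by (metis image_eqI image_subsetI)
  show ?thesis using uea_incl_hom inj hom gen uniq img iso comp by blast
qed

end
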